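(* Let $D_a>0$, $L>0$ and fix $\alpha>0$. Consider the optimization problem $\mathbf{E}_\alpha$: minimize $\gamma^2$ over all $\gamma\in\mathbb{R}$ such that (i) the $C_0$-semigroup $(T_{A_{0\gamma}}(t))_{t\ge0}$ generated by $A_{0\gamma}$ on $\mathrm{L}^2(0,L)\times\mathrm{L}^2(0,L)$ is positive and (ii) the $C_0$-semigroup $(T_{SA_\gamma S^{-1}}(t))_{t\ge0}$ generated by $SA_\gamma S^{-1}$ on $\mathrm{L}^2(0,L)$ is $\beta$-exponentially stable for all $\beta\in(-\alpha,0]$. Then $\mathbf{E}_\alpha$ is feasible (i.e. there is at least one $\gamma\in\mathbb{R}$ satisfying (i) and (ii)) if, and only if, $\alpha<\pi^2D_a/(4L^2)$. In this case, $\mathbf{E}_\alpha$ has a unique solution $\gamma_*$, given by $$\gamma_*=-\sqrt{\alpha D_a^{-1}}\,\tan\!\left(L\sqrt{\alpha D_a^{-1}}\right).$$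
   Context: For $\gamma\in\mathbb{R}$, $A_{0\gamma}$ is the operator on $\mathrm{L}^2(0,L)\times\mathrm{L}^2(0,L)$ given by $A_{0\gamma}(x,\tilde x)=\left(D_a\frac{\mathrm{d}^2x}{\mathrm{d}z^2},D_a\frac{\mathrm{d}^2\tilde x}{\mathrm{d}z^2}\right)$ with domain the set of $(x,\tilde x)\in\mathrm{H}^2(0,L)\times\mathrm{H}^2(0,L)$ such that $\frac{\mathrm{d}x}{\mathrm{d}z}(0)=\frac{\mathrm{d}\tilde x}{\mathrm{d}z}(0)=0$, $\frac{\mathrm{d}x}{\mathrm{d}z}(L)=0$ and $\frac{\mathrm{d}\tilde x}{\mathrm{d}z}(L)=-\gamma x(L)+\gamma\tilde x(L)$. (It describes the uncontrolled diffusion system with output $x(L,t)$ together with its observer with gain $\gamma$.) $A_\gamma$ is the operator $D_a\frac{\mathrm{d}^2}{\mathrm{d}z^2}$ on $\mathrm{L}^2(0,L)$ with domain $\{x\in\mathrm{H}^2(0,L):\frac{\mathrm{d}x}{\mathrm{d}z}(0)+\gamma x(0)=0=\frac{\mathrm{d}x}{\mathrm{d}z}(L)\}$, and $(Sx)(z)=x(L-z)$. Hence $SA_\gamma S^{-1}$ is $D_a\frac{\mathrm{d}^2}{\mathrm{d}z^2}$ with domain $\{e\in\mathrm{H}^2(0,L):\frac{\mathrm{d}e}{\mathrm{d}z}(0)=0,\ \frac{\mathrm{d}e}{\mathrm{d}z}(L)=\gamma e(L)\}$ (generator of the estimation error dynamics). A semigroup is positive if it preserves the cone of (componentwise, a.e.)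 nonnegative functions. A $C_0$-semigroup is $\beta$-exponentially stable if its growth bound is less than $\beta$; thus condition (ii) is equivalent to the growth bound being at most $-\alpha$. *)

theory Defs
  imports "HOL-Analysis.Analysis"
begin

section \<open>Real square-integrable functions modulo equality almost everywhere\<close>

definition sq_integrable :: "(real \<Rightarrow> real) \<Rightarrow> bool" where
  "sq_integrable f \<longleftrightarrow> f \<in> borel_measurable lborel \<and> integrable lborel (\<lambda>z. (f z)\<^sup>2)"

definition sq_eq :: "(real \<Rightarrow> real) \<Rightarrow> (real \<Rightarrow> real) \<Rightarrow> bool" where
  "sq_eq f g \<longleftrightarrow> sq_integrable f \<and> sq_integrable g \<and> (AE z in lborel. f z = g z)"

lemma sq_integrable_zero: "sq_integrable (\<lambda>_. 0)"
  by (simp add: sq_integrable_def)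

lemma sq_integrable_mult:
  assumes "sq_integrable f" "sq_integrable g"
  shows "integrable lborel (\<lambda>z. f z * g z)"
proof (rule Bochner_Integration.integrable_bound)
  show "integrable lborel (\<lambda>z. (f z)\<^sup>2 + (g z)\<^sup>2)"
    using assms by (auto simp: sq_integrable_def)
  show "(\<lambda>z. f z * g z) \<in> borel_measurable lborel"
    using assms by (auto simp: sq_integrable_def)
  have "\<bar>a * b\<bar> \<le> a\<^sup>2 + b\<^sup>2" for a b :: real
    using sum_squares_bound[of "\<bar>a\<bar>" "\<bar>b\<bar>"] mult_nonneg_nonneg[of "\<bar>a\<bar>" "\<bar>b\<bar>"]
    unfolding abs_mult power2_abs by linarith
  then show "AE z in lborel. norm (f z * g z) \<le> norm ((f z)\<^sup>2 + (g z)\<^sup>2)"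
    by (intro AE_I2) simp
qed

lemma sq_integrable_add:
  assumes "sq_integrable f" "sq_integrable g"
  shows "sq_integrable (\<lambda>z. f z + g z)"
proof -
  have "integrable lborel (\<lambda>z. (f z)\<^sup>2 + (g z)\<^sup>2 + 2 * (f z * g z))"
    using assms sq_integrable_mult[OF assms] by (auto simp: sq_integrable_def)
  moreover have "(\<lambda>z. (f z)\<^sup>2 + (g z)\<^sup>2 + 2 * (f z * g z)) = (\<lambda>z. (f z + g z)\<^sup>2)"
    by (auto simp: power2_sum)
  ultimately show ?thesis
    using assms by (auto simp: sq_integrable_def)
qed

lemma sq_integrable_cmult:
  "sq_integrable f \<Longrightarrow> sq_integrable (\<lambda>z. c * f z)"
  by (auto simp: sq_integrable_def power_mult_distrib)

lemma sq_integrable_reflect: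
  assumes "sq_integrable f"
  shows "sq_integrable (\<lambda>z. f (c - z))"
proof -
  have "integrable lborel (\<lambda>z. (f (c + (-1) * z))\<^sup>2)"
    using assms lborel_integrable_real_affine[of "\<lambda>z. (f z)\<^sup>2" "-1" c]
    by (auto simp: sq_integrable_def)
  then show ?thesis
    using assms by (auto simp: sq_integrable_def intro: measurable_compose[of "\<lambda>z. c - z" lborel lborel f])
qed

lemma AE_lborel_reflect:
  fixes P :: "real \<Rightarrow> bool"
  assumes "AE z in lborel. P z"
  shows "AE z in lborel. P (c - z)"
proof -
  have eq: "lborel = density (distr lborel borel (\<lambda>z. c + (-1) * z)) (\<lambda>_. ennreal \<bar>-1::real\<bar>)"
    by (rule lborel_real_affine) simp
  have "AE z in density (distr lborel borel (\<lambda>z. c + (-1) * z)) (\<lambda>_. ennreal \<bar>-1::real\<bar>). P z"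
    using assms by (subst (asm) eq)
  then have "AE z in distr lborel borel (\<lambda>z. c + (-1) * z). P z"
    by (subst (asm) AE_density) auto
  then have "AE z in lborel. P (c + (-1) * z)"
    by (rule AE_distrD[rotated]) simp
  then show ?thesis by simp
qed

lemma AE_iff_of_sq_eq:
  assumes "sq_eq f g" and "\<And>z. f z = g z \<Longrightarrow> P z \<longleftrightarrow> Q z"
  shows "(AE z in lborel. P z) \<longleftrightarrow> (AE z in lborel. Q z)"
proof -
  have "AE z in lborel. P z \<longleftrightarrow> Q z"
    using assms(1) unfolding sq_eq_def by (auto elim!: eventually_mono dest: assms(2))
  then show ?thesis
    by (rule eventually_subst)
qed

quotient_type L2R = "real \<Rightarrow> real" / partial: sq_eq
proof (rule part_equivpI)
  show "\<exists>f. sq_eq f f"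
    by (rule exI[of _ "\<lambda>_. 0"]) (simp add: sq_eq_def sq_integrable_zero)
  show "symp sq_eq"
    by (rule sympI) (auto simp: sq_eq_def)
  show "transp sq_eq"
    by (rule transpI) (auto simp: sq_eq_def)
qed

instantiation L2R :: real_inner
begin

lift_definition zero_L2R :: L2R is "\<lambda>_. 0"
  by (simp add: sq_eq_def sq_integrable_zero)

lift_definition plus_L2R :: "L2R \<Rightarrow> L2R \<Rightarrow> L2R" is "\<lambda>f g z. f z + g z"
  by (auto simp: sq_eq_def sq_integrable_add)

lift_definition scaleR_L2R :: "real \<Rightarrow> L2R \<Rightarrow> L2R" is "\<lambda>c f z. c * f z"
  by (auto simp: sq_eq_def sq_integrable_cmult)

lift_definition uminus_L2R :: "L2R \<Rightarrow> L2R" is "\<lambda>f z. - f z"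
  using sq_integrable_cmult[of _ "-1"] by (auto simp: sq_eq_def)

lift_definition minus_L2R :: "L2R \<Rightarrow> L2R \<Rightarrow> L2R" is "\<lambda>f g z. f z - g z"
proof -
  fix f f' g g' assume *: "sq_eq f f'" "sq_eq g g'"
  have "sq_integrable (\<lambda>z. u z - v z)" if "sq_integrable u" "sq_integrable v" for u v
    using sq_integrable_add[OF that(1) sq_integrable_cmult[OF that(2), of "-1"]] by simp
  with * show "sq_eq (\<lambda>z. f z - g z) (\<lambda>z. f' z - g' z)"
    by (auto simp: sq_eq_def)
qed

lift_definition inner_L2R :: "L2R \<Rightarrow> L2R \<Rightarrow> real" is "\<lambda>f g. \<integral>z. f z * g z \<partial>lborel"
  by (rule integral_cong_AE) (auto simp: sq_eq_def sq_integrable_def)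

definition norm_L2R :: "L2R \<Rightarrow> real" where
  "norm_L2R f = sqrt (inner f f)"

definition sgn_L2R :: "L2R \<Rightarrow> L2R" where
  "sgn_L2R f = inverse (norm f) *\<^sub>R f"

definition dist_L2R :: "L2R \<Rightarrow> L2R \<Rightarrow> real" where
  "dist_L2R f g = norm (f - g)"

definition uniformity_L2R :: "(L2R \<times> L2R) filter" where
  "uniformity_L2R = (INF e\<in>{0<..}. principal {(x, y). dist x y < e})"

definition open_L2R :: "L2R set \<Rightarrow> bool" where
  "open_L2R U = (\<forall>x\<in>U. eventually (\<lambda>(x', y). x' = x \<longrightarrow> y \<in> U) uniformity)"

instance
proof
  fix f g h :: L2R and a b :: real
  show "f + g + h = f + (g + h)"
    by transfer (auto simp: sq_eq_def algebra_simps intro!: sq_integrable_add)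
  show "f + g = g + f"
    by transfer (auto simp: sq_eq_def algebra_simps intro!: sq_integrable_add)
  show "0 + f = f"
    by transfer (auto simp: sq_eq_def)
  show "- f + f = 0"
    by transfer (auto simp: sq_eq_def sq_integrable_zero)
  show "f - g = f + - g"
  proof transfer
    fix f g assume "sq_eq f f" "sq_eq g g"
    then show "sq_eq (\<lambda>z. f z - g z) (\<lambda>z. f z + - g z)"
      using sq_integrable_add[of f "\<lambda>z. -1 * g z"] sq_integrable_cmult[of g "-1"]
      by (auto simp: sq_eq_def)
  qed
  show "a *\<^sub>R (f + g) = a *\<^sub>R f + a *\<^sub>R g"
    by transfer (auto simp: sq_eq_def distrib_left intro!: sq_integrable_add sq_integrable_cmult)
  show "(a + b) *\<^sub>R f = a *\<^sub>R f + b *\<^sub>R f"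
    by transfer (auto simp: sq_eq_def distrib_right intro!: sq_integrable_add sq_integrable_cmult)
  show "a *\<^sub>R b *\<^sub>R f = (a * b) *\<^sub>R f"
    by transfer (auto simp: sq_eq_def mult.assoc intro!: sq_integrable_cmult)
  show "1 *\<^sub>R f = f"
    by transfer (auto simp: sq_eq_def)
  show "inner f g = inner g f"
    by transfer (simp add: mult.commute)
  show "inner (f + g) h = inner f h + inner g h"
    by transfer (simp add: sq_eq_def distrib_right sq_integrable_mult)
  show "inner (a *\<^sub>R f) g = a * inner f g"
    by transfer (simp add: mult.assoc)
  show "0 \<le> inner f f"
    by transfer simp
  show "inner f f = 0 \<longleftrightarrow> f = 0"
  proof transfer
    fix f assume f: "sq_eq f f"
    then have "integrable lborel (\<lambda>z. f z * f z)"
      by (auto simp: sq_eq_def sq_integrable_mult)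
    then have "(\<integral>z. f z * f z \<partial>lborel) = 0 \<longleftrightarrow> (AE z in lborel. f z * f z = 0)"
      by (intro integral_nonneg_eq_0_iff_AE) auto
    with f show "(\<integral>z. f z * f z \<partial>lborel) = 0 \<longleftrightarrow> sq_eq f (\<lambda>_. 0)"
      by (auto simp: sq_eq_def sq_integrable_zero)
  qed
qed (rule norm_L2R_def sgn_L2R_def dist_L2R_def uniformity_L2R_def open_L2R_def)+

end

lift_definition nonneg_L2R :: "L2R \<Rightarrow> bool" is "\<lambda>f. AE z in lborel. 0 \<le> f z"
  by (rule AE_iff_of_sq_eq) auto

text \<open>
  \<open>L2 L\<close> is L2(0,L): extension by zero identifies it isometrically, and as an ordered vector
  space, with the subspace of classes that vanish almost everywhere outside (0,L).
\<close>

lift_definition vanishes_outside :: "real set \<Rightarrow> L2R \<Rightarrow> bool" is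
  "\<lambda>S f. AE z in lborel. z \<notin> S \<longrightarrow> f z = 0"
  by (rule AE_iff_of_sq_eq) auto

definition L2 :: "real \<Rightarrow> L2R set" where
  "L2 L = {x. vanishes_outside {0<..<L} x}"

lemma subspace_L2: "subspace (L2 L)"
proof (rule subspaceI)
  have *: "vanishes_outside S 0" "vanishes_outside S x \<Longrightarrow> vanishes_outside S y \<Longrightarrow> vanishes_outside S (x + y)"
    "vanishes_outside S x \<Longrightarrow> vanishes_outside S (c *\<^sub>R x)" for S x y c
    by (transfer, auto elim: eventually_elim2 eventually_mono)+
  show "0 \<in> L2 L" "\<And>x y. x \<in> L2 L \<Longrightarrow> y \<in> L2 L \<Longrightarrow> x + y \<in> L2 L"
    "\<And>c x. x \<in> L2 L \<Longrightarrow> c *\<^sub>R x \<in> L2 L"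
    by (auto simp: L2_def *)
qed

section \<open>Sobolev spaces on (0,L)\<close>

text \<open>
  Weak derivatives are tested against C1 functions with compact support in (0,L), and
  H2(0,L) consists of the elements of H1(0,L) whose weak derivative lies in H1(0,L) again.
  Weak derivatives in \<open>L2 L\<close> are unique, so \<open>wderiv\<close> is total on \<open>H1 L\<close>.
\<close>

definition test_fun :: "real \<Rightarrow> (real \<Rightarrow> real) \<Rightarrow> bool" where
  "test_fun L \<phi> \<longleftrightarrow> \<phi> C1_differentiable_on UNIV \<and>
     compact (closure {z. \<phi> z \<noteq> 0}) \<and> closure {z. \<phi> z \<noteq> 0} \<subseteq> {0<..<L}"

lift_definition is_weak_deriv :: "real \<Rightarrow> L2R \<Rightarrow> L2R \<Rightarrow> bool" is
  "\<lambda>L f g. \<forall>\<phi>. test_fun L \<phi> \<longrightarrow> (\<integral>z. f z * deriv \<phi> z \<partial>lborel) = - (\<integral>z. g z * \<phi> z \<partial>lborel)"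
proof -
  fix L f f' g g' assume *: "sq_eq f f'" "sq_eq g g'"
  have "(\<integral>z. f z * deriv \<phi> z \<partial>lborel) = (\<integral>z. f' z * deriv \<phi> z \<partial>lborel)"
       "(\<integral>z. g z * \<phi> z \<partial>lborel) = (\<integral>z. g' z * \<phi> z \<partial>lborel)"
    if "test_fun L \<phi>" for \<phi>
  proof -
    have \<phi>: "\<phi> C1_differentiable_on UNIV"
      using that by (simp add: test_fun_def)
    then have "continuous_on UNIV \<phi>"
      by (rule C1_differentiable_imp_continuous_on)
    moreover obtain D where D: "\<And>z. (\<phi> has_real_derivative D z) (at z)" "continuous_on UNIV D"
      using \<phi> by (auto simp: C1_differentiable_on_def has_real_derivative_iff_has_vector_derivative)
    moreover from D(1) have "deriv \<phi> = D"
      by (auto intro: DERIV_imp_deriv)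
    ultimately have meas: "\<phi> \<in> borel_measurable lborel" "deriv \<phi> \<in> borel_measurable lborel"
      by (auto intro: borel_measurable_continuous_onI)
    show "(\<integral>z. f z * deriv \<phi> z \<partial>lborel) = (\<integral>z. f' z * deriv \<phi> z \<partial>lborel)"
      by (rule integral_cong_AE) (use * meas in \<open>auto simp: sq_eq_def sq_integrable_def\<close>)
    show "(\<integral>z. g z * \<phi> z \<partial>lborel) = (\<integral>z. g' z * \<phi> z \<partial>lborel)"
      by (rule integral_cong_AE) (use * meas in \<open>auto simp: sq_eq_def sq_integrable_def\<close>)
  qed
  then show
    "(\<forall>\<phi>. test_fun L \<phi> \<longrightarrow> (\<integral>z. f z * deriv \<phi> z \<partial>lborel) = - (\<integral>z. g z * \<phi> z \<partial>lborel)) =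
     (\<forall>\<phi>. test_fun L \<phi> \<longrightarrow> (\<integral>z. f' z * deriv \<phi> z \<partial>lborel) = - (\<integral>z. g' z * \<phi> z \<partial>lborel))"
    by auto
qed

definition H1 :: "real \<Rightarrow> L2R set" where
  "H1 L = {x \<in> L2 L. \<exists>y\<in>L2 L. is_weak_deriv L x y}"

definition wderiv :: "real \<Rightarrow> L2R \<Rightarrow> L2R" where
  "wderiv L x = (THE y. y \<in> L2 L \<and> is_weak_deriv L x y)"

definition H2 :: "real \<Rightarrow> L2R set" where
  "H2 L = {x \<in> H1 L. wderiv L x \<in> H1 L}"

lift_definition is_rep :: "real \<Rightarrow> L2R \<Rightarrow> (real \<Rightarrow> real) \<Rightarrow> bool" is
  "\<lambda>L f u. AE z in lborel. z \<in> {0<..<L} \<longrightarrow> f z = u z"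
  by (intro ext AE_iff_of_sq_eq) auto

text \<open>
  The value at a point \<open>z\<close> of \<open>[0,L]\<close> of an element of \<open>H1 L\<close> is that of its continuous
  representative on the closed interval; \<open>pval L (wderiv L x) z\<close> is therefore the classical
  (at the end points one-sided) derivative of the C1 representative of \<open>x \<in> H2 L\<close>.
\<close>

definition pval :: "real \<Rightarrow> L2R \<Rightarrow> real \<Rightarrow> real" where
  "pval L x z = (THE c. \<exists>u. continuous_on {0..L} u \<and> is_rep L x u \<and> u z = c)"

section \<open>Strongly continuous semigroups\<close>

text \<open>
  The state space is a subspace \<open>X\<close> of the ambient type; values of \<open>T\<close> at negative times or
  outside \<open>X\<close> are irrelevant. Unbounded operators are represented by their graphs.
\<close>

definition C0_semigroup :: "'a::real_normed_vector set \<Rightarrow> (real \<Rightarrow> 'a \<Rightarrow> 'a) \<Rightarrow> bool" where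
  "C0_semigroup X T \<longleftrightarrow>
     (\<forall>t\<ge>0. (\<forall>x\<in>X. T t x \<in> X) \<and>
             (\<forall>x\<in>X. \<forall>y\<in>X. T t (x + y) = T t x + T t y) \<and>
             (\<forall>c. \<forall>x\<in>X. T t (c *\<^sub>R x) = c *\<^sub>R T t x) \<and>
             (\<exists>K. \<forall>x\<in>X. norm (T t x) \<le> K * norm x)) \<and>
     (\<forall>x\<in>X. T 0 x = x) \<and>
     (\<forall>s\<ge>0. \<forall>t\<ge>0. \<forall>x\<in>X. T (s + t) x = T s (T t x)) \<and>
     (\<forall>x\<in>X. ((\<lambda>t. T t x) \<longlongrightarrow> x) (at_right 0))"

definition generator :: "'a::real_normed_vector set \<Rightarrow> (real \<Rightarrow> 'a \<Rightarrow> 'a) \<Rightarrow> ('a \<times> 'a) set" where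
  "generator X T = {(x, y). x \<in> X \<and> y \<in> X \<and> ((\<lambda>t. (T t x - x) /\<^sub>R t) \<longlongrightarrow> y) (at_right 0)}"

definition generates ::
  "'a::real_normed_vector set \<Rightarrow> ('a \<times> 'a) set \<Rightarrow> (real \<Rightarrow> 'a \<Rightarrow> 'a) \<Rightarrow> bool" where
  "generates X A T \<longleftrightarrow> C0_semigroup X T \<and> generator X T = A"

definition growth_bound :: "'a::real_normed_vector set \<Rightarrow> (real \<Rightarrow> 'a \<Rightarrow> 'a) \<Rightarrow> ereal" where
  "growth_bound X T =
     Inf {ereal \<omega> | \<omega>. \<exists>M\<ge>1. \<forall>t\<ge>0. \<forall>x\<in>X. norm (T t x) \<le> M * exp (\<omega> * t) * norm x}"

definition exp_stable :: "'a::real_normed_vector set \<Rightarrow> (real \<Rightarrow> 'a \<Rightarrow> 'a) \<Rightarrow> real \<Rightarrow> bool" where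
  "exp_stable X T \<beta> \<longleftrightarrow> growth_bound X T < ereal \<beta>"

definition positive_semigroup :: "'a set \<Rightarrow> (real \<Rightarrow> 'a \<Rightarrow> 'a) \<Rightarrow> bool" where
  "positive_semigroup K T \<longleftrightarrow> (\<forall>t\<ge>0. \<forall>x\<in>K. T t x \<in> K)"

section \<open>The diffusion operators and the optimization problem\<close>

definition A0 :: "real \<Rightarrow> real \<Rightarrow> real \<Rightarrow> ((L2R \<times> L2R) \<times> (L2R \<times> L2R)) set" where
  "A0 D L \<gamma> = {((x, x'), (D *\<^sub>R wderiv L (wderiv L x), D *\<^sub>R wderiv L (wderiv L x'))) | x x'.
     x \<in> H2 L \<and> x' \<in> H2 L \<and>
     pval L (wderiv L x) 0 = 0 \<and> pval L (wderiv L x') 0 = 0 \<and>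
     pval L (wderiv L x) L = 0 \<and>
     pval L (wderiv L x') L = - \<gamma> * pval L x L + \<gamma> * pval L x' L}"

definition A_op :: "real \<Rightarrow> real \<Rightarrow> real \<Rightarrow> (L2R \<times> L2R) set" where
  "A_op D L \<gamma> = {(x, D *\<^sub>R wderiv L (wderiv L x)) | x.
     x \<in> H2 L \<and>
     pval L (wderiv L x) 0 + \<gamma> * pval L x 0 = 0 \<and> pval L (wderiv L x) L = 0}"

lift_definition reflect :: "real \<Rightarrow> L2R \<Rightarrow> L2R" is "\<lambda>L f z. f (L - z)"
  unfolding sq_eq_def using AE_lborel_reflect by (blast intro: sq_integrable_reflect)

text \<open>For bijective \<open>S\<close> this is the graph of \<open>S A S\<close>-inverse.\<close>

definition conj_op :: "('a \<Rightarrow> 'b) \<Rightarrow> ('a \<times> 'a) set \<Rightarrow> ('b \<times> 'b) set" where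
  "conj_op S A = {(S x, S y) | x y. (x, y) \<in> A}"

definition L2_pos :: "real \<Rightarrow> L2R set" where
  "L2_pos L = {x \<in> L2 L. nonneg_L2R x}"

text \<open>
  A semigroup is determined on its state space by its generator, so each existential states that
  the operator is a generator and that the semigroup generated by it has the required property.
\<close>

definition admissible :: "real \<Rightarrow> real \<Rightarrow> real \<Rightarrow> real \<Rightarrow> bool" where
  "admissible D L \<alpha> \<gamma> \<longleftrightarrow>
     (\<exists>T. generates (L2 L \<times> L2 L) (A0 D L \<gamma>) T \<and>
          positive_semigroup (L2_pos L \<times> L2_pos L) T) \<and>
     (\<exists>T. generates (L2 L) (conj_op (reflect L) (A_op D L \<gamma>)) T \<and>
          (\<forall>\<beta>\<in>{-\<alpha><..0}. exp_stable (L2 L) T \<beta>))"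

end

theory Submission
  imports Defs
begin

text \<open>
  In the error coordinate \<open>e = x' - x\<close> the operator \<open>A0\<close> decouples into the Neumann Laplacian and
  the Robin Laplacian with \<open>e'(0) = 0\<close>, \<open>e'(L) = \<gamma> e(L)\<close>, and the latter is also \<open>S A S\<close>-inverse.

  Condition (ii) alone forces \<open>\<gamma> \<le> \<gamma>\<^sub>*\<close>: for \<open>\<gamma> \<ge> 0\<close> the Robin Laplacian has an eigenfunction
  \<open>cosh (\<mu> z)\<close> with eigenvalue \<open>D \<mu>\<^sup>2 \<ge> 0\<close>, while for \<open>\<gamma> < 0\<close> it has the eigenfunction \<open>cos (\<mu> z)\<close> with
  \<open>0 < \<mu> < \<pi> / (2 L)\<close>, \<open>\<gamma> = - \<mu> tan (\<mu> L)\<close> and eigenvalue \<open>- D \<mu>\<^sup>2\<close>, which stability makes at most \<open>- \<alpha>\<close>.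

  Conversely, for \<open>\<gamma> = - \<mu> tan (\<mu> L)\<close> the Riccati function \<open>w = - \<mu> tan (\<mu> z)\<close> and the square
  \<open>(u' - w u)\<^sup>2 \<ge> 0\<close> show that the Robin Laplacian is dissipative with the sharp constant \<open>D \<mu>\<^sup>2\<close>.
  Its resolvent is explicit, positive, and dominated by the Neumann one. All this passes to the
  semigroups, which are limits of the powers \<open>J (t / 2\<^sup>k) ^ (2\<^sup>k)\<close> of the resolvent, and positivity
  of the coupled semigroup is exactly the domination of the Robin semigroup by the Neumann one.
\<close>

section \<open>Contraction semigroups generated by dissipative operators\<close>

text \<open>The relation \<gamma> = - \<mu> tan (\<mu> L) comes from inserting cos (\<mu> z) into
  the boundary condition at L. For 0 < \<mu> < \<pi> / (2 L) it runs monotonically from 0 down to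
  minus infinity, and the limit is the Dirichlet condition at L. The threshold \<pi>^2 D / (4 L^2)
  is the decay rate of that limit problem: it is approached but never attained, which is why
  feasibility is a strict inequality. Admissible gains are negative and bounded above by the optimal
  one, so minimizing the square picks the largest of them.

  Generation rests on dissipativity and the range condition. Halving the time step compares one
  resolvent step of length 2 h with two of length h; for commuting contractions the global error is
  at most the number of steps times the local error, and the latter is quadratic in h on the domain
  of A^2.

  Point values of classes modulo null sets are the recurring obstacle. They are reached through
  functions written as integrals of their derivatives, so integration by parts has to be available
  for a derivative that is merely square integrable.\<close>

text \<open>Telescoping. Commutation moves the power of \<open>Q\<close> to the outside, so the only
  error that enters is the one at \<open>x\<close> itself; this matters because two resolvent
  schemes are close only on smooth vectors.\<close>

lemma norm_funpow_diff_le: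
  fixes P Q :: "'a::real_normed_vector \<Rightarrow> 'a"
  assumes X: "subspace X" and x: "x \<in> X"
    and P: "\<And>y. y \<in> X \<Longrightarrow> P y \<in> X" "\<And>y. y \<in> X \<Longrightarrow> norm (P y) \<le> norm y"
      "\<And>y z. y \<in> X \<Longrightarrow> z \<in> X \<Longrightarrow> P (y - z) = P y - P z"
    and Q: "\<And>y. y \<in> X \<Longrightarrow> Q y \<in> X" "\<And>y. y \<in> X \<Longrightarrow> norm (Q y) \<le> norm y"
      "\<And>y z. y \<in> X \<Longrightarrow> z \<in> X \<Longrightarrow> Q (y - z) = Q y - Q z"
    and PQ: "\<And>y. y \<in> X \<Longrightarrow> P (Q y) = Q (P y)"
  shows "norm ((P ^^ n) x - (Q ^^ n) x) \<le> real n * norm (P x - Q x)"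
proof (induction n)
  case (Suc n)
  have Pn: "(P ^^ n) y \<in> X" if "y \<in> X" for n y
    using that by (induction n) (auto simp: P)
  have Qn: "(Q ^^ n) y \<in> X" if "y \<in> X" for n y
    using that by (induction n) (auto simp: Q)
  have Qc: "norm ((Q ^^ n) y) \<le> norm y" if "y \<in> X" for n y
    using that by (induction n) (auto intro: order_trans[OF Q(2)] simp: Qn)
  have Qd: "(Q ^^ n) (y - z) = (Q ^^ n) y - (Q ^^ n) z" if "y \<in> X" "z \<in> X" for n y z
    using that by (induction n) (auto simp: Q Qn)
  have PQn: "P ((Q ^^ n) x) = (Q ^^ n) (P x)" for n
    by (induction n) (auto simp: PQ Qn x)
  have "(P ^^ Suc n) x - (Q ^^ Suc n) x = P ((P ^^ n) x - (Q ^^ n) x) + (Q ^^ n) (P x - Q x)"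
    using P(3)[OF Pn[OF x] Qn[OF x], of n n] Qd[OF P(1)[OF x] Q(1)[OF x], of n] PQn[of n]
    by (simp add: funpow_swap1)
  also have "norm \<dots> \<le> norm ((P ^^ n) x - (Q ^^ n) x) + norm (P x - Q x)"
    using P(2)[of "(P ^^ n) x - (Q ^^ n) x"] Qc[of "P x - Q x" n]
    by (intro norm_triangle_le add_mono) (auto simp: x X Pn Qn P Q subspace_diff)
  finally show ?case
    using Suc by (simp add: algebra_simps)
qed auto

text \<open>\<open>A\<close> is a graph, so linearity means being a subspace and single-valuedness
  is an assumption of its own. Density of the domain is a consequence, see \<open>J_tendsto\<close>.
  The rate \<open>\<omega>\<close> is a parameter because it becomes the decay rate of the
  semigroup.\<close>

locale m_dissipative =
  fixes X :: "'a::real_inner set" and A :: "('a \<times> 'a) set" and \<omega> :: real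
  assumes subspace_X: "subspace X" and complete_X: "complete X"
    and subspace_A: "subspace A" and A_subset: "A \<subseteq> X \<times> X"
    and single_valued: "(0, y) \<in> A \<Longrightarrow> y = 0"
    and \<omega>_nonneg: "0 \<le> \<omega>"
    and dissipative: "(x, y) \<in> A \<Longrightarrow> y \<bullet> x \<le> - \<omega> * (norm x)\<^sup>2"
    and range: "0 < h \<Longrightarrow> f \<in> X \<Longrightarrow> \<exists>x y. (x, y) \<in> A \<and> x - h *\<^sub>R y = f"
begin

lemma X_add: "x \<in> X \<Longrightarrow> y \<in> X \<Longrightarrow> x + y \<in> X"
  and X_diff: "x \<in> X \<Longrightarrow> y \<in> X \<Longrightarrow> x - y \<in> X"
  and X_scale: "x \<in> X \<Longrightarrow> c *\<^sub>R x \<in> X"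
  using subspace_X by (auto simp: subspace_add subspace_diff subspace_scale)

lemma A_X: "(x, y) \<in> A \<Longrightarrow> x \<in> X" "(x, y) \<in> A \<Longrightarrow> y \<in> X"
  using A_subset by auto

lemma A_add: "(x, y) \<in> A \<Longrightarrow> (x', y') \<in> A \<Longrightarrow> (x + x', y + y') \<in> A"
  and A_diff: "(x, y) \<in> A \<Longrightarrow> (x', y') \<in> A \<Longrightarrow> (x - x', y - y') \<in> A"
  and A_scale: "(x, y) \<in> A \<Longrightarrow> (c *\<^sub>R x, c *\<^sub>R y) \<in> A"
  using subspace_add[OF subspace_A, of "(x, y)" "(x', y')"]
    subspace_diff[OF subspace_A, of "(x, y)" "(x', y')"]
    subspace_scale[OF subspace_A, of "(x, y)" c] by auto

section \<open>Dissipativity and the resolvent\<close>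

lemma dissipative_norm:
  assumes "(x, y) \<in> A" "0 \<le> h"
  shows "(1 + \<omega> * h) * norm x \<le> norm (x - h *\<^sub>R y)"
proof (cases "x = 0")
  case False
  have "(1 + \<omega> * h) * norm x * norm x \<le> x \<bullet> x - h * (y \<bullet> x)"
    using mult_left_mono[OF dissipative[OF assms(1)] assms(2)]
    by (simp add: power2_norm_eq_inner[symmetric] algebra_simps power2_eq_square)
  also have "\<dots> = (x - h *\<^sub>R y) \<bullet> x"
    by (simp add: inner_diff_left)
  also have "\<dots> \<le> norm (x - h *\<^sub>R y) * norm x"
    by (rule norm_cauchy_schwarz)
  finally show ?thesis
    using False by simp
qed auto

text \<open>The resolvent of \<open>A\<close>, that is \<open>(1 - h A)\<close>-inverse; it is the identity for \<open>h = 0\<close>.\<close>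

definition J :: "real \<Rightarrow> 'a \<Rightarrow> 'a" where
  "J h f = (if h = 0 then f else THE x. (x, (x - f) /\<^sub>R h) \<in> A)"

lemma J_eqI:
  assumes "(x, y) \<in> A" "0 \<le> h" "x - h *\<^sub>R y = f"
  shows "J h f = x"
proof (cases "h = 0")
  case False
  have y: "y = (x - f) /\<^sub>R h"
    using False assms(3) by auto
  have "(THE x. (x, (x - f) /\<^sub>R h) \<in> A) = x"
  proof (rule the_equality)
    fix x' assume x': "(x', (x' - f) /\<^sub>R h) \<in> A"
    have "(x' - x, (x' - f) /\<^sub>R h - y) \<in> A"
      using x' assms(1) by (rule A_diff)
    then have "(1 + \<omega> * h) * norm (x' - x) \<le> norm (x' - x - h *\<^sub>R ((x' - f) /\<^sub>R h - y))"
      using assms(2) by (rule dissipative_norm)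
    also have "\<dots> = 0"
      using False by (simp add: y algebra_simps)
    finally have "(1 + \<omega> * h) * norm (x' - x) \<le> 0" .
    moreover have "0 < 1 + \<omega> * h"
      using \<omega>_nonneg assms(2) by (simp add: add_pos_nonneg)
    ultimately show "x' = x"
      by (metis mult_le_0_iff norm_le_zero_iff not_less right_minus_eq)
  qed (use assms y in simp)
  with False show ?thesis by (simp add: J_def)
qed (use assms in \<open>simp add: J_def\<close>)

lemma J_in_A:
  assumes "0 < h" "f \<in> X"
  shows "(J h f, (J h f - f) /\<^sub>R h) \<in> A"
proof -
  obtain x y where xy: "(x, y) \<in> A" "x - h *\<^sub>R y = f"
    using range[OF assms] by blast
  then have "J h f = x" "y = (x - f) /\<^sub>R h"
    using assms by (auto intro: J_eqI)
  with xy show ?thesis by simp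
qed

lemma J_0 [simp]: "J 0 f = f"
  by (simp add: J_def)

lemma J_X: "0 \<le> h \<Longrightarrow> f \<in> X \<Longrightarrow> J h f \<in> X"
  using J_in_A[of h f] A_X by (cases "h = 0") auto

lemma J_norm: 
  assumes "0 \<le> h" "f \<in> X" shows "(1 + \<omega> * h) * norm (J h f) \<le> norm f"
  using dissipative_norm[OF J_in_A[of h f], of h] assms by (cases "h = 0") auto

lemma J_contraction:
  assumes "0 \<le> h" "f \<in> X" shows "norm (J h f) \<le> norm f"
  using mult_right_mono[of 1 "1 + \<omega> * h" "norm (J h f)"] J_norm[OF assms] \<omega>_nonneg assms(1) by auto

lemma J_add:
  assumes "0 \<le> h" "f \<in> X" "g \<in> X" shows "J h (f + g) = J h f + J h g"
proof (cases "h = 0")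
  case False
  then show ?thesis
    using assms A_add[OF J_in_A[of h f] J_in_A[of h g]] by (intro J_eqI) (auto simp: algebra_simps)
qed auto

lemma J_scale:
  assumes "0 \<le> h" "f \<in> X" shows "J h (c *\<^sub>R f) = c *\<^sub>R J h f"
proof (cases "h = 0")
  case False
  then show ?thesis
    using assms A_scale[OF J_in_A[of h f], of c] by (intro J_eqI) (auto simp: algebra_simps)
qed auto

lemma J_diff:
  assumes "0 \<le> h" "f \<in> X" "g \<in> X" shows "J h (f - g) = J h f - J h g"
  using J_add[OF assms(1,2) X_scale[OF assms(3), of "-1"]] J_scale[OF assms(1,3), of "-1"] by simp

text \<open>The resolvent commutes with \<open>A\<close>: the difference of the graph elements over
  \<open>J h x\<close> and \<open>x\<close>, divided by \<open>h\<close>, is a graph element that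
  exhibits the image of \<open>J h x\<close> as the solution of the resolvent equation for
  \<open>y\<close>.\<close>

lemma J_A:
  assumes "(x, y) \<in> A" "0 \<le> h"
  shows "(J h x, J h y) \<in> A" and J_expand: "J h x = x + h *\<^sub>R J h y"
proof -
  have "(J h x, J h y) \<in> A \<and> J h x = x + h *\<^sub>R J h y"
  proof (cases "h = 0")
    case False
    define y' where "y' = (J h x - x) /\<^sub>R h"
    have *: "(J h x, y') \<in> A"
      using J_in_A[of h x] assms False A_X by (auto simp: y'_def)
    have "(y', (y' - y) /\<^sub>R h) \<in> A"
      using A_scale[OF A_diff[OF * assms(1)], of "1/h"] by (simp add: y'_def inverse_eq_divide)
    then have "J h y = y'"
      by (rule J_eqI) (use False assms in \<open>auto simp: algebra_simps\<close>)
    with * False show ?thesis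
      by (auto simp: y'_def)
  qed (use assms in auto)
  then show "(J h x, J h y) \<in> A" "J h x = x + h *\<^sub>R J h y" by auto
qed

text \<open>With \<open>p = J s (J t f)\<close>, the candidate for \<open>J s f\<close> is (1 - t A)
  p; applying \<open>J t\<close> to it gives back \<open>p\<close>. The second graph element over
  \<open>q = A p\<close> is what makes the candidate lie in the domain.\<close>

lemma J_commute:
  assumes "0 \<le> s" "0 \<le> t" "f \<in> X"
  shows "J s (J t f) = J t (J s f)"
proof (cases "s = 0 \<or> t = 0")
  case False
  define u p where "u = J t f" and "p = J s u"
  define q where "q = (p - u) /\<^sub>R s"
  have u: "(u, (u - f) /\<^sub>R t) \<in> A"
    using J_in_A[of t f] False assms by (simp add: u_def)
  have p: "(p, q) \<in> A"
    using J_in_A[of s u] False assms A_X(1)[OF u] by (simp add: p_def q_def)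
  have q: "(q, (q - (u - f) /\<^sub>R t) /\<^sub>R s) \<in> A"
    using A_scale[OF A_diff[OF p u], of "inverse s"] by (simp add: q_def)
  have "J s f = p - t *\<^sub>R q"
  proof (rule J_eqI)
    show "(p - t *\<^sub>R q, q - t *\<^sub>R ((q - (u - f) /\<^sub>R t) /\<^sub>R s)) \<in> A"
      by (intro A_diff p A_scale q)
    have "s *\<^sub>R q = p - u" using False by (simp add: q_def)
    moreover have "s *\<^sub>R t *\<^sub>R ((q - (u - f) /\<^sub>R t) /\<^sub>R s) = t *\<^sub>R (q - (u - f) /\<^sub>R t)"
      using False by (subst scaleR_left_commute) simp
    moreover have "t *\<^sub>R (q - (u - f) /\<^sub>R t) = t *\<^sub>R q - (u - f)"
      using False by (simp add: scaleR_diff_right)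
    ultimately show "p - t *\<^sub>R q - s *\<^sub>R (q - t *\<^sub>R ((q - (u - f) /\<^sub>R t) /\<^sub>R s)) = f"
      by (simp only: scaleR_diff_right[of s]) simp
  qed (use assms in simp)
  moreover have "J t (p - t *\<^sub>R q) = p"
    by (rule J_eqI[OF p]) (use assms in auto)
  ultimately show ?thesis
    by (simp add: p_def u_def)
qed auto

lemma J_minus_id:
  assumes "(x, y) \<in> A" "0 \<le> h"
  shows "norm (J h x - x) \<le> h * norm y"
  using J_expand[OF assms] J_contraction[OF assms(2) A_X(2)[OF assms(1)]] assms(2)
  by (simp add: mult_left_mono)

text \<open>The increment from \<open>J h f\<close> to \<open>J k f\<close> is a nonpositive
  multiple of \<open>z = A (J k (J h f))\<close>, and dissipativity makes the inner product of
  \<open>z\<close> with \<open>J h f\<close> nonpositive. So the increment and \<open>J h f\<close>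
  enclose an angle of at most 90 degrees, and expanding the square gives the bound.\<close>

lemma J_monotone:
  assumes f: "f \<in> X" and "0 < k" "k \<le> h"
  shows "(norm (J h f - J k f))\<^sup>2 \<le> (norm (J k f))\<^sup>2 - (norm (J h f))\<^sup>2"
proof -
  define a b y where "a = J h f" and "b = J k f" and "y = (a - f) /\<^sub>R h"
  have h: "0 < h" using assms by simp
  have a: "(a, y) \<in> A"
    using J_in_A[OF h f] by (simp add: a_def y_def)
  define c z where "c = J k a" and "z = J k y"
  have c: "(c, z) \<in> A" "c = a + k *\<^sub>R z"
    using J_A[OF a, of k] J_expand[OF a, of k] assms by (auto simp: c_def z_def)
  have f': "f = a - h *\<^sub>R y"
    using h by (simp add: y_def)
  have "b = c - h *\<^sub>R z"
    unfolding b_def f' using J_diff[of k a "h *\<^sub>R y"] J_scale[of k y h] A_X[OF a] assms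
    by (simp add: c_def z_def X_scale)
  then have ba: "b - a = - (h - k) *\<^sub>R z"
    using c by (simp add: algebra_simps)
  have "a \<bullet> z = c \<bullet> z - k * (z \<bullet> z)"
    by (simp add: c(2) algebra_simps)
  also have "\<dots> \<le> 0"
  proof -
    have "0 \<le> \<omega> * (norm c)\<^sup>2" "0 \<le> k * (z \<bullet> z)"
      using \<omega>_nonneg assms by simp_all
    then show ?thesis
      using dissipative[OF c(1)] inner_commute[of c z] by linarith
  qed
  finally have "a \<bullet> (b - a) \<ge> 0"
    using assms by (simp add: ba mult_nonpos_nonpos)
  then show ?thesis
    unfolding a_def[symmetric] b_def[symmetric]
    by (simp add: power2_norm_eq_inner algebra_simps inner_commute)
qed

text \<open>The norms of \<open>J h x\<close> increase as \<open>h\<close> decreases to 0, so \<open>J h x\<close> is Cauchy by \<open>J_monotone\<close>;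
  applying \<open>J 1\<close> identifies the limit as \<open>x\<close>. In particular the domain of \<open>A\<close> is dense.\<close>

lemma J_tendsto:
  assumes x: "x \<in> X"
  shows "(\<lambda>n. J (1 / Suc n) x) \<longlonglongrightarrow> x"
proof -
  define a where "a n = J (1 / Suc n) x" for n
  have aX: "a n \<in> X" for n
    unfolding a_def by (rule J_X) (auto simp: x)
  have diff: "(norm (a m - a n))\<^sup>2 \<le> (norm (a n))\<^sup>2 - (norm (a m))\<^sup>2" if "m \<le> n" for m n
    unfolding a_def by (rule J_monotone) (use x that in \<open>auto simp: field_simps\<close>)
  have "(norm (a m))\<^sup>2 \<le> (norm (a n))\<^sup>2" if "m \<le> n" for m n
    using diff[OF that] zero_le_power2[of "norm (a m - a n)"] by linarith
  then have "incseq (\<lambda>n. (norm (a n))\<^sup>2)"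
    by (auto simp: incseq_def)
  moreover have "(norm (a n))\<^sup>2 \<le> (norm x)\<^sup>2" for n
    unfolding a_def by (intro power_mono J_contraction) (auto simp: x)
  ultimately have "convergent (\<lambda>n. (norm (a n))\<^sup>2)"
    using incseq_convergent by (metis convergent_def)
  then have C: "Cauchy (\<lambda>n. (norm (a n))\<^sup>2)"
    by (rule convergent_Cauchy)
  have "Cauchy a"
  proof (rule metric_CauchyI)
    fix e :: real assume e: "0 < e"
    then obtain M where M: "\<And>m n. m \<ge> M \<Longrightarrow> n \<ge> M \<Longrightarrow> dist ((norm (a m))\<^sup>2) ((norm (a n))\<^sup>2) < e\<^sup>2"
      using metric_CauchyD[OF C, of "e\<^sup>2"] by auto
    have *: "dist (a m) (a n) < e" if "m \<ge> M" "n \<ge> M" "m \<le> n" for m n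
    proof -
      have "(dist (a m) (a n))\<^sup>2 < e\<^sup>2"
        using diff[OF that(3)] M[OF that(1,2)] by (simp add: dist_norm)
      then show ?thesis
        using e by (simp add: power_less_imp_less_base)
    qed
    have "dist (a m) (a n) < e" if "m \<ge> M" "n \<ge> M" for m n
      using *[of m n] *[of n m] that by (cases "m \<le> n") (auto simp: dist_commute)
    then show "\<exists>M. \<forall>m\<ge>M. \<forall>n\<ge>M. dist (a m) (a n) < e" by blast
  qed
  then obtain p where p: "p \<in> X" "a \<longlonglongrightarrow> p"
    using complete_X aX by (auto simp: complete_def)
  have "(\<lambda>n. J 1 (a n)) \<longlonglongrightarrow> J 1 p"
  proof (rule LIM_zero_cancel, rule Lim_null_comparison)
    show "\<forall>\<^sub>F n in sequentially. norm (J 1 (a n) - J 1 p) \<le> norm (a n - p)"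
      using J_contraction[of 1] by (intro always_eventually allI) (simp add: J_diff[symmetric] aX p X_diff)
    show "(\<lambda>n. norm (a n - p)) \<longlonglongrightarrow> 0"
      using p(2) by (simp add: LIM_zero tendsto_norm_zero)
  qed
  moreover have "(\<lambda>n. J 1 (a n)) \<longlonglongrightarrow> J 1 x"
  proof (rule LIM_zero_cancel, rule Lim_null_comparison)
    show "\<forall>\<^sub>F n in sequentially. norm (J 1 (a n) - J 1 x) \<le> 1 / Suc n * norm ((J 1 x - x) /\<^sub>R 1)"
    proof (intro always_eventually allI)
      fix n
      have "J 1 (a n) = J (1 / Suc n) (J 1 x)"
        unfolding a_def by (rule J_commute) (auto simp: x)
      then show "norm (J 1 (a n) - J 1 x) \<le> 1 / Suc n * norm ((J 1 x - x) /\<^sub>R 1)"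
        using J_minus_id[OF J_in_A[of 1 x], of "1 / Suc n"] x by simp
    qed
    show "(\<lambda>n. 1 / Suc n * norm ((J 1 x - x) /\<^sub>R 1)) \<longlonglongrightarrow> 0"
      using tendsto_mult_left_zero[OF LIMSEQ_inverse_real_of_nat] by (simp add: inverse_eq_divide)
  qed
  ultimately have "J 1 p = J 1 x"
    by (rule LIMSEQ_unique)
  \<comment> \<open>The graph elements over the common value of \<open>J 1 p\<close> and
    \<open>J 1 x\<close> differ by exactly this pair, so injectivity of the resolvent is
    single-valuedness of \<open>A\<close>.\<close>
  then have "(0, x - p) \<in> A"
    using A_diff[OF J_in_A[of 1 p] J_in_A[of 1 x]] p x by simp
  then have "p = x"
    using single_valued by fastforce
  with p show ?thesis by (simp add: a_def[abs_def])
qed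


section \<open>Local error on the domain of A^2\<close>

text \<open>On the domain of A^2 one has exactly J h x = x + h y + h^2 J h z, so both sides share
  \<open>x\<close> and the term of first order. The leftover coefficients s^2, s t, t^2 and (s +
  t)^2 add up to at most 2 (s + t)^2.\<close>

lemma J_second_order:
  assumes xy: "(x, y) \<in> A" and yz: "(y, z) \<in> A" and "0 \<le> s" "0 \<le> t"
  shows "norm (J s (J t x) - J (s + t) x) \<le> 2 * (s + t)\<^sup>2 * norm z"
proof -
  have X: "x \<in> X" "y \<in> X" "z \<in> X"
    using A_X xy yz by auto
  have e: "J h x = x + h *\<^sub>R y + h\<^sup>2 *\<^sub>R J h z" if "0 \<le> h" for h
    using J_expand[OF xy that] J_expand[OF yz that] by (simp add: power2_eq_square algebra_simps)
  have "J s (J t x) = J s x + t *\<^sub>R J s y + t\<^sup>2 *\<^sub>R J s (J t z)"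
    unfolding e[OF assms(4)] using X assms J_X by (simp add: J_add J_scale X_add X_scale)
  also have "\<dots> - J (s + t) x
      = s\<^sup>2 *\<^sub>R J s z + (t * s) *\<^sub>R J s z + t\<^sup>2 *\<^sub>R J s (J t z) + (- (s + t)\<^sup>2) *\<^sub>R J (s + t) z"
    using e[of s] e[of "s + t"] J_expand[OF yz, of s] assms by (simp add: algebra_simps)
  also have "norm \<dots> \<le> s\<^sup>2 * norm z + (t * s) * norm z + t\<^sup>2 * norm z + (s + t)\<^sup>2 * norm z"
  proof -
    have n: "norm (c *\<^sub>R w) \<le> \<bar>c\<bar> * norm z" if "norm w \<le> norm z" for c w
      using that by (simp add: mult_left_mono)
    have "norm (J s (J t z)) \<le> norm z"
      using J_contraction[of s "J t z"] J_contraction[of t z] X J_X assms by fastforce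
    then show ?thesis
      using n[of "J s z" "s\<^sup>2"] n[of "J s z" "t * s"] n[of "J s (J t z)" "t\<^sup>2"]
        n[of "J (s + t) z" "- (s + t)\<^sup>2"] J_contraction[of s z] J_contraction[of "s + t" z] X assms
      by (intro norm_triangle_le add_mono) (auto simp: abs_mult)
  qed
  also have "\<dots> = (s\<^sup>2 + t * s + t\<^sup>2 + (s + t)\<^sup>2) * norm z"
    by (simp add: algebra_simps)
  also have "\<dots> \<le> (2 * (s + t)\<^sup>2) * norm z"
    using assms by (intro mult_right_mono) (auto simp: power2_sum)
  finally show ?thesis by simp
qed

text \<open>Each resolvent moves the vector one step deeper into the domain, and with a small
  parameter it costs at most half of \<open>e\<close>.\<close>

lemma dense_A2:
  assumes x: "x \<in> X" and e: "0 < e"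
  obtains x' y z where "(x', y) \<in> A" "(y, z) \<in> A" "norm (x - x') < e"
proof -
  obtain n where n: "norm (J (1 / Suc n) x - x) < e / 2"
    using LIMSEQ_D[OF J_tendsto[OF x], of "e / 2"] e by auto
  define a where "a = J (1 / Suc n) x"
  obtain y where y: "(a, y) \<in> A"
    using J_in_A[of "1 / Suc n" x] x unfolding a_def by auto
  obtain m where m: "norm (J (1 / Suc m) a - a) < e / 2"
    using LIMSEQ_D[OF J_tendsto[OF A_X(1)[OF y]], of "e / 2"] e by auto
  define h :: real where "h = 1 / Suc m"
  have h: "0 < h" by (simp add: h_def)
  show ?thesis
  proof (rule that)
    show "(J h a, J h y) \<in> A" "(J h y, (J h y - y) /\<^sub>R h) \<in> A"
      using J_A[OF y] J_in_A[OF h] A_X(2)[OF y] h by auto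
    have "norm (x - J h a) \<le> norm (a - x) + norm (J h a - a)"
      by norm
    then show "norm (x - J h a) < e"
      using m n by (simp add: a_def h_def)
  qed
qed

section \<open>Powers of the resolvent\<close>

lemma funpow_J:
  assumes "0 \<le> h" "x \<in> X"
  shows funpow_J_X: "(J h ^^ n) x \<in> X"
    and funpow_J_norm: "(1 + \<omega> * h) ^ n * norm ((J h ^^ n) x) \<le> norm x"
    and funpow_J_contraction: "norm ((J h ^^ n) x) \<le> norm x"
proof -
  show X: "(J h ^^ n) x \<in> X" for n
    by (induction n) (auto simp: assms J_X)
  show "(1 + \<omega> * h) ^ n * norm ((J h ^^ n) x) \<le> norm x"
  proof (induction n)
    case (Suc n)
    have "(1 + \<omega> * h) ^ Suc n * norm ((J h ^^ Suc n) x)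
        = (1 + \<omega> * h) ^ n * ((1 + \<omega> * h) * norm (J h ((J h ^^ n) x)))"
      by simp
    also have "\<dots> \<le> (1 + \<omega> * h) ^ n * norm ((J h ^^ n) x)"
      using J_norm[OF assms(1) X] \<omega>_nonneg assms(1) by (intro mult_left_mono) auto
    finally show ?case using Suc by simp
  qed simp
  show "norm ((J h ^^ n) x) \<le> norm x"
    by (induction n) (use J_contraction[OF assms(1) X] in \<open>auto intro: order_trans\<close>)
qed

lemma funpow_J_diff:
  assumes "0 \<le> h" "x \<in> X" "y \<in> X"
  shows "(J h ^^ n) (x - y) = (J h ^^ n) x - (J h ^^ n) y"
  using assms by (induction n) (auto simp: J_diff funpow_J_X)

lemma funpow_J_add:
  assumes "0 \<le> h" "x \<in> X" "y \<in> X"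
  shows "(J h ^^ n) (x + y) = (J h ^^ n) x + (J h ^^ n) y"
  using assms by (induction n) (auto simp: J_add funpow_J_X)

lemma funpow_J_scale:
  assumes "0 \<le> h" "x \<in> X"
  shows "(J h ^^ n) (c *\<^sub>R x) = c *\<^sub>R (J h ^^ n) x"
  using assms by (induction n) (auto simp: J_scale funpow_J_X)

text \<open>The telescoping bound with the identity as second contraction.\<close>

lemma funpow_J_minus_id:
  assumes "(x, y) \<in> A" "0 \<le> h"
  shows "norm ((J h ^^ n) x - x) \<le> real n * h * norm y"
proof -
  have "norm ((J h ^^ n) x - (id ^^ n) x) \<le> real n * norm (J h x - id x)"
    using assms A_X(1)[OF assms(1)]
    by (intro norm_funpow_diff_le[OF subspace_X]) (auto simp: J_X J_contraction J_diff)
  also have "\<dots> \<le> real n * (h * norm y)"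
    using J_minus_id[OF assms] by (intro mult_left_mono) auto
  finally show ?thesis by (simp add: id_funpow mult.assoc)
qed

text \<open>Iterating \<open>J_expand\<close> writes the left-hand side as \<open>h\<close> times
  the sum of the deviations of J^j y from \<open>y\<close> over j = 1, ..., n. This is the discrete
  form of T t x - x being the integral of T s y over [0, t].\<close>

lemma funpow_J_first_order:
  assumes "(x, y) \<in> A" "0 \<le> h" and e: "\<And>j. j \<le> n \<Longrightarrow> norm ((J h ^^ j) y - y) \<le> e"
  shows "norm ((J h ^^ n) x - x - (real n * h) *\<^sub>R y) \<le> real n * h * e"
  using e
proof (induction n)
  case (Suc n)
  have X: "x \<in> X" "y \<in> X" using A_X assms by auto
  have "(J h ^^ Suc n) x = (J h ^^ n) x + h *\<^sub>R (J h ^^ Suc n) y"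
    unfolding funpow_Suc_right o_apply J_expand[OF assms(1,2)]
    using X assms(2) by (simp add: funpow_J_add funpow_J_scale X_scale J_X)
  then have "(J h ^^ Suc n) x - x - (real (Suc n) * h) *\<^sub>R y
      = ((J h ^^ n) x - x - (real n * h) *\<^sub>R y) + h *\<^sub>R ((J h ^^ Suc n) y - y)"
    by (simp add: algebra_simps del: funpow.simps)
  also have "norm \<dots> \<le> real n * h * e + h * e"
    using Suc.IH Suc.prems assms(2)
    by (intro norm_triangle_le add_mono) (auto intro!: mult_left_mono simp del: funpow.simps)
  finally show ?case by (simp add: algebra_simps)
qed simp

section \<open>The semigroup as a limit of dyadic resolvent powers\<close>

text \<open>The implicit Euler scheme with 2^k equal steps. Powers of two make each grid a
  refinement of the previous one, so that consecutive schemes can be compared step by step.\<close>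

definition E :: "nat \<Rightarrow> real \<Rightarrow> 'a \<Rightarrow> 'a" where
  "E k t = J (t / 2 ^ k) ^^ (2 ^ k)"

definition T :: "real \<Rightarrow> 'a \<Rightarrow> 'a" where
  "T t x = lim (\<lambda>k. E k t x)"

lemma E_X: "0 \<le> t \<Longrightarrow> x \<in> X \<Longrightarrow> E k t x \<in> X"
  and E_contraction: "0 \<le> t \<Longrightarrow> x \<in> X \<Longrightarrow> norm (E k t x) \<le> norm x"
  and E_diff: "0 \<le> t \<Longrightarrow> x \<in> X \<Longrightarrow> y \<in> X \<Longrightarrow> E k t (x - y) = E k t x - E k t y"
  and E_add: "0 \<le> t \<Longrightarrow> x \<in> X \<Longrightarrow> y \<in> X \<Longrightarrow> E k t (x + y) = E k t x + E k t y"
  and E_scale: "0 \<le> t \<Longrightarrow> x \<in> X \<Longrightarrow> E k t (c *\<^sub>R x) = c *\<^sub>R E k t x"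
  unfolding E_def
  by (auto simp: funpow_J_X funpow_J_contraction funpow_J_diff funpow_J_add funpow_J_scale)

text \<open>One step of length 2 h is compared with two of length h: there are 2^k such pairs, and
  each has a local error of order 4^(-k).\<close>

lemma E_Cauchy_aux:
  assumes "(x, y) \<in> A" "(y, z) \<in> A" "0 \<le> t"
  shows "norm (E (Suc k) t x - E k t x) \<le> 2 * t\<^sup>2 * norm z / 2 ^ k"
proof -
  define h where "h = t / 2 ^ Suc k"
  have h: "0 \<le> h" "t / 2 ^ k = h + h" "t = 2 ^ k * (h + h)"
    using assms by (auto simp: h_def)
  have X: "x \<in> X" using A_X assms by auto
  have "E (Suc k) t x = ((J h ^^ 2) ^^ (2 ^ k)) x"
    by (simp add: E_def h_def funpow_mult)
  also have "J h ^^ 2 = (\<lambda>x. J h (J h x))"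
    by (auto simp: numeral_2_eq_2)
  finally have "norm (E (Suc k) t x - E k t x)
      = norm (((\<lambda>x. J h (J h x)) ^^ (2 ^ k)) x - (J (h + h) ^^ (2 ^ k)) x)"
    by (simp add: E_def h)
  also have "\<dots> \<le> real (2 ^ k) * norm (J h (J h x) - J (h + h) x)"
    using h(1) X
    by (intro norm_funpow_diff_le[OF subspace_X])
       (auto simp: J_X J_contraction J_diff J_commute intro: order_trans[OF J_contraction])
  also have "\<dots> \<le> real (2 ^ k) * (2 * (h + h)\<^sup>2 * norm z)"
    using J_second_order[OF assms(1,2) h(1) h(1)] by (intro mult_left_mono) auto
  also have "\<dots> = 2 * t\<^sup>2 * norm z / 2 ^ k"
    unfolding h(2)[symmetric] by (simp add: field_simps power2_eq_square)
  finally show ?thesis .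
qed

text \<open>The schemes are contractions uniformly in \<open>k\<close>, so replacing
  \<open>x\<close> by a nearby vector in the domain of A^2 costs the same for all of them.\<close>

lemma E_convergent:
  assumes x: "x \<in> X" and t: "0 \<le> t"
  shows "\<exists>l\<in>X. (\<lambda>k. E k t x) \<longlonglongrightarrow> l"
proof -
  have "Cauchy (\<lambda>k. E k t x)"
  proof (rule metric_CauchyI)
    fix e :: real assume e: "0 < e"
    obtain x' y z where a: "(x', y) \<in> A" "(y, z) \<in> A" "norm (x - x') < e / 3"
      using dense_A2[OF x, of "e / 3"] e by auto
    \<comment> \<open>The geometric tail: the terms 2 t^2 |z| / 2^j with j \<ge> k sum to 4 t^2 |z|
      / 2^k. Keeping the partial sum as a difference lets the induction on \<open>n\<close>
      close.\<close>
    define C where "C = 4 * t\<^sup>2 * norm z"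
    have C: "norm (E (k + n) t x' - E k t x') \<le> C / 2 ^ k - C / 2 ^ (k + n)" for k n
    proof (induction n)
      case (Suc n)
      have "norm (E (k + Suc n) t x' - E k t x')
          \<le> norm (E (Suc (k + n)) t x' - E (k + n) t x') + norm (E (k + n) t x' - E k t x')"
        by simp norm
      also have "\<dots> \<le> C / 2 / 2 ^ (k + n) + (C / 2 ^ k - C / 2 ^ (k + n))"
        using E_Cauchy_aux[OF a(1,2) t, of "k + n"] Suc by (intro add_mono) (auto simp: C_def ac_simps)
      also have "\<dots> = C / 2 ^ k - C / 2 ^ (k + Suc n)"
        by (simp add: field_simps)
      finally show ?case .
    qed simp
    have "(\<lambda>k. C / 2 ^ k) \<longlonglongrightarrow> 0"
      using LIMSEQ_divide_realpow_zero[of 2 C] by simp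
    then obtain K where K: "\<And>k. k \<ge> K \<Longrightarrow> \<bar>C / 2 ^ k\<bar> < e / 3"
      using e LIMSEQ_D[of "\<lambda>k. C / 2 ^ k" 0 "e / 3"] by auto
    have C0: "0 \<le> C" by (simp add: C_def)
    have *: "dist (E m t x) (E n t x) < e" if "n \<ge> K" "n \<le> m" for m n
    proof -
      have "norm (E m t x' - E n t x') \<le> C / 2 ^ n - C / 2 ^ m"
        using C[of n "m - n"] that by simp
      also have "\<dots> \<le> C / 2 ^ n"
        using C0 by simp
      finally have 1: "norm (E m t x' - E n t x') < e / 3"
        using K[OF that(1)] by linarith
      have x': "x' \<in> X" using a A_X by auto
      have 2: "norm (E k t x - E k t x') < e / 3" for k
        using E_contraction[OF t X_diff[OF x x'], of k] a(3) E_diff[OF t x x'] by simp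
      show ?thesis
        using 1 2[of m] 2[of n] unfolding dist_norm by norm
    qed
    have "dist (E m t x) (E n t x) < e" if "n \<ge> K" "m \<ge> K" for m n
      using *[of m n] *[of n m] that by (cases "m \<le> n") (auto simp: dist_commute)
    then show "\<exists>M. \<forall>m\<ge>M. \<forall>n\<ge>M. dist (E m t x) (E n t x) < e" by blast
  qed
  then show ?thesis
    using complete_X E_X[OF t x] by (auto simp: complete_def)
qed

lemma
  assumes "x \<in> X" "0 \<le> t"
  shows T_X: "T t x \<in> X" and E_tendsto: "(\<lambda>k. E k t x) \<longlonglongrightarrow> T t x"
proof -
  obtain l where l: "l \<in> X" "(\<lambda>k. E k t x) \<longlonglongrightarrow> l"
    using E_convergent[OF assms] by blast
  then have "T t x = l"
    by (simp add: T_def limI)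
  with l show "T t x \<in> X" "(\<lambda>k. E k t x) \<longlonglongrightarrow> T t x" by auto
qed

text \<open>The powers satisfy the bound with factor (1 + \<omega> t / 2^k)^(2^k), which tends to
  exp (\<omega> t). The rate passes to the limit without loss and with constant 1.\<close>

lemma T_norm:
  assumes "x \<in> X" "0 \<le> t"
  shows "norm (T t x) \<le> exp (- \<omega> * t) * norm x"
proof -
  have "filterlim (\<lambda>k. 2 ^ k :: nat) at_top sequentially"
    by (rule filterlim_subseq) (simp add: strict_mono_def)
  from filterlim_compose[OF tendsto_exp_limit_sequentially[of "\<omega> * t"] this]
  have "(\<lambda>k. (1 + \<omega> * (t / 2 ^ k)) ^ (2 ^ k)) \<longlonglongrightarrow> exp (\<omega> * t)"
    by simp
  then have "(\<lambda>k. (1 + \<omega> * (t / 2 ^ k)) ^ (2 ^ k) * norm (E k t x)) \<longlonglongrightarrow> exp (\<omega> * t) * norm (T t x)"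
    by (intro tendsto_mult tendsto_norm E_tendsto assms)
  moreover have "(1 + \<omega> * (t / 2 ^ k)) ^ (2 ^ k) * norm (E k t x) \<le> norm x" for k
    unfolding E_def by (rule funpow_J_norm) (use assms in auto)
  ultimately have "exp (\<omega> * t) * norm (T t x) \<le> norm x"
    by (intro LIMSEQ_le_const2) auto
  then show ?thesis
    by (simp add: exp_minus field_simps)
qed

lemma T_contraction: "x \<in> X \<Longrightarrow> 0 \<le> t \<Longrightarrow> norm (T t x) \<le> norm x"
  using LIMSEQ_le_const2[OF tendsto_norm[OF E_tendsto]] E_contraction by blast

lemma T_add: 
  assumes "x \<in> X" "y \<in> X" "0 \<le> t" shows "T t (x + y) = T t x + T t y"
  using LIMSEQ_unique[OF E_tendsto[of "x + y" t]] tendsto_add[OF E_tendsto[of x t] E_tendsto[of y t]]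
    assms by (simp add: E_add X_add)

lemma T_scale:
  assumes "x \<in> X" "0 \<le> t" shows "T t (c *\<^sub>R x) = c *\<^sub>R T t x"
  using LIMSEQ_unique[OF E_tendsto[of "c *\<^sub>R x" t]] tendsto_scaleR[OF tendsto_const[of c] E_tendsto[of x t]]
    assms by (simp add: E_scale X_scale)

lemma T_diff:
  assumes "x \<in> X" "y \<in> X" "0 \<le> t" shows "T t (x - y) = T t x - T t y"
  using T_add[OF assms(1) X_scale[OF assms(2), of "-1"] assms(3)] T_scale[OF assms(2,3), of "-1"] by simp

lemma T_0: "T 0 x = x"
proof -
  have "(J 0 ^^ n) x = x" for n by (induction n) auto
  then show ?thesis by (simp add: T_def E_def)
qed

text \<open>A product of two convergent families of operators; the uniform contraction bound on the
  outer one absorbs the error of the inner one.\<close>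

lemma E_E_tendsto:
  assumes x: "x \<in> X" and "0 \<le> s" "0 \<le> t"
  shows "(\<lambda>k. E k s (E k t x)) \<longlonglongrightarrow> T s (T t x)"
proof -
  have "(\<lambda>k. E k s (E k t x) - E k s (T t x)) \<longlonglongrightarrow> 0"
  proof (rule Lim_null_comparison)
    show "\<forall>\<^sub>F k in sequentially. norm (E k s (E k t x) - E k s (T t x)) \<le> norm (E k t x - T t x)"
      using assms by (intro always_eventually allI)
        (simp add: E_diff[symmetric] E_X T_X X_diff E_contraction)
    show "(\<lambda>k. norm (E k t x - T t x)) \<longlonglongrightarrow> 0"
      by (intro tendsto_norm_zero LIM_zero E_tendsto assms)
  qed
  from tendsto_add[OF this E_tendsto[OF T_X[OF x assms(3)] assms(2)]] show ?thesis by simp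
qed

text \<open>The same local error as for convergence, now between the product of steps p and q and
  the single step p + q.\<close>

lemma T_semigroup_A2:
  assumes a: "(x, y) \<in> A" "(y, z) \<in> A" and st: "0 \<le> s" "0 \<le> t"
  shows "T (s + t) x = T s (T t x)"
proof -
  have X: "x \<in> X" using A_X a by auto
  have *: "norm (E k s (E k t x) - E k (s + t) x) \<le> 2 * (s + t)\<^sup>2 * norm z / 2 ^ k" for k
  proof -
    define p q where "p = s / 2 ^ k" and "q = t / 2 ^ k"
    have pq: "0 \<le> p" "0 \<le> q" "(s + t) / 2 ^ k = p + q" "s = 2 ^ k * p" "t = 2 ^ k * q"
      using st by (auto simp: p_def q_def field_simps)
    have fX: "(J q ^^ n) x \<in> X" for n
      using funpow_J_X pq X by auto
    have c1: "J q ((J p ^^ n) w) = (J p ^^ n) (J q w)" if "w \<in> X" for n w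
      using that pq by (induction n) (auto simp: J_commute funpow_J_X)
    \<comment> \<open>Both factors use the same number of steps, so commutation interleaves them
      into powers of one contraction.\<close>
    have c: "(J p ^^ n) ((J q ^^ n) x) = ((\<lambda>x. J p (J q x)) ^^ n) x" for n
    proof (induction n)
      case (Suc n)
      show ?case
        using Suc[symmetric] c1[OF fX, of n n] by (simp add: funpow_swap1)
    qed simp
    have "norm (E k s (E k t x) - E k (s + t) x)
        = norm (((\<lambda>x. J p (J q x)) ^^ (2 ^ k)) x - (J (p + q) ^^ (2 ^ k)) x)"
      by (simp add: E_def pq(3) c p_def[symmetric] q_def[symmetric])
    also have "\<dots> \<le> real (2 ^ k) * norm (J p (J q x) - J (p + q) x)"
      using pq(1,2) X
      by (intro norm_funpow_diff_le[OF subspace_X])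
         (auto simp: J_X J_contraction J_diff J_commute intro: order_trans[OF J_contraction])
    also have "\<dots> \<le> real (2 ^ k) * (2 * (p + q)\<^sup>2 * norm z)"
      using J_second_order[OF a pq(1,2)] by (intro mult_left_mono) auto
    also have "\<dots> = 2 * (s + t)\<^sup>2 * norm z / 2 ^ k"
      unfolding pq(3)[symmetric] by (simp add: field_simps power2_eq_square)
    finally show ?thesis .
  qed
  have "(\<lambda>k. E k s (E k t x) - E k (s + t) x) \<longlonglongrightarrow> 0"
    by (rule Lim_null_comparison[OF always_eventually LIMSEQ_divide_realpow_zero[of 2]]) (use * in auto)
  moreover have "(\<lambda>k. E k s (E k t x) - E k (s + t) x) \<longlonglongrightarrow> T s (T t x) - T (s + t) x"
    using st X by (intro tendsto_diff E_E_tendsto E_tendsto) auto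
  ultimately show ?thesis
    using LIMSEQ_unique by fastforce
qed

lemma T_semigroup:
  assumes x: "x \<in> X" and st: "0 \<le> s" "0 \<le> t"
  shows "T (s + t) x = T s (T t x)"
proof -
  have "norm (T (s + t) x - T s (T t x)) \<le> e" if e: "0 < e" for e
  proof -
    obtain x' y z where a: "(x', y) \<in> A" "(y, z) \<in> A" "norm (x - x') < e / 2"
      using dense_A2[OF x, of "e / 2"] e by auto
    have x': "x' \<in> X" using a A_X by auto
    define d where "d = x - x'"
    have d: "d \<in> X" "x = x' + d" "norm d < e / 2" 
      using x x' a X_diff by (auto simp: d_def)
    have "T (s + t) x - T s (T t x) = T (s + t) d - T s (T t d)"
      using st d x' T_semigroup_A2[OF a(1,2) st] by (simp add: T_add T_X)
    also have "norm \<dots> \<le> norm d + norm d"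
      using st d T_contraction[of "T t d" s] T_contraction[of d t] T_contraction[of d "s + t"] T_X
      by (intro norm_triangle_le_diff add_mono) auto
    finally show ?thesis using d by linarith
  qed
  then show ?thesis
    using field_le_epsilon[of "norm (T (s + t) x - T s (T t x))" 0] by simp
qed

section \<open>Behaviour at time zero and the generator\<close>

lemma T_minus_id:
  assumes "(x, y) \<in> A" "0 \<le> t"
  shows "norm (T t x - x) \<le> t * norm y"
proof (rule LIMSEQ_le_const2)
  show "(\<lambda>k. norm (E k t x - x)) \<longlonglongrightarrow> norm (T t x - x)"
    using assms A_X by (intro tendsto_intros E_tendsto) auto
  show "\<exists>N. \<forall>k\<ge>N. norm (E k t x - x) \<le> t * norm y"
    using funpow_J_minus_id[OF assms(1), of "t / 2 ^ k" "2 ^ k" for k] assms(2) by (auto simp: E_def)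
qed

text \<open>A quantitative rate for the return to \<open>y\<close> needs a vector in the domain,
  while \<open>y\<close> is only in \<open>X\<close>; hence the approximation \<open>y'\<close>. Its
  distance from \<open>y\<close> counts twice: once under the contraction and once directly.\<close>

lemma T_first_order:
  assumes xy: "(x, y) \<in> A" and yz: "(y', z) \<in> A" and t: "0 \<le> t"
  shows "norm (T t x - x - t *\<^sub>R y) \<le> t * (2 * norm (y - y') + t * norm z)"
proof (rule LIMSEQ_le_const2)
  have X: "x \<in> X" "y \<in> X" "y' \<in> X" using A_X xy yz by auto
  show "(\<lambda>k. norm (E k t x - x - t *\<^sub>R y)) \<longlonglongrightarrow> norm (T t x - x - t *\<^sub>R y)"
    using t X by (intro tendsto_intros E_tendsto) auto
  show "\<exists>N. \<forall>k\<ge>N. norm (E k t x - x - t *\<^sub>R y) \<le> t * (2 * norm (y - y') + t * norm z)"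
  proof (intro exI allI impI)
    fix k :: nat
    define h where "h = t / 2 ^ k"
    have h: "0 \<le> h" "real (2 ^ k) * h = t" using t by (auto simp: h_def)
    have "norm ((J h ^^ j) y - y) \<le> 2 * norm (y - y') + t * norm z" if "j \<le> 2 ^ k" for j
    proof -
      have "real j * h \<le> real (2 ^ k) * h"
        using that h(1) by (intro mult_right_mono) (auto simp flip: of_nat_le_iff)
      then have "real j * h * norm z \<le> t * norm z"
        using h(2) by (intro mult_right_mono) auto
      then have "norm ((J h ^^ j) y' - y') \<le> t * norm z"
        using funpow_J_minus_id[OF yz h(1), of j] by linarith
      moreover have "norm ((J h ^^ j) y - (J h ^^ j) y') \<le> norm (y - y')"
        using funpow_J_contraction[OF h(1) X_diff[OF X(2,3)], of j] funpow_J_diff[OF h(1) X(2,3)] by simp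
      moreover have "norm (a - y) \<le> norm (a - b) + norm (b - y') + norm (y - y')" for a b
        by norm
      ultimately show ?thesis
        by (smt (verit, best))
    qed
    from funpow_J_first_order[where n = "2 ^ k", OF xy h(1) this] h(2)
    show "norm (E k t x - x - t *\<^sub>R y) \<le> t * (2 * norm (y - y') + t * norm z)"
      by (simp add: E_def h_def)
  qed
qed

lemma T_strongly_continuous:
  assumes x: "x \<in> X"
  shows "((\<lambda>t. T t x) \<longlongrightarrow> x) (at_right 0)"
proof (rule tendstoI)
  fix e :: real assume e: "0 < e"
  obtain x' y z where a: "(x', y) \<in> A" "(y, z) \<in> A" "norm (x - x') < e / 3"
    using dense_A2[OF x, of "e / 3"] e by auto
  have x': "x' \<in> X" using a A_X by auto
  have "((\<lambda>t. t * norm y) \<longlongrightarrow> 0 * norm y) (at_right 0)"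
    by (intro tendsto_intros)
  then have "\<forall>\<^sub>F t in at_right 0. t * norm y < e / 3"
    using e by (intro order_tendstoD) auto
  then show "\<forall>\<^sub>F t in at_right 0. dist (T t x) x < e"
    using eventually_at_right_less[of 0]
  proof eventually_elim
    case (elim t)
    then have "norm (T t x' - x') < e / 3"
      using T_minus_id[OF a(1), of t] by simp
    moreover have "norm (T t x - T t x') \<le> norm (x - x')"
      using T_contraction[of "x - x'" t] T_diff[OF x x', of t] elim X_diff[OF x x'] by simp
    ultimately show ?case
      using a(3) unfolding dist_norm by norm
  qed
qed

lemma C0_semigroup_T: "C0_semigroup X T"
  unfolding C0_semigroup_def
proof (intro conjI allI impI ballI)
  fix t :: real assume "0 \<le> t"
  then show "\<exists>K. \<forall>x\<in>X. norm (T t x) \<le> K * norm x"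
    using T_contraction by (intro exI[of _ 1]) auto
qed (auto simp: T_X T_add T_scale T_0 T_semigroup T_strongly_continuous)

lemma A_le_generator:
  assumes xy: "(x, y) \<in> A"
  shows "((\<lambda>t. (T t x - x) /\<^sub>R t) \<longlongrightarrow> y) (at_right 0)"
proof (rule tendstoI)
  fix e :: real assume e: "0 < e"
  have X: "x \<in> X" "y \<in> X" using A_X xy by auto
  \<comment> \<open>A quarter suffices because \<open>T_first_order\<close> doubles the distance
    from \<open>y\<close> to \<open>y'\<close>; the other half of \<open>e\<close> goes to the term
    with \<open>t\<close>.\<close>
  obtain y' z z' where a: "(y', z) \<in> A" "(z, z') \<in> A" "norm (y - y') < e / 4"
    using dense_A2[OF X(2), of "e / 4"] e by auto
  have "((\<lambda>t. t * norm z) \<longlongrightarrow> 0 * norm z) (at_right 0)"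
    by (intro tendsto_intros)
  then have "\<forall>\<^sub>F t in at_right 0. t * norm z < e / 2"
    using e by (intro order_tendstoD) auto
  then show "\<forall>\<^sub>F t in at_right 0. dist ((T t x - x) /\<^sub>R t) y < e"
    using eventually_at_right_less[of 0]
  proof eventually_elim
    case (elim t)
    have "(T t x - x) /\<^sub>R t - y = (T t x - x - t *\<^sub>R y) /\<^sub>R t"
      using elim by (simp add: scaleR_diff_right)
    also have "norm \<dots> \<le> inverse t * (t * (2 * norm (y - y') + t * norm z))"
      using T_first_order[OF xy a(1), of t] elim unfolding norm_scaleR by (intro mult_mono) auto
    also have "\<dots> = 2 * norm (y - y') + t * norm z"
      using elim by simp
    finally show ?case
      using elim a(3) unfolding dist_norm by linarith
  qed
qed

text \<open>Maximality: for \<open>(x, y)\<close> in the generator, the range condition gives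
  \<open>(a, b)\<close> in \<open>A\<close> with a - b = x - y. Then \<open>d = x - a\<close> is
  mapped to itself by the generator, whereas the generator of a contraction semigroup is
  dissipative, so |d|^2 \<le> 0.\<close>

lemma generator_T: "generator X T = A"
proof (rule set_eqI, clarify)
  fix x y
  show "(x, y) \<in> generator X T \<longleftrightarrow> (x, y) \<in> A"
  proof
    assume "(x, y) \<in> A"
    then show "(x, y) \<in> generator X T"
      using A_X A_le_generator by (auto simp: generator_def)
  next
    assume "(x, y) \<in> generator X T"
    then have xy: "x \<in> X" "y \<in> X" "((\<lambda>t. (T t x - x) /\<^sub>R t) \<longlongrightarrow> y) (at_right 0)"
      by (auto simp: generator_def)
    obtain a b where ab: "(a, b) \<in> A" "a - 1 *\<^sub>R b = x - y"
      using range[of 1 "x - y"] xy X_diff by auto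
    have aX: "a \<in> X" using A_X ab by auto
    define d where "d = x - a"
    have d: "d \<in> X" using X_diff xy aX by (simp add: d_def)
    have bd: "y - b = d"
      using ab(2) by (simp add: d_def algebra_simps)
    have "((\<lambda>t. (T t x - x) /\<^sub>R t - (T t a - a) /\<^sub>R t) \<longlongrightarrow> y - b) (at_right 0)"
      by (intro tendsto_diff xy A_le_generator ab)
    then have "((\<lambda>t. ((T t x - x) /\<^sub>R t - (T t a - a) /\<^sub>R t) \<bullet> d) \<longlongrightarrow> d \<bullet> d) (at_right 0)"
      unfolding bd by (intro tendsto_inner tendsto_const)
    moreover have "\<forall>\<^sub>F t in at_right 0. ((T t x - x) /\<^sub>R t - (T t a - a) /\<^sub>R t) \<bullet> d \<le> 0"
      using eventually_at_right_less[of 0]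
    proof eventually_elim
      case (elim t)
      have "T t x - T t a = T t d"
        using elim T_diff[OF xy(1) aX] by (simp add: d_def)
      then have "T t x - x - (T t a - a) = T t d - d"
        by (simp add: d_def)
      then have "(T t x - x) /\<^sub>R t - (T t a - a) /\<^sub>R t = (T t d - d) /\<^sub>R t"
        by (metis scaleR_diff_right)
      moreover have "T t d \<bullet> d \<le> d \<bullet> d"
        using norm_cauchy_schwarz[of "T t d" d] T_contraction[OF d, of t] elim
          mult_right_mono[of "norm (T t d)" "norm d" "norm d"]
        by (simp add: power2_norm_eq_inner[symmetric] power2_eq_square)
      ultimately show ?case
        using elim by (simp add: inner_diff_left mult_nonneg_nonpos)
    qed
    ultimately have "d \<bullet> d \<le> 0"
      by (intro tendsto_upperbound[OF _ _ trivial_limit_at_right_real])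
    then have "d = 0"
      by (metis inner_eq_zero_iff inner_ge_zero order_antisym)
    with bd ab(1) show "(x, y) \<in> A" by (simp add: d_def)
  qed
qed

lemma generates_T: "generates X A T"
  by (simp add: generates_def C0_semigroup_T generator_T)

end

section \<open>The space L2(0,L)\<close>

lemma sq_eq_refl [simp]: "sq_eq f f \<longleftrightarrow> sq_integrable f"
  by (simp add: sq_eq_def)

lemma abs_L2R_eq_iff:
  assumes "sq_integrable f" "sq_integrable g"
  shows "abs_L2R f = abs_L2R g \<longleftrightarrow> (AE z in lborel. f z = g z)"
  using Quotient3_rel[OF Quotient3_L2R, of f g] assms by (auto simp: sq_eq_def)

lemma abs_rep_L2R [simp]: "abs_L2R (rep_L2R x) = x"
  by (rule Quotient3_abs_rep[OF Quotient3_L2R])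

lemma sq_integrable_rep [simp]: "sq_integrable (rep_L2R x)"
  using Quotient3_rep_reflp[OF Quotient3_L2R, of x] by simp

text \<open>The closed interval, although \<open>L2\<close> speaks of the open one: the two differ
  by a null set, and continuity, compactness and gauge integrals are all used on the closed
  interval. Together with \<open>cl\<close> this allows work with functions whose values outside are
  irrelevant.\<close>

definition zext :: "real \<Rightarrow> (real \<Rightarrow> real) \<Rightarrow> real \<Rightarrow> real" where
  "zext L u z = indicator {0..L} z * u z"

definition sqi :: "real \<Rightarrow> (real \<Rightarrow> real) \<Rightarrow> bool" where
  "sqi L u \<longleftrightarrow> sq_integrable (zext L u)"

definition cl :: "real \<Rightarrow> (real \<Rightarrow> real) \<Rightarrow> L2R" where
  "cl L u = abs_L2R (zext L u)"

lemma zext_in: "z \<in> {0..L} \<Longrightarrow> zext L u z = u z"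
  by (simp add: zext_def)

lemma zext_add: "zext L (\<lambda>z. u z + v z) = (\<lambda>z. zext L u z + zext L v z)"
  and zext_diff: "zext L (\<lambda>z. u z - v z) = (\<lambda>z. zext L u z - zext L v z)"
  and zext_scale: "zext L (\<lambda>z. c * u z) = (\<lambda>z. c * zext L u z)"
  and zext_mult: "zext L (\<lambda>z. u z * v z) = (\<lambda>z. zext L u z * zext L v z)"
  by (auto simp: zext_def indicator_def algebra_simps)

lemma sqi_add: "sqi L u \<Longrightarrow> sqi L v \<Longrightarrow> sqi L (\<lambda>z. u z + v z)"
  unfolding sqi_def zext_add by (rule sq_integrable_add)

lemma sqi_scale: "sqi L u \<Longrightarrow> sqi L (\<lambda>z. c * u z)"
  unfolding sqi_def zext_scale by (rule sq_integrable_cmult)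

lemma sqi_diff: "sqi L u \<Longrightarrow> sqi L v \<Longrightarrow> sqi L (\<lambda>z. u z - v z)"
  using sqi_add[of L u "\<lambda>z. -1 * v z"] sqi_scale[of L v "-1"] by simp

lemma cl_add: "sqi L u \<Longrightarrow> sqi L v \<Longrightarrow> cl L (\<lambda>z. u z + v z) = cl L u + cl L v"
  by (simp add: cl_def sqi_def zext_add plus_L2R.abs_eq)

lemma cl_scale: "sqi L u \<Longrightarrow> cl L (\<lambda>z. c * u z) = c *\<^sub>R cl L u"
  by (simp add: cl_def sqi_def zext_scale scaleR_L2R.abs_eq)

lemma cl_diff: "sqi L u \<Longrightarrow> sqi L v \<Longrightarrow> cl L (\<lambda>z. u z - v z) = cl L u - cl L v"
  by (simp add: cl_def sqi_def zext_diff minus_L2R.abs_eq)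

lemma cl_zero: "cl L (\<lambda>_. 0) = 0"
  by (simp add: cl_def zero_L2R_def zext_def[abs_def])

lemma sqi_measurable: "sqi L u \<Longrightarrow> zext L u \<in> borel_measurable borel"
  by (simp add: sqi_def sq_integrable_def)

lemma sqi_of_sq_integrable:
  assumes "sq_integrable u" shows "sqi L u"
proof -
  have "u \<in> borel_measurable borel" using assms by (simp add: sq_integrable_def)
  then have m: "zext L u \<in> borel_measurable lborel"
    unfolding zext_def[abs_def] by simp
  moreover have "integrable lborel (\<lambda>z. (zext L u z)\<^sup>2)"
    by (rule Bochner_Integration.integrable_bound[of lborel "\<lambda>z. (u z)\<^sup>2"])
       (use assms m in \<open>auto simp: sq_integrable_def zext_def indicator_def\<close>)
  ultimately show ?thesis by (simp add: sqi_def sq_integrable_def)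
qed

lemma sqi_rep [simp]: "sqi L (rep_L2R x)"
  by (simp add: sqi_of_sq_integrable)

lemma AE_interior_iff:
  "(AE z in lborel. z \<in> {0<..<L} \<longrightarrow> P z) \<longleftrightarrow> (AE z in lborel. z \<in> {0..L} \<longrightarrow> P z)" for L :: real
proof -
  have "AE z in lborel. (z \<in> {0<..<L} \<longrightarrow> P z) \<longleftrightarrow> (z \<in> {0..L} \<longrightarrow> P z)"
    using AE_lborel_singleton[of "0 :: real"] AE_lborel_singleton[of L] by eventually_elim auto
  then show ?thesis by (rule eventually_subst)
qed

lemma cl_L2 [simp]: 
  assumes "sqi L u" shows "cl L u \<in> L2 L"
proof -
  have "AE z in lborel. z \<notin> {0<..<L} \<longrightarrow> zext L u z = 0"
    using AE_lborel_singleton[of "0 :: real"] AE_lborel_singleton[of L]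
    by eventually_elim (auto simp: zext_def indicator_def)
  then show ?thesis
    using assms by (simp add: L2_def cl_def vanishes_outside.abs_eq sqi_def)
qed

lemma cl_rep:
  assumes "x \<in> L2 L" shows "cl L (rep_L2R x) = x"
proof -
  have "vanishes_outside {0<..<L} (abs_L2R (rep_L2R x))"
    using assms by (simp add: L2_def)
  then have "AE z in lborel. z \<notin> {0<..<L} \<longrightarrow> rep_L2R x z = 0"
    by (simp only: vanishes_outside.abs_eq sq_eq_refl sq_integrable_rep)
  then have "AE z in lborel. zext L (rep_L2R x) z = rep_L2R x z"
    by eventually_elim (auto simp: zext_def indicator_def)
  then have "cl L (rep_L2R x) = abs_L2R (rep_L2R x)"
    unfolding cl_def using sqi_rep[of L x] by (subst abs_L2R_eq_iff) (auto simp: sqi_def)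
  then show ?thesis by simp
qed

lemma L2_cases:
  assumes "x \<in> L2 L" obtains u where "sqi L u" "x = cl L u"
  using cl_rep[OF assms] sqi_rep by metis

lemma cl_eq_iff:
  assumes "sqi L u" "sqi L v"
  shows "cl L u = cl L v \<longleftrightarrow> (AE z in lborel. z \<in> {0..L} \<longrightarrow> u z = v z)"
proof -
  have "cl L u = cl L v \<longleftrightarrow> (AE z in lborel. zext L u z = zext L v z)"
    using assms unfolding cl_def sqi_def by (rule abs_L2R_eq_iff)
  also have "(\<lambda>z. zext L u z = zext L v z) = (\<lambda>z. z \<in> {0..L} \<longrightarrow> u z = v z)"
    by (auto simp: zext_def indicator_def)
  finally show ?thesis .
qed

lemma sqi_cong_AE:
  assumes "sqi L u" "zext L v \<in> borel_measurable borel" "AE z in lborel. z \<in> {0..L} \<longrightarrow> u z = v z"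
  shows "sqi L v"
proof -
  have "AE z in lborel. (zext L u z)\<^sup>2 = (zext L v z)\<^sup>2"
    using assms(3) by eventually_elim (auto simp: zext_def indicator_def)
  then have "integrable lborel (\<lambda>z. (zext L v z)\<^sup>2)"
    using assms by (subst integrable_cong_AE[of _ _ "\<lambda>z. (zext L u z)\<^sup>2"])
      (auto simp: sqi_def sq_integrable_def elim: eventually_mono)
  with assms show ?thesis by (auto simp: sqi_def sq_integrable_def)
qed

lemma integral_zext:
  assumes "integrable lborel (zext L f)"
  shows "f absolutely_integrable_on {0..L}" "integral {0..L} f = (\<integral>z. zext L f z \<partial>lborel)"
proof -
  have *: "set_integrable lborel {0..L} f"
    using assms by (simp add: set_integrable_def zext_def[abs_def])
  then show "f absolutely_integrable_on {0..L}"
    using integrable_completion[of "\<lambda>x. indicat_real {0..L} x *\<^sub>R f x" lborel]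
    unfolding set_integrable_def by (meson borel_measurable_integrable)
  show "integral {0..L} f = (\<integral>z. zext L f z \<partial>lborel)"
    using set_borel_integral_eq_integral(2)[OF *] 
    by (simp add: set_lebesgue_integral_def zext_def[abs_def])
qed

lemma sqi_mult:
  assumes "sqi L u" "sqi L v" shows "integrable lborel (zext L (\<lambda>z. u z * v z))"
  using sq_integrable_mult[of "zext L u" "zext L v"] assms by (simp add: sqi_def zext_mult)

lemma inner_cl:
  assumes "sqi L u" "sqi L v"
  shows "cl L u \<bullet> cl L v = integral {0..L} (\<lambda>z. u z * v z)"
  using integral_zext(2)[OF sqi_mult[OF assms]] assms
  by (simp add: cl_def sqi_def inner_L2R.abs_eq zext_mult)

lemma sqi_continuous:
  assumes "continuous_on {0..L} u" shows "sqi L u"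
proof -
  have "continuous_on {0..L} (\<lambda>z. (u z)\<^sup>2)"
    by (intro continuous_intros assms)
  then have "integrable lborel (\<lambda>z. (u z)\<^sup>2 * indicator {0..L} z)"
    using borel_integrable_compact[of "{0..L}" "\<lambda>z. (u z)\<^sup>2"] by (simp add: mult.commute indicator_def if_distrib cong: if_cong)
  moreover have "(\<lambda>z. (u z)\<^sup>2 * indicator {0..L} z) = (\<lambda>z. (zext L u z)\<^sup>2)"
    by (auto simp: zext_def indicator_def)
  moreover have "zext L u \<in> borel_measurable borel"
    using borel_measurable_continuous_on_indicator[OF _ assms] by (simp add: zext_def[abs_def])
  ultimately show ?thesis by (simp add: sqi_def sq_integrable_def)
qed

lemma sqi_absolutely_integrable:
  assumes "sqi L u" shows "integrable lborel (zext L u)" "u absolutely_integrable_on {0..L}"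
proof -
  show "integrable lborel (zext L u)"
    using sqi_mult[OF assms sqi_continuous[of L "\<lambda>_. 1"]] by simp
  then show "u absolutely_integrable_on {0..L}" by (rule integral_zext)
qed

section \<open>The positive cone\<close>

lemma nonneg_cl:
  assumes "sqi L u"
  shows "nonneg_L2R (cl L u) \<longleftrightarrow> (AE z in lborel. z \<in> {0..L} \<longrightarrow> 0 \<le> u z)"
proof -
  have "nonneg_L2R (cl L u) \<longleftrightarrow> (AE z in lborel. 0 \<le> zext L u z)"
    using assms by (simp add: cl_def sqi_def nonneg_L2R.abs_eq)
  also have "(\<lambda>z. 0 \<le> zext L u z) = (\<lambda>z. z \<in> {0..L} \<longrightarrow> 0 \<le> u z)"
    by (auto simp: zext_def indicator_def)
  finally show ?thesis .
qed

text \<open>Self-duality of the cone. It turns positivity into a family of inequalities between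
  inner products, which are stable under sums and norm limits.\<close>

lemma L2_pos_iff: "x \<in> L2_pos L \<longleftrightarrow> x \<in> L2 L \<and> (\<forall>y\<in>L2_pos L. 0 \<le> x \<bullet> y)"
proof safe
  fix y assume "x \<in> L2_pos L" "y \<in> L2_pos L"
  then obtain u v where uv: "sqi L u" "sqi L v" "x = cl L u" "y = cl L v"
    by (auto simp: L2_pos_def elim!: L2_cases)
  then have *: "AE z in lborel. z \<in> {0..L} \<longrightarrow> 0 \<le> u z" "AE z in lborel. z \<in> {0..L} \<longrightarrow> 0 \<le> v z"
    using \<open>x \<in> L2_pos L\<close> \<open>y \<in> L2_pos L\<close> by (auto simp: L2_pos_def nonneg_cl)
  have "0 \<le> (\<integral>z. zext L (\<lambda>z. u z * v z) z \<partial>lborel)"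
    by (rule integral_nonneg_AE, use * in eventually_elim) (auto simp: zext_def indicator_def)
  then show "0 \<le> x \<bullet> y"
    using uv integral_zext(2)[OF sqi_mult] by (simp add: inner_cl)
next
  assume x: "x \<in> L2 L" "\<forall>y\<in>L2_pos L. 0 \<le> x \<bullet> y"
  then obtain u where u: "sqi L u" "x = cl L u" by (elim L2_cases)
  \<comment> \<open>The negative part as test element: its inner product with \<open>x\<close> is
    minus its squared norm.\<close>
  define n where "n z = max 0 (- u z)" for z
  have n: "sqi L n"
  proof -
    have "zext L n = (\<lambda>z. max 0 (- zext L u z))"
      by (auto simp: zext_def n_def indicator_def)
    then have "zext L n \<in> borel_measurable lborel"
      using sqi_measurable[OF u(1)] by simp
    moreover have "integrable lborel (\<lambda>z. (zext L n z)\<^sup>2)"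
    proof (rule Bochner_Integration.integrable_bound[of lborel "\<lambda>z. (zext L u z)\<^sup>2"])
      show "integrable lborel (\<lambda>z. (zext L u z)\<^sup>2)"
        using u(1) by (simp add: sqi_def sq_integrable_def)
      show "(\<lambda>z. (zext L n z)\<^sup>2) \<in> borel_measurable lborel"
        using \<open>zext L n \<in> borel_measurable lborel\<close> by (rule borel_measurable_power)
    qed (auto simp: zext_def indicator_def n_def max_def)
    ultimately show ?thesis by (simp add: sqi_def sq_integrable_def)
  qed
  have "cl L n \<in> L2_pos L"
    using n by (simp add: L2_pos_def nonneg_cl) (simp add: n_def)
  then have "0 \<le> integral {0..L} (\<lambda>z. u z * n z)"
    using x u n by (auto simp: inner_cl)
  also have "(\<lambda>z. u z * n z) = (\<lambda>z. -1 * (n z * n z))"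
    by (auto simp: n_def max_def)
  also have "integral {0..L} \<dots> = - (cl L n \<bullet> cl L n)"
    using n by (simp add: inner_cl)
  finally have "cl L n = 0"
    by (metis inner_eq_zero_iff inner_ge_zero neg_0_le_iff_le order_antisym)
  then have "AE z in lborel. z \<in> {0..L} \<longrightarrow> n z = 0"
    using cl_eq_iff[OF n sqi_continuous[of L "\<lambda>_. 0"]] by (simp add: cl_zero)
  then have "AE z in lborel. z \<in> {0..L} \<longrightarrow> 0 \<le> u z"
    by eventually_elim (auto simp: n_def max_def split: if_splits)
  with u show "x \<in> L2_pos L" by (simp add: L2_pos_def nonneg_cl)
qed (auto simp: L2_pos_def)

lemma L2_pos_add: "x \<in> L2_pos L \<Longrightarrow> y \<in> L2_pos L \<Longrightarrow> x + y \<in> L2_pos L"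
  using subspace_add[OF subspace_L2] by (subst L2_pos_iff, subst (asm) (1 2) L2_pos_iff) (auto simp: inner_add_left)

lemma L2_pos_tendsto:
  assumes "\<And>n. f n \<in> L2_pos L" "f \<longlonglongrightarrow> x" "x \<in> L2 L"
  shows "x \<in> L2_pos L"
  unfolding L2_pos_iff[of x]
proof safe
  fix y assume "y \<in> L2_pos L"
  then have "0 \<le> f n \<bullet> y" for n using assms(1) L2_pos_iff by blast
  moreover have "(\<lambda>n. f n \<bullet> y) \<longlonglongrightarrow> x \<bullet> y" by (intro tendsto_intros assms)
  ultimately show "0 \<le> x \<bullet> y" by (intro LIMSEQ_le_const) auto
qed (rule assms)

section \<open>Completeness\<close>

lemma norm_cl_nn_integral:
  assumes "sqi L u"
  shows "(\<integral>\<^sup>+z. ennreal ((zext L u z)\<^sup>2) \<partial>lborel) = ennreal ((norm (cl L u))\<^sup>2)"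
proof -
  have "integrable lborel (\<lambda>z. (zext L u z)\<^sup>2)"
    using assms by (simp add: sqi_def sq_integrable_def)
  then have "(\<integral>\<^sup>+z. ennreal ((zext L u z)\<^sup>2) \<partial>lborel) = ennreal (\<integral>z. (zext L u z)\<^sup>2 \<partial>lborel)"
    by (intro nn_integral_eq_integral) auto
  also have "(\<integral>z. (zext L u z)\<^sup>2 \<partial>lborel) = cl L u \<bullet> cl L u"
    using assms by (simp add: cl_def sqi_def inner_L2R.abs_eq power2_eq_square)
  finally show ?thesis by (simp add: power2_norm_eq_inner)
qed

text \<open>Cauchy-Schwarz against the constant 1. On a bounded interval a series summable in the L2
  norm is therefore summable in L1, hence absolutely convergent almost everywhere.\<close>

lemma nn_integral_zext_le:
  assumes "sqi L u"
  shows "(\<integral>\<^sup>+z. ennreal \<bar>zext L u z\<bar> \<partial>lborel) \<le> ennreal (norm (cl L (\<lambda>_. 1)) * norm (cl L u))"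
proof -
  have a: "sqi L (\<lambda>z. \<bar>u z\<bar>)"
  proof -
    have "zext L (\<lambda>z. \<bar>u z\<bar>) = (\<lambda>z. \<bar>zext L u z\<bar>)"
      by (auto simp: zext_def indicator_def)
    then show ?thesis using assms by (auto simp: sqi_def sq_integrable_def)
  qed
  have 1: "sqi L (\<lambda>_. 1)" by (rule sqi_continuous) simp
  have "(\<integral>\<^sup>+z. ennreal \<bar>zext L u z\<bar> \<partial>lborel) = ennreal (\<integral>z. \<bar>zext L u z\<bar> \<partial>lborel)"
    using sqi_absolutely_integrable(1)[OF assms] by (intro nn_integral_eq_integral) auto
  also have "(\<integral>z. \<bar>zext L u z\<bar> \<partial>lborel) = cl L (\<lambda>_. 1) \<bullet> cl L (\<lambda>z. \<bar>u z\<bar>)"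
    unfolding inner_cl[OF 1 a] using integral_zext(2)[OF sqi_mult[OF 1 a]]
    by (simp add: zext_def abs_mult)
  also have "\<dots> \<le> norm (cl L (\<lambda>_. 1)) * norm (cl L (\<lambda>z. \<bar>u z\<bar>))"
    by (rule norm_cauchy_schwarz)
  also have "norm (cl L (\<lambda>z. \<bar>u z\<bar>)) = norm (cl L u)"
    unfolding norm_eq_sqrt_inner inner_cl[OF a a] inner_cl[OF assms assms] by simp
  finally show ?thesis by (auto simp: ennreal_leI)
qed

lemma Cauchy_fast_subseq:
  fixes x :: "nat \<Rightarrow> 'a::metric_space"
  assumes "Cauchy x"
  obtains r where "strict_mono r" "\<And>n. dist (x (r (Suc n))) (x (r n)) < (1/2) ^ n"
proof -
  have "\<exists>N. \<forall>m\<ge>N. \<forall>n\<ge>N. dist (x m) (x n) < (1/2) ^ k" for k :: nat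
    using assms by (intro metric_CauchyD) auto
  then obtain N where N: "\<And>k m n. m \<ge> N k \<Longrightarrow> n \<ge> N k \<Longrightarrow> dist (x m) (x n) < (1/2) ^ k"
    by metis
  \<comment> \<open>The partial sum dominates every \<open>N j\<close> with j \<le> k, and the added
    \<open>k\<close> makes the sequence strictly increasing.\<close>
  define r where "r k = (\<Sum>j\<le>k. N j) + k" for k
  have "strict_mono r"
    by (rule strict_monoI_Suc) (auto simp: r_def)
  moreover have "r k \<ge> N k" for k
    using member_le_sum[of k "{..k}" N] by (simp add: r_def)
  then have "dist (x (r (Suc k))) (x (r k)) < (1/2) ^ k" for k
    using N[of k "r (Suc k)" "r k"] strict_monoD[OF \<open>strict_mono r\<close>, of k "Suc k"] 
    by (metis less_imp_le_nat lessI order_trans)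
  ultimately show ?thesis by (rule that)
qed

text \<open>The Riesz-Fischer argument: along a subsequence with increments below 2^(-n) the
  telescoping series converges almost everywhere, and Fatou's lemma upgrades the pointwise limit to
  a limit in norm.\<close>

lemma complete_L2: "complete (L2 L)"
  unfolding complete_def
proof safe
  fix x :: "nat \<Rightarrow> L2R" assume xL: "\<forall>n. x n \<in> L2 L" and C: "Cauchy x"
  obtain r where r: "strict_mono r" "\<And>n. dist (x (r (Suc n))) (x (r n)) < (1/2) ^ n"
    using Cauchy_fast_subseq[OF C] by blast
  define f where "f n = rep_L2R (x (r n))" for n
  have f: "sqi L (f n)" "cl L (f n) = x (r n)" for n
    using xL by (auto simp: f_def cl_rep)
  have fm [measurable]: "zext L (f n) \<in> borel_measurable borel" for n
    by (rule sqi_measurable[OF f(1)])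
  define d where "d n z = f (Suc n) z - f n z" for n z
  have d: "sqi L (d n)" "norm (cl L (d n)) \<le> (1/2) ^ n" for n
    using r(2)[of n] unfolding d_def by (auto simp: sqi_diff f cl_diff dist_norm)
  have dm [measurable]: "zext L (d n) \<in> borel_measurable borel" for n
    by (rule sqi_measurable[OF d(1)])
  define c where "c = norm (cl L (\<lambda>_. 1))"
  have "(\<integral>\<^sup>+z. (\<Sum>n. ennreal \<bar>zext L (d n) z\<bar>) \<partial>lborel) = (\<Sum>n. \<integral>\<^sup>+z. ennreal \<bar>zext L (d n) z\<bar> \<partial>lborel)"
    by (rule nn_integral_suminf) simp
  also have "\<dots> \<le> (\<Sum>n. ennreal (c * (1/2) ^ n))"
  proof (intro suminf_le)
    fix n
    have "ennreal (c * norm (cl L (d n))) \<le> ennreal (c * (1/2) ^ n)"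
      using d(2)[of n] by (intro ennreal_leI mult_left_mono) (auto simp: c_def)
    then show "(\<integral>\<^sup>+z. ennreal \<bar>zext L (d n) z\<bar> \<partial>lborel) \<le> ennreal (c * (1/2) ^ n)"
      using nn_integral_zext_le[OF d(1), of n] unfolding c_def by (rule order_trans[rotated])
  qed auto
  also have "\<dots> = ennreal (\<Sum>n. c * (1/2) ^ n)"
    by (intro suminf_ennreal2 summable_mult summable_geometric) (auto simp: c_def)
  also have "\<dots> < \<infinity>" by simp
  finally have "AE z in lborel. (\<Sum>n. ennreal \<bar>zext L (d n) z\<bar>) \<noteq> \<infinity>"
    by (intro nn_integral_PInf_AE) auto
  then have conv: "AE z in lborel. convergent (\<lambda>n. zext L (f n) z)"
  proof eventually_elim
    case (elim z)
    have "summable (\<lambda>n. \<bar>zext L (d n) z\<bar>)"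
      using elim by (intro summable_suminf_not_top) auto
    then have "summable (\<lambda>n. zext L (d n) z)"
      by (rule summable_rabs_cancel)
    then have "summable (\<lambda>n. zext L (f (Suc n)) z - zext L (f n) z)"
      by (simp add: d_def[abs_def] zext_diff)
    then have "convergent (\<lambda>n. \<Sum>i<n. zext L (f (Suc i)) z - zext L (f i) z)"
      by (simp add: summable_iff_convergent)
    then have "convergent (\<lambda>n. zext L (f n) z - zext L (f 0) z)"
      by (simp only: sum_lessThan_telescope[of "\<lambda>n. zext L (f n) z"])
    then show ?case by (simp add: convergent_diff_const_right_iff)
  qed
  define F where "F z = lim (\<lambda>n. zext L (f n) z)" for z
  have Fm [measurable]: "F \<in> borel_measurable borel"
    unfolding F_def by measurable
  \<comment> \<open>Outside the interval the sequence is constantly 0, so the limit vanishes there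
    exactly and not only almost everywhere.\<close>
  have FL: "zext L F = F"
    by (auto simp: zext_def F_def indicator_def)
  have lim: "AE z in lborel. (\<lambda>n. zext L (f n) z) \<longlonglongrightarrow> F z"
    using conv by eventually_elim (simp add: F_def convergent_LIMSEQ_iff)
  \<comment> \<open>Fatou's lemma in \<open>m\<close>, with \<open>k\<close> fixed. The finite bound
    also shows that the difference from \<open>F\<close> is square integrable, which is how
    \<open>F\<close> itself is seen to be.\<close>
  have est: "(\<integral>\<^sup>+z. ennreal ((F z - zext L (f k) z)\<^sup>2) \<partial>lborel) \<le> ennreal (e\<^sup>2)"
    if e: "0 < e" "\<And>m. m \<ge> k \<Longrightarrow> dist (x (r m)) (x (r k)) \<le> e" for k e
  proof -
    have "AE z in lborel. ennreal ((F z - zext L (f k) z)\<^sup>2) 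
        = liminf (\<lambda>m. ennreal ((zext L (f m) z - zext L (f k) z)\<^sup>2))"
      using lim
    proof eventually_elim
      case (elim z)
      then have "(\<lambda>m. ennreal ((zext L (f m) z - zext L (f k) z)\<^sup>2)) \<longlonglongrightarrow> ennreal ((F z - zext L (f k) z)\<^sup>2)"
        by (intro tendsto_intros tendsto_ennrealI)
      from lim_imp_Liminf[OF _ this] show ?case by simp
    qed
    then have "(\<integral>\<^sup>+z. ennreal ((F z - zext L (f k) z)\<^sup>2) \<partial>lborel)
        = (\<integral>\<^sup>+z. liminf (\<lambda>m. ennreal ((zext L (f m) z - zext L (f k) z)\<^sup>2)) \<partial>lborel)"
      by (rule nn_integral_cong_AE)
    also have "\<dots> \<le> liminf (\<lambda>m. \<integral>\<^sup>+z. ennreal ((zext L (f m) z - zext L (f k) z)\<^sup>2) \<partial>lborel)"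
      by (rule nn_integral_liminf) simp
    also have "\<dots> \<le> liminf (\<lambda>m. ennreal (e\<^sup>2))"
    proof (rule Liminf_mono)
      show "\<forall>\<^sub>F m in sequentially. (\<integral>\<^sup>+z. ennreal ((zext L (f m) z - zext L (f k) z)\<^sup>2) \<partial>lborel) \<le> ennreal (e\<^sup>2)"
        using eventually_ge_at_top[of k]
      proof eventually_elim
        case (elim m)
        have "(norm (cl L (\<lambda>z. f m z - f k z)))\<^sup>2 \<le> e\<^sup>2"
          using e(2)[OF elim] by (intro power_mono) (auto simp: cl_diff f dist_norm)
        then show ?case
          using norm_cl_nn_integral[OF sqi_diff[OF f(1) f(1)], of m k] by (simp add: zext_diff ennreal_leI)
      qed
    qed
    also have "\<dots> = ennreal (e\<^sup>2)" by (simp add: Liminf_const)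
    finally show ?thesis .
  qed
  have Fk: "sqi L (\<lambda>z. F z - f k z) \<and> norm (cl L (\<lambda>z. F z - f k z)) \<le> e"
    if e: "0 < e" "\<And>m. m \<ge> k \<Longrightarrow> dist (x (r m)) (x (r k)) \<le> e" for k e
  proof -
    have "integrable lborel (\<lambda>z. (F z - zext L (f k) z)\<^sup>2)"
      using est[OF e] by (intro integrableI_bounded) (auto intro: le_less_trans)
    then have s: "sqi L (\<lambda>z. F z - f k z)"
      by (simp add: sqi_def sq_integrable_def zext_diff FL)
    moreover have "ennreal ((norm (cl L (\<lambda>z. F z - f k z)))\<^sup>2) \<le> ennreal (e\<^sup>2)"
      using est[OF e] norm_cl_nn_integral[OF s] by (simp add: zext_diff FL)
    then have "norm (cl L (\<lambda>z. F z - f k z)) \<le> e"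
      using e by (subst (asm) ennreal_le_iff) (auto intro: power2_le_imp_le)
    ultimately show ?thesis ..
  qed
  have CK: "\<exists>K. \<forall>k\<ge>K. \<forall>m\<ge>k. dist (x (r m)) (x (r k)) \<le> e" if "0 < e" for e
  proof -
    obtain M where M: "\<And>m n. m \<ge> M \<Longrightarrow> n \<ge> M \<Longrightarrow> dist (x m) (x n) < e"
      using metric_CauchyD[OF C \<open>0 < e\<close>] by blast
    have "dist (x (r m)) (x (r k)) \<le> e" if "k \<ge> M" "m \<ge> k" for k m
      using M[of "r m" "r k"] seq_suble[OF r(1), of m] seq_suble[OF r(1), of k] that by fastforce
    then show ?thesis by blast
  qed
  obtain K where "sqi L (\<lambda>z. F z - f K z)"
    using CK[of 1] Fk[of 1] by auto
  from sqi_add[OF this f(1)[of K]] have F: "sqi L F" by simp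
  have "(\<lambda>k. x (r k)) \<longlonglongrightarrow> cl L F"
  proof (rule metric_LIMSEQ_I)
    fix e :: real assume e: "0 < e"
    obtain K where K: "\<forall>k\<ge>K. \<forall>m\<ge>k. dist (x (r m)) (x (r k)) \<le> e / 2"
      using CK[of "e / 2"] e by auto
    have "dist (x (r k)) (cl L F) < e" if "k \<ge> K" for k
    proof -
      have "norm (cl L (\<lambda>z. F z - f k z)) \<le> e / 2"
        by (rule Fk[THEN conjunct2]) (use K that e in auto)
      then show ?thesis
        using e by (simp add: cl_diff F f dist_norm norm_minus_commute)
    qed
    then show "\<exists>K. \<forall>k\<ge>K. dist (x (r k)) (cl L F) < e" by blast
  qed
  then have "x \<longlonglongrightarrow> cl L F"
    using Cauchy_converges_subseq[OF C r(1)] by (simp add: o_def)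
  with cl_L2[OF F] show "\<exists>l\<in>L2 L. x \<longlonglongrightarrow> l" ..
qed

section \<open>Absolutely continuous functions\<close>

text \<open>\<open>F\<close> is absolutely continuous on \<open>[0,L]\<close> with derivative \<open>f\<close>.\<close>

definition primitive :: "real \<Rightarrow> (real \<Rightarrow> real) \<Rightarrow> (real \<Rightarrow> real) \<Rightarrow> bool" where
  "primitive L f F \<longleftrightarrow> f absolutely_integrable_on {0..L} \<and>
     (\<forall>z\<in>{0..L}. (f has_integral (F z - F 0)) {0..z})"

lemma primitive_integral:
  assumes "primitive L f F" "z \<in> {0..L}"
  shows "F z = F 0 + integral {0..z} f"
proof -
  have "integral {0..z} f = F z - F 0"
    using assms by (intro integral_unique) (auto simp: primitive_def)
  then show ?thesis by simp
qed

lemma primitive_indefinite: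
  assumes "f absolutely_integrable_on {0..L}"
  shows "primitive L f (\<lambda>z. c + integral {0..z} f)"
proof -
  have "f integrable_on {0..z}" if "z \<in> {0..L}" for z
    using set_lebesgue_integral_eq_integral(1)[OF assms] that
    by (auto intro: integrable_subinterval_real)
  then show ?thesis
    using assms by (auto simp: primitive_def intro!: integrable_integral)
qed

lemma primitive_continuous:
  assumes "primitive L f F" shows "continuous_on {0..L} F"
proof -
  have "f integrable_on {0..L}"
    using assms set_lebesgue_integral_eq_integral(1) by (auto simp: primitive_def)
  then have "continuous_on {0..L} (\<lambda>z. F 0 + integral {0..z} f)"
    by (intro continuous_intros indefinite_integral_continuous_1)
  then show ?thesis
    by (rule continuous_on_eq) (rule primitive_integral[OF assms, symmetric])
qed

lemma primitive_C1:
  assumes "\<And>z. z \<in> {0..L} \<Longrightarrow> (F has_real_derivative f z) (at z within {0..L})" "continuous_on {0..L} f"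
  shows "primitive L f F"
  unfolding primitive_def
proof (intro conjI ballI)
  show "f absolutely_integrable_on {0..L}"
    using assms(2) by (intro absolutely_integrable_continuous_real)
  fix z assume z: "z \<in> {0..L}"
  show "(f has_integral F z - F 0) {0..z}"
    using z assms(1)
    by (intro fundamental_theorem_of_calculus)
      (auto simp flip: has_real_derivative_iff_has_vector_derivative intro: DERIV_subset[where s = "{0..L}"])
qed

lemma primitive_DERIV:
  assumes "primitive L f F" "continuous_on {0..L} f" "z \<in> {0..L}"
  shows "(F has_real_derivative f z) (at z within {0..L})"
proof -
  have "((\<lambda>z. F 0 + integral {0..z} f) has_real_derivative 0 + f z) (at z within {0..L})"
    using assms by (intro DERIV_add DERIV_const integral_has_real_derivative)
  then have "((\<lambda>z. F 0 + integral {0..z} f) has_real_derivative f z) (at z within {0..L})"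
    by simp
  then show ?thesis
    by (rule has_field_derivative_transform_within[OF _ zero_less_one assms(3)])
       (rule primitive_integral[OF assms(1), symmetric])
qed

section \<open>Product rule and integration by parts\<close>

lemma absolutely_integrable_mult_continuous:
  fixes f h :: "real \<Rightarrow> real"
  assumes "f absolutely_integrable_on {a..b}" "continuous_on {a..b} h"
  shows "(\<lambda>s. f s * h s) absolutely_integrable_on {a..b}"
proof -
  have "(\<lambda>s. h s * f s) absolutely_integrable_on {a..b}"
    using assms compact_continuous_image[OF assms(2)]
    by (intro absolutely_integrable_bounded_measurable_product_real
        continuous_imp_measurable_on_sets_lebesgue compact_imp_bounded) auto
  then show ?thesis by (simp add: mult.commute)
qed

text \<open>The defect of the product rule over [a, b] is the integral of f (H b - H s) plus that of
  (F a - F s) h. One factor is of size C (b - a), the other is controlled by the integral of |f|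
  over [a, b], which is small as well: the defect is of smaller order than b - a.\<close>

lemma product_increment_bound:
  fixes f h :: "real \<Rightarrow> real"
  assumes P: "primitive L f F" and H: "primitive L h H" and ch: "continuous_on {0..L} h"
    and C: "\<And>z. z \<in> {0..L} \<Longrightarrow> \<bar>h z\<bar> \<le> C" and ab: "0 \<le> a" "a \<le> b" "b \<le> L"
  shows "\<bar>F b * H b - F a * H a - integral {a..b} (\<lambda>s. f s * H s + F s * h s)\<bar>
     \<le> 2 * C * (b - a) * integral {a..b} (\<lambda>s. \<bar>f s\<bar>)"
proof -
  have sub: "{a..b} \<subseteq> {0..L}" using ab by auto
  have f: "f absolutely_integrable_on {a..b}"
    using P sub unfolding primitive_def by (blast intro: absolutely_integrable_on_subinterval)
  have fa: "(\<lambda>s. \<bar>f s\<bar>) absolutely_integrable_on {a..b}"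
    using absolutely_integrable_norm[OF f] by (simp add: o_def)
  have int: "g integrable_on {a..b}" if "g absolutely_integrable_on {a..b}" for g :: "real \<Rightarrow> real"
    using that set_lebesgue_integral_eq_integral(1) by blast
  have inc: "G y - G x = integral {x..y} g" if "primitive L g G" "0 \<le> x" "x \<le> y" "y \<le> L" for g G x y
  proof -
    have "g integrable_on {0..y}"
      using that set_lebesgue_integral_eq_integral(1)[of "{0..L}" g]
      by (auto simp: primitive_def intro: integrable_subinterval_real)
    then show ?thesis
      using that primitive_integral[OF that(1), of x] primitive_integral[OF that(1), of y]
        Henstock_Kurzweil_Integration.integral_combine[of 0 x y g] by auto
  qed
  have cF: "continuous_on {a..b} F" "continuous_on {a..b} H" "continuous_on {a..b} h"
    using primitive_continuous[OF P] primitive_continuous[OF H] ch continuous_on_subset sub by blast+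
  have absub: "integral {x..y} (\<lambda>s. \<bar>f s\<bar>) \<le> integral {a..b} (\<lambda>s. \<bar>f s\<bar>)" if "a \<le> x" "x \<le> y" "y \<le> b" for x y
    using that int[OF fa] by (intro integral_subset_le) (auto intro: integrable_subinterval_real)
  have Hb: "\<bar>H b - H s\<bar> \<le> C * (b - a)" if "s \<in> {a..b}" for s
  proof -
    have "\<bar>H b - H s\<bar> = norm (integral {s..b} h)"
      using inc[OF H, of s b] that ab by simp
    also have "\<dots> \<le> C * (b - s)"
      using that ab ch C by (intro integral_bound) (auto intro: continuous_on_subset)
    also have "\<dots> \<le> C * (b - a)"
      using that C[of 0] ab by (intro mult_left_mono) auto
    finally show ?thesis .
  qed
  have Fa: "\<bar>F a - F s\<bar> \<le> integral {a..b} (\<lambda>s. \<bar>f s\<bar>)" if "s \<in> {a..b}" for s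
  proof -
    have "\<bar>F a - F s\<bar> = norm (integral {a..s} f)"
      using inc[OF P, of a s] that ab by simp
    also have "\<dots> \<le> integral {a..s} (\<lambda>s. \<bar>f s\<bar>)"
      using that int[OF f] int[OF fa] 
      by (intro Henstock_Kurzweil_Integration.integral_norm_bound_integral) (auto intro: integrable_subinterval_real)
    also have "\<dots> \<le> integral {a..b} (\<lambda>s. \<bar>f s\<bar>)"
      using that by (intro absub) auto
    finally show ?thesis .
  qed
  define I where "I = integral {a..b} (\<lambda>s. \<bar>f s\<bar>)"
  have i1: "(\<lambda>s. f s * H s) integrable_on {a..b}" "(\<lambda>s. F s * h s) integrable_on {a..b}"
    using int[OF absolutely_integrable_mult_continuous[OF f cF(2)]] cF
    by (auto intro!: integrable_continuous_real continuous_intros)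
  have e1: "integral {a..b} (\<lambda>s. f s * (H b - H s)) = (F b - F a) * H b - integral {a..b} (\<lambda>s. f s * H s)"
    using i1 int[OF f] inc[OF P] ab by (simp add: right_diff_distrib integral_diff integrable_on_mult_left)
  have e2: "integral {a..b} (\<lambda>s. (F a - F s) * h s) = F a * (H b - H a) - integral {a..b} (\<lambda>s. F s * h s)"
    using i1 cF(3) inc[OF H] ab
    by (simp add: left_diff_distrib integral_diff integrable_on_mult_right integrable_continuous_real)
  define X Y where "X = integral {a..b} (\<lambda>s. f s * (H b - H s))" and "Y = integral {a..b} (\<lambda>s. (F a - F s) * h s)"
  have XY: "F b * H b - F a * H a - integral {a..b} (\<lambda>s. f s * H s + F s * h s) = X + Y"
    unfolding X_def Y_def e1 e2 using i1 by (simp add: integral_add algebra_simps)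
  have "norm X \<le> integral {a..b} (\<lambda>s. C * (b - a) * \<bar>f s\<bar>)"
    unfolding X_def
  proof (rule Henstock_Kurzweil_Integration.integral_norm_bound_integral)
    show "(\<lambda>s. f s * (H b - H s)) integrable_on {a..b}"
      by (intro int absolutely_integrable_mult_continuous f continuous_intros cF)
    show "(\<lambda>s. C * (b - a) * \<bar>f s\<bar>) integrable_on {a..b}"
      using int[OF fa] by (rule integrable_on_mult_right)
    show "norm (f s * (H b - H s)) \<le> C * (b - a) * \<bar>f s\<bar>" if "s \<in> {a..b}" for s
      using mult_right_mono[OF Hb[OF that], of "\<bar>f s\<bar>"] by (simp add: abs_mult mult.commute)
  qed
  also have "\<dots> = C * (b - a) * I"
    by (simp add: I_def)
  finally have "\<bar>X\<bar> \<le> C * (b - a) * I" by simp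
  moreover have "norm Y \<le> I * C * (b - a)"
    unfolding Y_def
  proof (rule integral_bound)
    show "norm ((F a - F s) * h s) \<le> I * C" if "s \<in> {a..b}" for s
      using Fa[OF that] C[of s] that ab unfolding I_def by (auto simp: abs_mult intro!: mult_mono)
  qed (use ab in \<open>auto intro!: continuous_intros cF\<close>)
  then have "\<bar>Y\<bar> \<le> C * (b - a) * I" by (simp add: mult_ac)
  moreover have "2 * C * (b - a) * I = C * (b - a) * I + C * (b - a) * I" by simp
  ultimately show ?thesis
    unfolding XY I_def[symmetric] using abs_triangle_ineq[of X Y] by linarith
qed

text \<open>\<open>f\<close> is merely integrable, so \<open>F\<close> cannot be differentiated
  pointwise. The defect \<open>E\<close>, however, has derivative 0 at every point, because its
  increments are bounded by |y - x| times the increment of a continuous function; hence it is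
  constant.\<close>

lemma primitive_mult:
  fixes f h :: "real \<Rightarrow> real"
  assumes P: "primitive L f F" and H: "primitive L h H" and ch: "continuous_on {0..L} h"
  shows "primitive L (\<lambda>s. f s * H s + F s * h s) (\<lambda>s. F s * H s)"
proof -
  define k where "k s = f s * H s + F s * h s" for s
  have f: "f absolutely_integrable_on {0..L}" "(\<lambda>s. \<bar>f s\<bar>) integrable_on {0..L}"
    using P absolutely_integrable_norm[where f = f and S = "{0..L}"] set_lebesgue_integral_eq_integral(1)
    by (fastforce simp: primitive_def o_def)+
  have k: "k absolutely_integrable_on {0..L}"
    unfolding k_def
  proof (rule set_integral_add(1))
    show "(\<lambda>s. f s * H s) absolutely_integrable_on {0..L}"
      using f primitive_continuous[OF H] by (intro absolutely_integrable_mult_continuous)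
    show "(\<lambda>s. F s * h s) absolutely_integrable_on {0..L}"
      using primitive_continuous[OF P] ch by (intro absolutely_integrable_continuous_real continuous_intros)
  qed
  then have ki: "k integrable_on {0..L}"
    using set_lebesgue_integral_eq_integral(1) by blast
  obtain C where C: "\<And>z. z \<in> {0..L} \<Longrightarrow> \<bar>h z\<bar> \<le> C"
    using compact_imp_bounded[OF compact_continuous_image[OF ch compact_Icc]]
    unfolding bounded_iff real_norm_def by blast
  define E where "E z = F z * H z - integral {0..z} k" for z
  define \<Phi> where "\<Phi> z = integral {0..z} (\<lambda>s. \<bar>f s\<bar>)" for z
  have c\<Phi>: "continuous_on {0..L} \<Phi>"
    unfolding \<Phi>_def by (intro indefinite_integral_continuous_1 f)
  have le: "\<bar>E b - E a\<bar> \<le> 2 * C * \<bar>b - a\<bar> * \<bar>\<Phi> b - \<Phi> a\<bar>" if "0 \<le> a" "a \<le> b" "b \<le> L" for a b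
  proof -
    have "integral {0..b} k = integral {0..a} k + integral {a..b} k"
      using that ki by (intro Henstock_Kurzweil_Integration.integral_combine[symmetric])
        (auto intro: integrable_subinterval_real)
    then have e: "E b - E a = F b * H b - F a * H a - integral {a..b} k"
      by (simp add: E_def)
    have "\<Phi> b = \<Phi> a + integral {a..b} (\<lambda>s. \<bar>f s\<bar>)"
      unfolding \<Phi>_def using that f by (intro Henstock_Kurzweil_Integration.integral_combine[symmetric])
        (auto intro: integrable_subinterval_real)
    moreover have "\<bar>E b - E a\<bar> \<le> 2 * C * (b - a) * integral {a..b} (\<lambda>s. \<bar>f s\<bar>)"
      using product_increment_bound[OF P H ch C that] unfolding e k_def by simp
    moreover have "0 \<le> integral {a..b} (\<lambda>s. \<bar>f s\<bar>)"
      using that f by (intro Henstock_Kurzweil_Integration.integral_nonneg) (auto intro: integrable_subinterval_real)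
    ultimately show ?thesis using that by simp
  qed
  have le': "\<bar>E y - E x\<bar> \<le> 2 * C * \<bar>y - x\<bar> * \<bar>\<Phi> y - \<Phi> x\<bar>" if "x \<in> {0..L}" "y \<in> {0..L}" for x y
    using le[of x y] le[of y x] that by (cases "x \<le> y") (auto simp: abs_minus_commute)
  have "(E has_real_derivative 0) (at x within {0..L})" if x: "x \<in> {0..L}" for x
    unfolding has_field_derivative_iff
  proof (rule Lim_null_comparison)
    have "(\<Phi> \<longlongrightarrow> \<Phi> x) (at x within {0..L})"
      using c\<Phi> x by (auto simp: continuous_on_def)
    then have "((\<lambda>y. 2 * C * \<bar>\<Phi> y - \<Phi> x\<bar>) \<longlongrightarrow> 2 * C * \<bar>\<Phi> x - \<Phi> x\<bar>) (at x within {0..L})"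
      by (intro tendsto_intros)
    then show "((\<lambda>y. 2 * C * \<bar>\<Phi> y - \<Phi> x\<bar>) \<longlongrightarrow> 0) (at x within {0..L})" by simp
    show "\<forall>\<^sub>F y in at x within {0..L}. norm ((E y - E x) / (y - x)) \<le> 2 * C * \<bar>\<Phi> y - \<Phi> x\<bar>"
      unfolding eventually_at_filter
    proof (intro always_eventually allI impI)
      fix y assume "y \<noteq> x" "y \<in> {0..L}"
      then show "norm ((E y - E x) / (y - x)) \<le> 2 * C * \<bar>\<Phi> y - \<Phi> x\<bar>"
        using le'[OF x, of y] by (simp add: divide_le_eq mult_ac)
    qed
  qed
  then obtain c where c: "\<And>x. x \<in> {0..L} \<Longrightarrow> E x = c"
    using has_field_derivative_zero_constant[of "{0..L}" E] by auto
  have "(k has_integral F z * H z - F 0 * H 0) {0..z}" if "z \<in> {0..L}" for z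
  proof -
    have "k integrable_on {0..z}" using ki that by (auto intro: integrable_subinterval_real)
    moreover have "integral {0..z} k = F z * H z - F 0 * H 0"
      using c[OF that] c[of 0] that by (simp add: E_def)
    ultimately show ?thesis by (metis integrable_integral)
  qed
  then show ?thesis
    using k unfolding primitive_def k_def[abs_def] by blast
qed

lemma primitive_add:
  assumes "primitive L f F" "primitive L g G"
  shows "primitive L (\<lambda>z. f z + g z) (\<lambda>z. F z + G z)"
  unfolding primitive_def
proof (intro conjI ballI)
  show "(\<lambda>z. f z + g z) absolutely_integrable_on {0..L}"
    using assms by (auto simp: primitive_def)
  fix z assume "z \<in> {0..L}"
  then have "((\<lambda>z. f z + g z) has_integral (F z - F 0) + (G z - G 0)) {0..z}"
    using assms by (intro has_integral_add) (auto simp: primitive_def)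
  then show "((\<lambda>z. f z + g z) has_integral F z + G z - (F 0 + G 0)) {0..z}"
    by (simp add: algebra_simps)
qed

lemma primitive_scale:
  assumes "primitive L f F"
  shows "primitive L (\<lambda>z. c * f z) (\<lambda>z. c * F z)"
  unfolding primitive_def
proof (intro conjI ballI)
  show "(\<lambda>z. c * f z) absolutely_integrable_on {0..L}"
    using assms by (auto simp: primitive_def)
  fix z assume "z \<in> {0..L}"
  then have "((\<lambda>z. c * f z) has_integral c * (F z - F 0)) {0..z}"
    using assms by (intro has_integral_mult_right) (auto simp: primitive_def)
  then show "((\<lambda>z. c * f z) has_integral c * F z - c * F 0) {0..z}"
    by (simp add: right_diff_distrib)
qed

lemma integral_by_parts_primitive:
  assumes "primitive L f F" "primitive L h H" "continuous_on {0..L} h" "0 \<le> L"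
  shows "integral {0..L} (\<lambda>z. f z * H z) = F L * H L - F 0 * H 0 - integral {0..L} (\<lambda>z. F z * h z)"
proof -
  have "(\<lambda>z. f z * H z) absolutely_integrable_on {0..L}"
    using assms primitive_continuous[OF assms(2)] by (intro absolutely_integrable_mult_continuous) (auto simp: primitive_def)
  then have "(\<lambda>z. f z * H z) integrable_on {0..L}"
    using set_lebesgue_integral_eq_integral(1) by blast
  moreover have "(\<lambda>z. F z * h z) integrable_on {0..L}"
    using assms primitive_continuous[OF assms(1)] by (intro integrable_continuous_real continuous_intros)
  moreover have "integral {0..L} (\<lambda>z. f z * H z + F z * h z) = F L * H L - F 0 * H 0"
    using primitive_integral[OF primitive_mult[OF assms(1-3)], of L] assms(4) by simp
  ultimately show ?thesis by (simp add: integral_add)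
qed

lemma primitive_cong_AE:
  assumes "primitive L f F" "AE z in lborel. z \<in> {0..L} \<longrightarrow> f z = g z" "g absolutely_integrable_on {0..L}"
  shows "primitive L g F"
proof -
  obtain N where N: "N \<in> null_sets lborel" "\<And>z. z \<in> space lborel - N \<Longrightarrow> z \<in> {0..L} \<longrightarrow> f z = g z"
    using AE_E3[OF assms(2)] by blast
  have "negligible N"
    using N(1) by (simp add: negligible_iff_null_sets null_sets_completionI)
  have "(g has_integral F z - F 0) {0..z}" if "z \<in> {0..L}" for z
    by (rule has_integral_spike[OF \<open>negligible N\<close>, of _ g f]) (use N(2) assms(1) that in \<open>auto simp: primitive_def\<close>)
  then show ?thesis using assms(3) by (simp add: primitive_def)
qed

text \<open>The positive and the negative part of \<open>g\<close> are densities of finite measures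
  that agree on every half-line, so the measures coincide and with them the densities almost
  everywhere.\<close>

lemma AE_zero_if_primitive_zero:
  assumes g: "sqi L g" and "0 \<le> L" and z: "\<And>z. z \<in> {0..L} \<Longrightarrow> integral {0..z} g = 0"
  shows "AE z in lborel. z \<in> {0..L} \<longrightarrow> g z = 0"
proof -
  define v where "v = zext L g"
  have v: "integrable lborel v"
    using sqi_absolutely_integrable[OF g] by (simp add: v_def)
  then have vm [measurable]: "v \<in> borel_measurable borel" by auto
  define p n where "p z = max 0 (v z)" and "n z = max 0 (- v z)" for z
  have pn: "integrable lborel p" "integrable lborel n"
    unfolding p_def n_def using v by (auto intro: integrable_max)
  have gi: "g integrable_on {0..L}"
    using sqi_absolutely_integrable(2)[OF g] set_lebesgue_integral_eq_integral(1) by blast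
  have ind: "integrable lborel (\<lambda>z. indicator {x<..} z * q z)" if "integrable lborel q" for q :: "real \<Rightarrow> real" and x
    using integrable_real_mult_indicator[of "{x<..}" lborel q] that by (simp add: mult.commute)
  have i0: "(\<integral>z. indicator {x<..} z * v z \<partial>lborel) = 0" for x
  proof -
    have "integrable lborel (\<lambda>z. indicator {x<..} z * v z)"
      by (rule ind[OF v])
    moreover have "zext L (\<lambda>z. indicator {x<..} z * g z) = (\<lambda>z. indicator {x<..} z * v z)"
      by (auto simp: v_def zext_def)
    ultimately have "(\<integral>z. indicator {x<..} z * v z \<partial>lborel) = integral {0..L} (\<lambda>z. indicator {x<..} z * g z)"
      using integral_zext(2)[of L "\<lambda>z. indicator {x<..} z * g z"] by simp
    also have "\<dots> = 0"
    proof (cases "x < 0")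
      case True
      have "integral {0..L} (\<lambda>z. indicator {x<..} z * g z) = integral {0..L} g"
        using True by (intro integral_cong) auto
      then show ?thesis using z assms(2) by simp
    next
      case False
      define y where "y = min x L"
      have y: "0 \<le> y" "y \<le> L" using False assms(2) by (auto simp: y_def)
      have "((\<lambda>z. indicator {x<..} z * g z) has_integral 0) {0..y}"
        by (rule has_integral_eq[of _ "\<lambda>_. 0"]) (auto simp: y_def)
      moreover have "integral {y..L} g = 0"
        using Henstock_Kurzweil_Integration.integral_combine[OF y gi] z[of y] z[of L] y assms(2) by simp
      then have "(g has_integral 0) {y..L}"
        using integrable_subinterval_real[OF gi, of y L] y by (metis atLeastatMost_subset_iff integrable_integral order_refl)
      \<comment> \<open>For x \<ge> L the interval degenerates to the point L, which is why L joins
        x in the exceptional set.\<close>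
      then have "((\<lambda>z. indicator {x<..} z * g z) has_integral 0) {y..L}"
        by (rule has_integral_spike[of "{x, L}", rotated 2]) (auto simp: y_def min_def split: if_splits)
      ultimately have "((\<lambda>z. indicator {x<..} z * g z) has_integral 0 + 0) {0..L}"
        by (intro has_integral_combine[OF y])
      then show ?thesis by (simp add: integral_unique)
    qed
    finally show ?thesis .
  qed
  have em: "emeasure (density lborel (\<lambda>z. ennreal (q z))) {x<..} = ennreal (\<integral>z. indicator {x<..} z * q z \<partial>lborel)"
    if "integrable lborel q" "\<And>z. 0 \<le> q z" for q :: "real \<Rightarrow> real" and x
  proof -
    have "integrable lborel (\<lambda>z. indicator {x<..} z * q z)"
      by (rule ind[OF that(1)])
    then have "(\<integral>\<^sup>+z. ennreal (indicator {x<..} z * q z) \<partial>lborel) = ennreal (\<integral>z. indicator {x<..} z * q z \<partial>lborel)"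
      using that by (intro nn_integral_eq_integral) auto
    moreover have "q \<in> borel_measurable borel" using that by auto
    ultimately show ?thesis
      by (subst emeasure_density) (auto simp: ennreal_mult mult.commute ennreal_indicator that(2))
  qed
  have "density lborel (\<lambda>z. ennreal (p z)) = density lborel (\<lambda>z. ennreal (n z))"
  proof (rule measure_eqI_lessThan)
    fix x
    have i: "integrable lborel (\<lambda>z. indicator {x<..} z * p z)" "integrable lborel (\<lambda>z. indicator {x<..} z * n z)"
      by (rule ind, rule pn)+
    have "(\<integral>z. indicator {x<..} z * p z \<partial>lborel) - (\<integral>z. indicator {x<..} z * n z \<partial>lborel)
        = (\<integral>z. indicator {x<..} z * p z - indicator {x<..} z * n z \<partial>lborel)"
      using i by simp
    also have "\<dots> = (\<integral>z. indicator {x<..} z * v z \<partial>lborel)"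
      by (intro Bochner_Integration.integral_cong) (auto simp: p_def n_def max_def indicator_def)
    finally show "emeasure (density lborel (\<lambda>z. ennreal (p z))) {x<..} = emeasure (density lborel (\<lambda>z. ennreal (n z))) {x<..}"
      using em[OF pn(1)] em[OF pn(2)] i0 by (simp add: p_def n_def)
    show "emeasure (density lborel (\<lambda>z. ennreal (p z))) {x<..} < \<infinity>"
      using em[OF pn(1)] by (simp add: p_def)
  qed auto
  moreover have "integral\<^sup>N lborel (\<lambda>z. ennreal (p z)) \<noteq> \<infinity>"
    using pn(1) by (auto simp: integrable_iff_bounded p_def)
  ultimately have "AE z in lborel. ennreal (p z) = ennreal (n z)"
    by (subst (asm) finite_density_unique) (auto simp: p_def n_def)
  then show ?thesis
  proof eventually_elim
    case (elim z)
    then have "v z = 0" by (auto simp: p_def n_def max_def split: if_splits)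
    then show ?case by (auto simp: v_def zext_def)
  qed
qed

section \<open>Weak derivatives\<close>

lemma continuous_cl_eq_imp_eq:
  assumes "0 < L" "continuous_on {0..L} u" "continuous_on {0..L} v" "cl L u = cl L v" "z \<in> {0..L}"
  shows "u z = v z"
proof -
  have s: "sqi L (\<lambda>z. u z - v z)"
    using assms by (intro sqi_continuous continuous_intros)
  have "cl L (\<lambda>z. u z - v z) = 0"
    using assms by (simp add: cl_diff sqi_continuous)
  then have "integral {0..L} (\<lambda>z. (u z - v z)\<^sup>2) = 0"
    using inner_cl[OF s s] by (simp add: power2_eq_square)
  then have "\<forall>z\<in>{0..L}. (u z - v z)\<^sup>2 = 0"
    using assms by (subst (asm) integral_eq_0_iff) (auto intro!: continuous_intros)
  then show ?thesis using assms(5) by simp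
qed

section \<open>Test functions\<close>

lemma C1_differentiable_on_UNIV_iff:
  fixes \<phi> :: "real \<Rightarrow> real"
  shows "\<phi> C1_differentiable_on UNIV \<longleftrightarrow>
    (\<forall>z. (\<phi> has_real_derivative deriv \<phi> z) (at z)) \<and> continuous_on UNIV (deriv \<phi>)"
proof
  assume "\<phi> C1_differentiable_on UNIV"
  then obtain D where D: "\<And>z. (\<phi> has_real_derivative D z) (at z)" "continuous_on UNIV D"
    by (auto simp: C1_differentiable_on_def has_real_derivative_iff_has_vector_derivative)
  moreover from D(1) have "deriv \<phi> = D"
    by (auto intro: DERIV_imp_deriv)
  ultimately show "(\<forall>z. (\<phi> has_real_derivative deriv \<phi> z) (at z)) \<and> continuous_on UNIV (deriv \<phi>)"
    by auto
qed (auto simp: C1_differentiable_on_def has_real_derivative_iff_has_vector_derivative)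

lemma test_funI:
  assumes D: "\<And>z. (\<phi> has_real_derivative D z) (at z)" "continuous_on UNIV D"
    and ab: "0 < a" "b < L" "\<And>z. z \<notin> {a..b} \<Longrightarrow> \<phi> z = 0"
  shows "test_fun L \<phi>" and "deriv \<phi> = D"
proof -
  show "deriv \<phi> = D"
    using D(1) by (auto intro: DERIV_imp_deriv)
  have "{z. \<phi> z \<noteq> 0} \<subseteq> {a..b}"
    using ab(3) by blast
  then have "closure {z. \<phi> z \<noteq> 0} \<subseteq> {a..b}"
    by (intro closure_minimal) auto
  moreover from this have "compact (closure {z. \<phi> z \<noteq> 0})"
    by (meson bounded_closed_interval bounded_subset closed_closure compact_eq_bounded_closed)
  ultimately show "test_fun L \<phi>"
    using ab D \<open>deriv \<phi> = D\<close> unfolding test_fun_def by (auto simp: C1_differentiable_on_UNIV_iff)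
qed

lemma test_funD:
  assumes "test_fun L \<phi>"
  shows "(\<phi> has_real_derivative deriv \<phi> z) (at z)" "continuous_on S (deriv \<phi>)" "continuous_on S \<phi>"
proof -
  have D: "\<And>z. (\<phi> has_real_derivative deriv \<phi> z) (at z)" "continuous_on UNIV (deriv \<phi>)"
    using assms by (auto simp: test_fun_def C1_differentiable_on_UNIV_iff)
  show "(\<phi> has_real_derivative deriv \<phi> z) (at z)" by (rule D)
  show "continuous_on S (deriv \<phi>)" using D(2) by (rule continuous_on_subset) simp
  show "continuous_on S \<phi>"
    by (rule DERIV_continuous_on[OF has_field_derivative_at_within[OF D(1)]])
qed

lemma test_fun_support:
  assumes "test_fun L \<phi>" "0 < L"
  shows "\<exists>a b. 0 < a \<and> a \<le> b \<and> b < L \<and> (\<forall>z. z \<notin> {a..b} \<longrightarrow> \<phi> z = 0)"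
proof -
  define K where "K = closure {z. \<phi> z \<noteq> 0}"
  have K: "compact K" "K \<subseteq> {0<..<L}"
    using assms by (auto simp: test_fun_def K_def)
  have K0: "\<phi> z = 0" if "z \<notin> K" for z
    using that closure_subset[of "{z. \<phi> z \<noteq> 0}"] by (auto simp: K_def)
  show ?thesis
  proof (cases "K = {}")
    case True
    then show ?thesis using assms(2) K0 by (intro exI[of _ "L/2"]) auto
  next
    case False
    obtain a where a: "a \<in> K" "\<And>z. z \<in> K \<Longrightarrow> a \<le> z"
      using compact_attains_inf[OF K(1) False] by blast
    obtain b where b: "b \<in> K" "\<And>z. z \<in> K \<Longrightarrow> z \<le> b"
      using compact_attains_sup[OF K(1) False] by blast
    have "\<forall>z. z \<notin> {a..b} \<longrightarrow> \<phi> z = 0" using a(2) b(2) K0 by auto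
    then show ?thesis
      using a b K(2) by (intro exI[of _ a] exI[of _ b]) auto
  qed
qed

text \<open>Squaring smooths the kink of the positive part just enough for C1, the regularity
  demanded of test functions. In all sign cases the remainder is at most (y - x)^2.\<close>

lemma DERIV_max_0_power2: "((\<lambda>x::real. (max 0 x)\<^sup>2) has_real_derivative 2 * max 0 x) (at x)"
  unfolding has_field_derivative_iff
proof (rule LIM_zero_cancel, rule Lim_null_comparison)
  have "\<bar>(max 0 y)\<^sup>2 - (max 0 x)\<^sup>2 - 2 * max 0 x * (y - x)\<bar> \<le> \<bar>y - x\<bar> * \<bar>y - x\<bar>" for y
  proof -
    consider "0 \<le> x \<and> 0 \<le> y" | "x \<le> 0 \<and> y \<le> 0" | "x < 0 \<and> 0 < y" | "0 < x \<and> y < 0" by linarith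
    then show ?thesis
    proof cases
      case 1
      then have "(max 0 y)\<^sup>2 - (max 0 x)\<^sup>2 - 2 * max 0 x * (y - x) = (y - x) * (y - x)"
        by (simp add: power2_eq_square algebra_simps)
      then show ?thesis by (simp add: abs_mult)
    next
      case 2
      then have "max 0 x = 0" "max 0 y = 0" by auto
      then show ?thesis by simp
    next
      case 3
      then have "y\<^sup>2 \<le> (y - x)\<^sup>2" by (intro power_mono) auto
      then show ?thesis using 3 by (simp add: power2_eq_square abs_mult[symmetric])
    next
      case 4
      have "x\<^sup>2 - 2 * x * y \<le> (y - x)\<^sup>2" "0 \<le> x\<^sup>2 - 2 * x * y"
        using 4 by (auto simp: power2_eq_square algebra_simps mult_nonneg_nonpos)
      then show ?thesis using 4 by (simp add: power2_eq_square abs_mult[symmetric] algebra_simps)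
    qed
  qed
  note * = this
  show "\<forall>\<^sub>F y in at x. norm (((max 0 y)\<^sup>2 - (max 0 x)\<^sup>2) / (y - x) - 2 * max 0 x) \<le> \<bar>y - x\<bar>"
    unfolding eventually_at_filter
  proof (intro always_eventually allI impI)
    fix y assume "y \<noteq> x"
    then have "((max 0 y)\<^sup>2 - (max 0 x)\<^sup>2) / (y - x) - 2 * max 0 x
        = ((max 0 y)\<^sup>2 - (max 0 x)\<^sup>2 - 2 * max 0 x * (y - x)) / (y - x)"
      by (simp add: diff_divide_distrib)
    then show "norm (((max 0 y)\<^sup>2 - (max 0 x)\<^sup>2) / (y - x) - 2 * max 0 x) \<le> \<bar>y - x\<bar>"
      using *[of y] \<open>y \<noteq> x\<close> by (simp add: divide_le_eq)
  qed
  have "((\<lambda>y. \<bar>y - x\<bar>) \<longlongrightarrow> \<bar>x - x\<bar>) (at x)" by (intro tendsto_intros)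
  then show "((\<lambda>y. \<bar>y - x\<bar>) \<longlongrightarrow> 0) (at x)" by simp
qed

text \<open>This is n b / (1 + n b) with b = ((z - a)^+ (b - z)^+)^2 in the denominator and
  numerator alike, that is, a C1 function with values in [0, 1] that vanishes outside (a, b) and
  tends pointwise to the indicator of (a, b) as \<open>n\<close> grows.\<close>

definition bump :: "real \<Rightarrow> real \<Rightarrow> nat \<Rightarrow> real \<Rightarrow> real" where
  "bump a b n z = 1 - 1 / (1 + real n * ((max 0 (z - a))\<^sup>2 * (max 0 (b - z))\<^sup>2))"

lemma bump_properties:
  assumes "0 < a" "a < b" "b < L"
  shows bump_test_fun: "test_fun L (bump a b n)"
    and bump_outside: "z \<notin> {a<..<b} \<Longrightarrow> bump a b n z = 0"
    and bump_bounds: "0 \<le> bump a b n z" "bump a b n z \<le> 1"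
    and bump_inside: "z \<in> {a<..<b} \<Longrightarrow> (\<lambda>n. bump a b n z) \<longlonglongrightarrow> 1"
    and bump_pos: "z \<in> {a<..<b} \<Longrightarrow> 0 < n \<Longrightarrow> 0 < bump a b n z"
proof -
  define \<beta> where "\<beta> z = (max 0 (z - a))\<^sup>2 * (max 0 (b - z))\<^sup>2" for z
  define \<beta>' where "\<beta>' z = 2 * max 0 (z - a) * (max 0 (b - z))\<^sup>2 + - (2 * max 0 (b - z)) * (max 0 (z - a))\<^sup>2" for z
  have \<beta>0: "0 \<le> \<beta> z" for z by (simp add: \<beta>_def)
  have \<beta>1: "0 < 1 + real n * \<beta> z" for n z using \<beta>0[of z] by (simp add: add_pos_nonneg)
  have bump: "bump a b n z = 1 - 1 / (1 + real n * \<beta> z)" for n z by (simp add: bump_def \<beta>_def)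
  have D1: "((\<lambda>z. (max 0 (z - a))\<^sup>2) has_real_derivative 2 * max 0 (z - a)) (at z)" for z
  proof -
    have "((\<lambda>z. z - a) has_real_derivative 1) (at z)" by (auto intro!: derivative_eq_intros)
    from DERIV_chain2[OF DERIV_max_0_power2 this] show ?thesis by simp
  qed
  have D2: "((\<lambda>z. (max 0 (b - z))\<^sup>2) has_real_derivative - (2 * max 0 (b - z))) (at z)" for z
  proof -
    have "((\<lambda>z. b - z) has_real_derivative -1) (at z)" by (auto intro!: derivative_eq_intros)
    from DERIV_chain2[OF DERIV_max_0_power2 this] show ?thesis by simp
  qed
  have D: "(\<beta> has_real_derivative \<beta>' z) (at z)" for z
    unfolding \<beta>_def[abs_def] \<beta>'_def by (rule DERIV_mult[OF D1 D2])
  show out: "bump a b n z = 0" if "z \<notin> {a<..<b}" for z n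
    using that by (auto simp: bump \<beta>_def)
  show "test_fun L (bump a b n)"
  proof (rule test_funI(1)[of _ "\<lambda>z. real n * \<beta>' z / (1 + real n * \<beta> z)\<^sup>2" a b])
    show "(bump a b n has_real_derivative real n * \<beta>' z / (1 + real n * \<beta> z)\<^sup>2) (at z)" for z
      unfolding bump[abs_def] using \<beta>1[of n z]
      by (auto intro!: derivative_eq_intros D simp: power2_eq_square)
    have "continuous_on UNIV \<beta>'" unfolding \<beta>'_def[abs_def] by (intro continuous_intros)
    moreover have "continuous_on UNIV \<beta>" unfolding \<beta>_def[abs_def] by (intro continuous_intros)
    moreover have "1 + real n * \<beta> z \<noteq> 0" for z using \<beta>1[of n z] by simp
    ultimately show "continuous_on UNIV (\<lambda>z. real n * \<beta>' z / (1 + real n * \<beta> z)\<^sup>2)"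
      by (intro continuous_intros) auto
  qed (use assms out in auto)
  show "0 \<le> bump a b n z" "bump a b n z \<le> 1"
    using \<beta>0[of z] \<beta>1[of n z] by (auto simp: bump divide_le_eq)
  have pos: "0 < \<beta> z" if "z \<in> {a<..<b}" using that by (simp add: \<beta>_def)
  show "0 < bump a b n z" if "z \<in> {a<..<b}" "0 < n"
    using pos[OF that(1)] that(2) \<beta>1[of n z] by (simp add: bump divide_less_eq)
  show "(\<lambda>n. bump a b n z) \<longlonglongrightarrow> 1" if "z \<in> {a<..<b}"
  proof -
    have "filterlim (\<lambda>n. 1 + real n * \<beta> z) at_top sequentially"
      using pos[OF that] filterlim_real_sequentially
      by (intro filterlim_tendsto_add_at_top[OF tendsto_const] filterlim_at_top_mult_tendsto_pos[OF tendsto_const])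
    then have "(\<lambda>n. 1 / (1 + real n * \<beta> z)) \<longlonglongrightarrow> 0"
      by (intro tendsto_divide_0[OF tendsto_const]) (rule filterlim_at_top_imp_at_infinity)
    from tendsto_diff[OF tendsto_const this, of 1] show ?thesis by (simp add: bump)
  qed
qed

section \<open>Fundamental lemma and du Bois-Reymond lemma\<close>

text \<open>Testing against \<open>bump\<close> and dominated convergence make the integral of
  \<open>v\<close> vanish over every compactly contained interval. The primitive is then constant on
  the open interval, by continuity on the closed one, and its value at 0 is 0.\<close>

lemma fundamental_lemma:
  assumes v: "sqi L v" and L: "0 < L"
    and 0: "\<And>\<phi>. test_fun L \<phi> \<Longrightarrow> integral {0..L} (\<lambda>z. v z * \<phi> z) = 0"
  shows "AE z in lborel. z \<in> {0..L} \<longrightarrow> v z = 0"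
proof (rule AE_zero_if_primitive_zero[OF v])
  have va: "v absolutely_integrable_on {0..L}" using sqi_absolutely_integrable[OF v] by simp
  then have vi: "v integrable_on {0..L}" "(\<lambda>z. \<bar>v z\<bar>) integrable_on {0..L}"
    using absolutely_integrable_norm[OF va] set_lebesgue_integral_eq_integral(1)[of "{0..L}"] by (force simp: o_def)+
  have ab: "integral {a..b} v = 0" if "0 < a" "a < b" "b < L" for a b
  proof -
    note bp = bump_properties[OF that]
    define g where "g z = (if z \<in> {a<..<b} then v z else 0)" for z
    have "(\<lambda>n. integral {0..L} (\<lambda>z. v z * bump a b n z)) \<longlonglongrightarrow> integral {0..L} g"
    proof (rule dominated_convergence(2))
      show "(\<lambda>z. v z * bump a b n z) integrable_on {0..L}" for n
      proof -
        show ?thesis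
          using absolutely_integrable_mult_continuous[OF va test_funD(3)[OF bp(1)]]
          by (rule set_lebesgue_integral_eq_integral(1))
      qed
      show "norm (v z * bump a b n z) \<le> \<bar>v z\<bar>" for n z
        using bp(3,4)[of n z] by (simp add: abs_mult mult_left_le)
      show "(\<lambda>n. v z * bump a b n z) \<longlonglongrightarrow> g z" for z
        using tendsto_mult_left[OF bp(5), of z "v z"] bp(2)[of z] by (cases "z \<in> {a<..<b}") (auto simp: g_def)
    qed (use vi in auto)
    then have "integral {0..L} g = 0"
      unfolding 0[OF bp(1)] LIMSEQ_const_iff by simp
    moreover have "integral {0..L} g = integral {a<..<b} v"
    proof -
      have "{a<..<b} \<inter> {0..L} = {a<..<b}" using that by auto
      then show ?thesis
        unfolding g_def using integral_restrict_Int[of "{0..L}" "{a<..<b}" v] by simp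
    qed
    ultimately show ?thesis by (simp add: integral_open_interval_real)
  qed
  define \<Phi> where "\<Phi> z = integral {0..z} v" for z
  have c\<Phi>: "continuous_on {0..L} \<Phi>"
    unfolding \<Phi>_def by (intro indefinite_integral_continuous_1 vi)
  have eq: "\<Phi> a = \<Phi> b" if "0 < a" "a < b" "b < L" for a b
  proof -
    have "v integrable_on {0..b}" using that by (intro integrable_subinterval_real[OF vi(1)]) auto
    then show ?thesis
      using Henstock_Kurzweil_Integration.integral_combine[of 0 a b v] ab[OF that] that by (simp add: \<Phi>_def)
  qed
  have eq': "\<Phi> z = \<Phi> (L/2)" if "z \<in> {0<..<L}" for z
  proof (cases z "L/2" rule: linorder_cases)
    case less
    then show ?thesis by (rule eq[rotated]) (use that L in auto)
  next
    case greater
    then show ?thesis by (rule eq[symmetric, rotated]) (use that L in auto)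
  next
    case equal
    then show ?thesis by (rule arg_cong)
  qed
  have const: "\<Phi> z = \<Phi> (L/2)" if "z \<in> {0..L}" for z
    by (rule continuous_constant_on_closure[where S = "{0<..<L}", OF _ eq']) (use L c\<Phi> that in auto)
  show "integral {0..z} v = 0" if "z \<in> {0..L}" for z
  proof -
    have "\<Phi> 0 = \<Phi> (L/2)" by (rule const) (use L in auto)
    with const[OF that] have "\<Phi> z = \<Phi> 0" by (rule trans[OF _ sym])
    then show ?thesis by (simp add: \<Phi>_def)
  qed
qed (use L in auto)

text \<open>A test function with mean 0 is the derivative of another one. Subtracting a multiple of
  one fixed \<open>\<psi>0\<close> gives any test function mean 0, so \<open>w\<close> acts on test
  functions as a constant does.\<close>

lemma du_Bois_Reymond:
  assumes w: "sqi L w" and L: "0 < L"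
    and 0: "\<And>\<phi>. test_fun L \<phi> \<Longrightarrow> integral {0..L} (\<lambda>z. w z * deriv \<phi> z) = 0"
  obtains c where "AE z in lborel. z \<in> {0..L} \<longrightarrow> w z = c"
proof -
  define \<psi>0 where "\<psi>0 = bump (L/3) (2*L/3) 1"
  note bp = bump_properties[of "L/3" "2*L/3" L]
  have t0: "test_fun L \<psi>0" using bp L by (simp add: \<psi>0_def)
  then have c0: "continuous_on S \<psi>0" for S
    by (rule test_funD(3))
  define I where "I = integral {0..L} \<psi>0"
  have "I \<noteq> 0"
  proof
    assume "I = 0"
    then have "\<forall>z\<in>{0..L}. \<psi>0 z = 0"
      unfolding I_def using c0 L bp by (subst (asm) integral_eq_0_iff) (auto simp: \<psi>0_def)
    moreover have "0 < \<psi>0 (L/2)" using L bp unfolding \<psi>0_def by (intro bp) auto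
    ultimately show False using L by auto
  qed
  have wi: "(\<lambda>z. w z * \<psi> z) integrable_on {0..L}" if "continuous_on {0..L} \<psi>" for \<psi>
    using absolutely_integrable_mult_continuous[OF sqi_absolutely_integrable(2)[OF w] that]
    by (rule set_lebesgue_integral_eq_integral(1))
  \<comment> \<open>The only possible value: testing \<open>w = c\<close> against
    \<open>\<psi>0\<close> determines it.\<close>
  define c where "c = integral {0..L} (\<lambda>z. w z * \<psi>0 z) / I"
  have "integral {0..L} (\<lambda>z. (w z - c) * \<psi> z) = 0" if \<psi>: "test_fun L \<psi>" for \<psi>
  proof -
    obtain a1 b1 where 1: "0 < a1" "b1 < L" and 10: "\<forall>z. z \<notin> {a1..b1} \<longrightarrow> \<psi> z = 0"
      using test_fun_support[OF \<psi> L] by blast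
    \<comment> \<open>One interval inside (0, L) that contains both supports, so that the primitive
      of \<open>\<theta>\<close> is supported in it as well.\<close>
    define a b where "a = min a1 (L/3)" and "b = max b1 (2*L/3)"
    have ab: "0 < a" "b < L" "a \<le> b" using 1 L by (auto simp: a_def b_def)
    define k where "k = integral {0..L} \<psi> / I"
    define \<theta> where "\<theta> z = \<psi> z - k * \<psi>0 z" for z
    have \<psi>c: "continuous_on S \<psi>" for S by (rule test_funD(3)[OF \<psi>])
    have \<theta>c: "continuous_on S \<theta>" for S
      unfolding \<theta>_def by (intro continuous_intros c0 \<psi>c)
    have \<theta>0: "\<theta> z = 0" if "z \<notin> {a..b}" for z
    proof -
      have "\<psi> z = 0" using that by (intro 10[rule_format]) (auto simp: a_def b_def)
      moreover have "\<psi>0 z = 0" using that L unfolding \<psi>0_def by (intro bp) (auto simp: a_def b_def)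
      ultimately show ?thesis by (simp add: \<theta>_def)
    qed
    have \<theta>i: "\<theta> integrable_on {x..y}" for x y by (intro integrable_continuous_real \<theta>c)
    have \<theta>I: "integral {0..L} \<theta> = 0"
      unfolding \<theta>_def using \<open>I \<noteq> 0\<close> c0 \<psi>c
      by (simp add: integral_diff integrable_continuous_real integrable_on_mult_right k_def I_def)
    define \<phi> where "\<phi> z = integral {0..z} \<theta>" for z
    \<comment> \<open>To the right of the support the primitive keeps its value, which is the mean
      of \<open>\<theta>\<close>, that is 0; this gives compact support.\<close>
    have tail: "\<phi> y = \<phi> b" if "b \<le> y" for y
    proof -
      have "integral {b..y} \<theta> = integral {b..y} (\<lambda>_. 0)"
        by (rule integral_spike[of "{b}"]) (auto intro: \<theta>0)
      then show ?thesis
        using Henstock_Kurzweil_Integration.integral_combine[of 0 b y \<theta>] that ab \<theta>i by (simp add: \<phi>_def)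
    qed
    have head: "\<phi> y = 0" if "y < a" for y
    proof -
      have "\<phi> y = integral {0..y} (\<lambda>_. 0)"
        unfolding \<phi>_def using that by (intro integral_cong \<theta>0) auto
      then show ?thesis by simp
    qed
    have D: "(\<phi> has_real_derivative \<theta> z) (at z)" for z
    proof (cases "z < a")
      case True
      have "((\<lambda>_. 0) has_real_derivative 0) (at z)" by simp
      then have "(\<phi> has_real_derivative 0) (at z)"
        by (rule has_field_derivative_transform_within_open[of _ _ _ "{..<a}"]) (use True head in auto)
      then show ?thesis using True \<theta>0[of z] by simp
    next
      case False
      then have z: "0 < z" using ab by simp
      have "(\<phi> has_real_derivative \<theta> z) (at z within {0..z+1})"
        unfolding \<phi>_def using z by (intro integral_has_real_derivative \<theta>c) auto
      then have "(\<phi> has_real_derivative \<theta> z) (at z within {0<..<z+1})"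
        by (rule DERIV_subset) auto
      then show ?thesis using z by (subst (asm) at_within_open) auto
    qed
    have "\<phi> z = 0" if "z \<notin> {a..b}" for z
      using that head[of z] tail[of z] tail[of L] ab \<theta>I by (cases "z < a") (auto simp: \<phi>_def)
    from 0[OF test_funI(1)[OF D \<theta>c ab(1,2) this]]
    have "integral {0..L} (\<lambda>z. w z * deriv \<phi> z) = 0" .
    also have "deriv \<phi> = \<theta>" using D by (auto intro: DERIV_imp_deriv)
    also have "(\<lambda>z. w z * \<theta> z) = (\<lambda>z. w z * \<psi> z - k * (w z * \<psi>0 z))"
      by (auto simp: \<theta>_def algebra_simps)
    finally have "integral {0..L} (\<lambda>z. w z * \<psi> z) = k * integral {0..L} (\<lambda>z. w z * \<psi>0 z)"
      using wi c0 \<psi>c by (simp add: integral_diff integrable_on_mult_right)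
    also have "\<dots> = c * integral {0..L} \<psi>"
      by (simp add: k_def c_def)
    finally show ?thesis
      using wi \<psi>c by (simp add: left_diff_distrib integral_diff integrable_on_mult_right integrable_continuous_real)
  qed
  moreover have "sqi L (\<lambda>z. w z - c)"
    by (rule sqi_diff[OF w sqi_continuous[OF continuous_on_const]])
  ultimately have "AE z in lborel. z \<in> {0..L} \<longrightarrow> w z - c = 0"
    using L by (intro fundamental_lemma)
  then show ?thesis using that[of c] by simp
qed

section \<open>Sobolev functions as primitives\<close>

lemma is_weak_deriv_cl:
  assumes "sqi L u" "sqi L g" "0 < L"
  shows "is_weak_deriv L (cl L u) (cl L g) \<longleftrightarrow>
    (\<forall>\<phi>. test_fun L \<phi> \<longrightarrow> integral {0..L} (\<lambda>z. u z * deriv \<phi> z) = - integral {0..L} (\<lambda>z. g z * \<phi> z))"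
proof -
  have *: "(\<integral>z. zext L w z * h z \<partial>lborel) = integral {0..L} (\<lambda>z. w z * h z)"
    if "sqi L w" "continuous_on UNIV h" for w h
  proof -
    have "sqi L h" using that(2) by (intro sqi_continuous) (rule continuous_on_subset, auto)
    then have "integrable lborel (zext L (\<lambda>z. w z * h z))" using that by (intro sqi_mult)
    moreover have "zext L (\<lambda>z. w z * h z) = (\<lambda>z. zext L w z * h z)" by (auto simp: zext_def)
    ultimately show ?thesis using integral_zext(2)[of L "\<lambda>z. w z * h z"] by simp
  qed
  have "(\<integral>z. zext L u z * deriv \<phi> z \<partial>lborel) = integral {0..L} (\<lambda>z. u z * deriv \<phi> z)"
    "(\<integral>z. zext L g z * \<phi> z \<partial>lborel) = integral {0..L} (\<lambda>z. g z * \<phi> z)" if "test_fun L \<phi>" for \<phi>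
    by (rule *[OF assms(1) test_funD(2)[OF that]], rule *[OF assms(2) test_funD(3)[OF that]])
  then show ?thesis
    using assms(1,2) by (simp add: cl_def is_weak_deriv.abs_eq sqi_def)
qed

lemma test_fun_primitive:
  assumes "test_fun L \<phi>" "0 < L"
  shows "primitive L (deriv \<phi>) \<phi>" "continuous_on {0..L} (deriv \<phi>)" "\<phi> 0 = 0" "\<phi> L = 0"
proof -
  obtain a b where \<phi>: "0 < a" "b < L" "\<forall>z. z \<notin> {a..b} \<longrightarrow> \<phi> z = 0"
    using test_fun_support[OF assms] by blast
  show c: "continuous_on {0..L} (deriv \<phi>)" by (rule test_funD(2)[OF assms(1)])
  show "primitive L (deriv \<phi>) \<phi>"
    by (rule primitive_C1[OF has_field_derivative_at_within[OF test_funD(1)[OF assms(1)]] c])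
  show "\<phi> 0 = 0" "\<phi> L = 0" using \<phi> by auto
qed

lemma primitive_weak_deriv:
  assumes "primitive L g u" "sqi L g" "0 < L"
  shows "is_weak_deriv L (cl L u) (cl L g)"
proof -
  have "integral {0..L} (\<lambda>z. u z * deriv \<phi> z) = - integral {0..L} (\<lambda>z. g z * \<phi> z)" if "test_fun L \<phi>" for \<phi>
    using integral_by_parts_primitive[OF assms(1) test_fun_primitive(1,2)[OF that assms(3)]]
      test_fun_primitive(3,4)[OF that assms(3)] assms(3) by simp
  then show ?thesis
    using is_weak_deriv_cl[OF sqi_continuous[OF primitive_continuous[OF assms(1)]] assms(2,3)] by blast
qed

text \<open>The primitive of \<open>g\<close> has the same weak derivative as \<open>w\<close>, so
  the difference is annihilated by all derivatives of test functions and is a constant.\<close>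

lemma weak_deriv_primitive:
  assumes w: "sqi L w" and g: "sqi L g" and L: "0 < L" and d: "is_weak_deriv L (cl L w) (cl L g)"
  obtains u where "primitive L g u" "cl L w = cl L u"
proof -
  define U where "U z = integral {0..z} g" for z
  have U: "primitive L g U"
    using primitive_indefinite[OF sqi_absolutely_integrable(2)[OF g], of 0] by (simp add: U_def[abs_def])
  have Us: "sqi L U" by (rule sqi_continuous[OF primitive_continuous[OF U]])
  have s: "sqi L (\<lambda>z. w z - U z)" using w Us by (rule sqi_diff)
  have "integral {0..L} (\<lambda>z. (w z - U z) * deriv \<phi> z) = 0" if "test_fun L \<phi>" for \<phi>
  proof -
    have "is_weak_deriv L (cl L U) (cl L g)" by (rule primitive_weak_deriv[OF U g L])
    then have e: "integral {0..L} (\<lambda>z. w z * deriv \<phi> z) = integral {0..L} (\<lambda>z. U z * deriv \<phi> z)"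
      using d that by (simp add: is_weak_deriv_cl w g L Us)
    have i: "(\<lambda>z. v z * deriv \<phi> z) integrable_on {0..L}" if "sqi L v" for v
      using absolutely_integrable_mult_continuous[OF sqi_absolutely_integrable(2)[OF that] test_fun_primitive(2)[OF \<open>test_fun L \<phi>\<close> L]]
      by (rule set_lebesgue_integral_eq_integral(1))
    show ?thesis using e i[OF w] i[OF Us] by (simp add: left_diff_distrib integral_diff)
  qed
  from du_Bois_Reymond[OF s L this] obtain c where c: "AE z in lborel. z \<in> {0..L} \<longrightarrow> w z - U z = c"
    by blast
  define u where "u z = c + U z" for z
  have u: "primitive L g u"
    using primitive_indefinite[OF sqi_absolutely_integrable(2)[OF g], of c] by (simp add: u_def[abs_def] U_def)
  moreover have "cl L w = cl L u"
    using w sqi_continuous[OF primitive_continuous[OF u]]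
  proof (subst cl_eq_iff)
    show "AE z in lborel. z \<in> {0..L} \<longrightarrow> w z = u z"
      using c by eventually_elim (auto simp: u_def)
  qed
  ultimately show ?thesis by (rule that)
qed

text \<open>Uniqueness of the weak derivative, which gives meaning to the description in
  \<open>wderiv\<close>.\<close>

lemma primitive_cl_unique:
  assumes "primitive L g u" "primitive L g' u'" "cl L u = cl L u'" "sqi L g" "sqi L g'" "0 < L"
  shows "cl L g = cl L g'"
proof -
  have eq: "u z = u' z" if "z \<in> {0..L}" for z
    using assms that by (intro continuous_cl_eq_imp_eq[of L u u'] primitive_continuous)
  have "primitive L (\<lambda>z. g z + -1 * g' z) (\<lambda>z. u z + -1 * u' z)"
    by (intro primitive_add primitive_scale assms)
  then have "integral {0..z} (\<lambda>z. g z - g' z) = 0" if "z \<in> {0..L}" for z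
    using primitive_integral[of L "\<lambda>z. g z - g' z" "\<lambda>z. u z - u' z" z] eq[OF that] eq[of 0] that by simp
  then have "AE z in lborel. z \<in> {0..L} \<longrightarrow> g z - g' z = 0"
    using assms by (intro AE_zero_if_primitive_zero sqi_diff) auto
  then show ?thesis using assms by (simp add: cl_eq_iff)
qed

lemma H1_cl:
  assumes "primitive L g u" "sqi L g" "0 < L"
  shows "cl L u \<in> H1 L" and wderiv_cl: "wderiv L (cl L u) = cl L g"
proof -
  have s: "sqi L u" by (rule sqi_continuous[OF primitive_continuous[OF assms(1)]])
  have d: "is_weak_deriv L (cl L u) (cl L g)" by (rule primitive_weak_deriv[OF assms])
  then show "cl L u \<in> H1 L" using assms s by (auto simp: H1_def)
  show "wderiv L (cl L u) = cl L g"
    unfolding wderiv_def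
  proof (rule the_equality)
    show "cl L g \<in> L2 L \<and> is_weak_deriv L (cl L u) (cl L g)" using assms d by simp
    fix y assume y: "y \<in> L2 L \<and> is_weak_deriv L (cl L u) y"
    then obtain g' where g': "sqi L g'" "y = cl L g'" by (auto elim: L2_cases)
    then obtain u' where "primitive L g' u'" "cl L u = cl L u'"
      using weak_deriv_primitive[OF s g'(1) assms(3)] y by blast
    then show "y = cl L g" using primitive_cl_unique[of L g' u' g u] assms g' by simp
  qed
qed

lemma H1_cases:
  assumes "x \<in> H1 L" "0 < L"
  obtains u g where "sqi L g" "primitive L g u" "x = cl L u"
proof -
  obtain y where y: "x \<in> L2 L" "y \<in> L2 L" "is_weak_deriv L x y"
    using assms by (auto simp: H1_def)
  then obtain w g where "sqi L w" "x = cl L w" "sqi L g" "y = cl L g" by (metis L2_cases)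
  with y show ?thesis using weak_deriv_primitive[of L w g] assms(2) that by metis
qed

text \<open>Continuous representatives agree on the whole closed interval, end points included, so
  the description in \<open>pval\<close> is unambiguous.\<close>

lemma pval_cl:
  assumes "continuous_on {0..L} u" "0 < L" "z \<in> {0..L}"
  shows "pval L (cl L u) z = u z"
  unfolding pval_def
proof (rule the_equality)
  have rep: "is_rep L (cl L u) v \<longleftrightarrow> cl L u = cl L v" if v: "continuous_on {0..L} v" for v
  proof -
    have "is_rep L (cl L u) v \<longleftrightarrow> (AE z in lborel. z \<in> {0<..<L} \<longrightarrow> zext L u z = v z)"
      using sqi_continuous[OF assms(1)] by (simp add: cl_def is_rep.abs_eq sqi_def)
    also have "\<dots> \<longleftrightarrow> (AE z in lborel. z \<in> {0..L} \<longrightarrow> u z = v z)"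
      unfolding AE_interior_iff by (simp add: zext_in cong: imp_cong)
    finally show ?thesis
      using sqi_continuous[OF assms(1)] sqi_continuous[OF v] by (simp add: cl_eq_iff)
  qed
  show "\<exists>v. continuous_on {0..L} v \<and> is_rep L (cl L u) v \<and> v z = u z"
    using rep assms by blast
  fix c assume "\<exists>v. continuous_on {0..L} v \<and> is_rep L (cl L u) v \<and> v z = c"
  then obtain v where v: "continuous_on {0..L} v" "cl L u = cl L v" "v z = c"
    using rep by blast
  then show "c = u z"
    using continuous_cl_eq_imp_eq[OF assms(2,1) v(1,2) assms(3)] by simp
qed

text \<open>The first derivative is carried along as a function so that boundary conditions become
  plain equations between its values at 0 and L.\<close>

definition H2rep :: "real \<Rightarrow> (real \<Rightarrow> real) \<Rightarrow> (real \<Rightarrow> real) \<Rightarrow> (real \<Rightarrow> real) \<Rightarrow> bool" where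
  "H2rep L u v g \<longleftrightarrow> sqi L g \<and> primitive L g v \<and> primitive L v u"

lemma H2rep_continuous:
  assumes "H2rep L u v g"
  shows "continuous_on {0..L} u" "continuous_on {0..L} v" "sqi L u" "sqi L v" "sqi L g"
  using assms primitive_continuous by (auto simp: H2rep_def intro!: sqi_continuous)

lemma H2_cl:
  assumes "H2rep L u v g" "0 < L"
  shows "cl L u \<in> H2 L" "wderiv L (cl L u) = cl L v" "wderiv L (wderiv L (cl L u)) = cl L g"
    "z \<in> {0..L} \<Longrightarrow> pval L (cl L u) z = u z" "z \<in> {0..L} \<Longrightarrow> pval L (wderiv L (cl L u)) z = v z"
proof -
  note c = H2rep_continuous[OF assms(1)]
  show w: "wderiv L (cl L u) = cl L v"
    using assms c by (intro wderiv_cl) (auto simp: H2rep_def)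
  show "wderiv L (wderiv L (cl L u)) = cl L g"
    unfolding w using assms c by (intro wderiv_cl) (auto simp: H2rep_def)
  show "cl L u \<in> H2 L"
    using H1_cl(1)[of L v u] H1_cl(1)[of L g v] assms c w by (auto simp: H2rep_def H2_def)
  show "z \<in> {0..L} \<Longrightarrow> pval L (cl L u) z = u z" "z \<in> {0..L} \<Longrightarrow> pval L (wderiv L (cl L u)) z = v z"
    unfolding w using c assms by (auto intro: pval_cl)
qed

text \<open>The weak derivative first found for \<open>u\<close> need not be continuous; it is
  replaced by the continuous representative of its class, which changes it on a null set only and
  leaves the primitive alone.\<close>

lemma H2_cases:
  assumes "x \<in> H2 L" "0 < L"
  obtains u v g where "H2rep L u v g" "x = cl L u"
proof -
  have "x \<in> H1 L" using assms by (simp add: H2_def)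
  then obtain u v0 where u: "sqi L v0" "primitive L v0 u" "x = cl L u"
    by (rule H1_cases[OF _ assms(2)])
  then have "wderiv L x = cl L v0" using assms by (simp add: wderiv_cl)
  then have "cl L v0 \<in> H1 L" using assms by (simp add: H2_def)
  then obtain v g where v: "sqi L g" "primitive L g v" "cl L v0 = cl L v"
    by (rule H1_cases[OF _ assms(2)])
  have vs: "sqi L v" by (rule sqi_continuous[OF primitive_continuous[OF v(2)]])
  have "AE z in lborel. z \<in> {0..L} \<longrightarrow> v0 z = v z"
    using v(3) cl_eq_iff[OF u(1) vs] by simp
  then have "primitive L v u"
    using primitive_cong_AE[OF u(2)] sqi_absolutely_integrable(2)[OF vs] by blast
  then show ?thesis using that[of u v g] u v by (auto simp: H2rep_def)
qed

section \<open>The Robin Laplacian\<close>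

lemma H2rep_zero: "H2rep L (\<lambda>_. 0) (\<lambda>_. 0) (\<lambda>_. 0)"
  by (auto simp: H2rep_def intro!: sqi_continuous primitive_C1)

lemma H2rep_add: "H2rep L u v g \<Longrightarrow> H2rep L u' v' g' \<Longrightarrow>
    H2rep L (\<lambda>z. u z + u' z) (\<lambda>z. v z + v' z) (\<lambda>z. g z + g' z)"
  by (auto simp: H2rep_def intro!: sqi_add primitive_add)

lemma H2rep_scale: "H2rep L u v g \<Longrightarrow> H2rep L (\<lambda>z. c * u z) (\<lambda>z. c * v z) (\<lambda>z. c * g z)"
  by (auto simp: H2rep_def intro!: sqi_scale primitive_scale)

lemma H2rep_diff: "H2rep L u v g \<Longrightarrow> H2rep L u' v' g' \<Longrightarrow>
    H2rep L (\<lambda>z. u z - u' z) (\<lambda>z. v z - v' z) (\<lambda>z. g z - g' z)"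
  using H2rep_add[of L u v g "\<lambda>z. -1 * u' z"] H2rep_scale[of L u' v' g' "-1"] by fastforce

lemma H2rep_C2:
  assumes "\<And>z. (u has_real_derivative v z) (at z)" "\<And>z. (v has_real_derivative g z) (at z)" "continuous_on UNIV g"
  shows "H2rep L u v g"
proof -
  have g: "continuous_on {0..L} g" using assms(3) by (rule continuous_on_subset) simp
  have v: "continuous_on {0..L} v"
    by (rule DERIV_continuous_on[OF has_field_derivative_at_within[OF assms(2)]])
  show ?thesis
    unfolding H2rep_def using g v
    by (auto intro!: sqi_continuous primitive_C1 has_field_derivative_at_within assms)
qed

definition robin :: "real \<Rightarrow> real \<Rightarrow> real \<Rightarrow> (L2R \<times> L2R) set" where
  "robin D L \<gamma> = {(cl L u, D *\<^sub>R cl L g) | u v g. H2rep L u v g \<and> v 0 = 0 \<and> v L = \<gamma> * u L}"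

lemma robinI: "H2rep L u v g \<Longrightarrow> v 0 = 0 \<Longrightarrow> v L = \<gamma> * u L \<Longrightarrow> (cl L u, D *\<^sub>R cl L g) \<in> robin D L \<gamma>"
  by (auto simp: robin_def)

lemma robinE:
  assumes "(x, y) \<in> robin D L \<gamma>"
  obtains u v g where "H2rep L u v g" "v 0 = 0" "v L = \<gamma> * u L" "x = cl L u" "y = D *\<^sub>R cl L g"
  using assms by (auto simp: robin_def)

section \<open>Reduction of both operators to the Robin Laplacian\<close>

lemma A_op_eq:
  assumes "0 < L"
  shows "A_op D L \<gamma> = {(cl L u, D *\<^sub>R cl L g) | u v g. H2rep L u v g \<and> v 0 + \<gamma> * u 0 = 0 \<and> v L = 0}"
proof -
  have *: "pval L (wderiv L (cl L u)) 0 = v 0" "pval L (wderiv L (cl L u)) L = v L" "pval L (cl L u) 0 = u 0"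
    if "H2rep L u v g" for u v g
    using H2_cl(4,5)[OF that assms] assms by auto
  show ?thesis
  proof (intro set_eqI iffI)
    fix p assume "p \<in> A_op D L \<gamma>"
    then obtain x where x: "p = (x, D *\<^sub>R wderiv L (wderiv L x))" "x \<in> H2 L"
      "pval L (wderiv L x) 0 + \<gamma> * pval L x 0 = 0" "pval L (wderiv L x) L = 0"
      by (auto simp: A_op_def)
    obtain u v g where h: "H2rep L u v g" and xu: "x = cl L u" by (rule H2_cases[OF x(2) assms])
    have "p = (cl L u, D *\<^sub>R cl L g)" using x(1) H2_cl(3)[OF h assms] by (simp add: xu)
    moreover have "v 0 + \<gamma> * u 0 = 0" "v L = 0" using x(3,4) *[OF h] by (simp_all add: xu)
    ultimately show "p \<in> {(cl L u, D *\<^sub>R cl L g) | u v g. H2rep L u v g \<and> v 0 + \<gamma> * u 0 = 0 \<and> v L = 0}"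
      using h by blast
  next
    fix p assume "p \<in> {(cl L u, D *\<^sub>R cl L g) | u v g. H2rep L u v g \<and> v 0 + \<gamma> * u 0 = 0 \<and> v L = 0}"
    then obtain u v g where h: "H2rep L u v g" and p: "p = (cl L u, D *\<^sub>R cl L g)" "v 0 + \<gamma> * u 0 = 0" "v L = 0"
      by auto
    have "p = (cl L u, D *\<^sub>R wderiv L (wderiv L (cl L u)))"
      using p(1) H2_cl(3)[OF h assms] by simp
    moreover have "pval L (wderiv L (cl L u)) 0 + \<gamma> * pval L (cl L u) 0 = 0" "pval L (wderiv L (cl L u)) L = 0"
      using p(2,3) *[OF h] by simp_all
    ultimately show "p \<in> A_op D L \<gamma>"
      using H2_cl(1)[OF h assms] unfolding A_op_def by blast
  qed
qed

lemma reflect_cl: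
  assumes "sqi L u"
  shows "sqi L (\<lambda>z. u (L - z))" "reflect L (cl L u) = cl L (\<lambda>z. u (L - z))"
proof -
  have *: "(\<lambda>z. zext L u (L - z)) = zext L (\<lambda>z. u (L - z))"
    by (auto simp: zext_def indicator_def)
  then show "sqi L (\<lambda>z. u (L - z))"
    using sq_integrable_reflect[of "zext L u" L] assms by (simp add: sqi_def)
  show "reflect L (cl L u) = cl L (\<lambda>z. u (L - z))"
    using assms by (simp add: cl_def reflect.abs_eq sqi_def *)
qed

lemma primitive_interval:
  assumes "primitive L f F" "0 \<le> a" "a \<le> b" "b \<le> L"
  shows "(f has_integral F b - F a) {a..b}"
proof -
  have i: "f integrable_on {0..L}"
    using assms(1) set_lebesgue_integral_eq_integral(1) by (auto simp: primitive_def)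
  have ib: "f integrable_on {0..b}" "f integrable_on {a..b}"
    by (rule integrable_subinterval_real[OF i]; use assms in auto)+
  have "integral {a..b} f = F b - F a"
    using Henstock_Kurzweil_Integration.integral_combine[OF assms(2,3) ib(1)]
      primitive_integral[OF assms(1), of a] primitive_integral[OF assms(1), of b] assms by simp
  then show ?thesis using ib(2) by (metis integrable_integral)
qed

lemma primitive_reflect:
  assumes P: "primitive L f F" and f: "sqi L f"
  shows "primitive L (\<lambda>z. - f (L - z)) (\<lambda>z. F (L - z))"
  unfolding primitive_def
proof (intro conjI ballI)
  show "(\<lambda>z. - f (L - z)) absolutely_integrable_on {0..L}"
    using sqi_absolutely_integrable(2)[OF sqi_scale[OF reflect_cl(1)[OF f], of "-1"]] by simp
  fix z assume z: "z \<in> {0..L}"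
  have "(f has_integral F L - F (L - z)) (cbox (L - z) L)"
    using primitive_interval[OF P, of "L - z" L] z by simp
  from has_integral_affinity[OF this, of "-1" L]
  have "((\<lambda>x. f (L - x)) has_integral F L - F (L - z)) ((\<lambda>x. L - x) ` {L - z..L})"
    by (simp add: algebra_simps)
  moreover have "(\<lambda>x. L - x) ` {L - z..L} = {0..z}"
    using z by (simp add: image_diff_atLeastAtMost)
  ultimately have "((\<lambda>x. - f (L - x)) has_integral - (F L - F (L - z))) {0..z}"
    by (intro has_integral_neg) simp
  then show "((\<lambda>z. - f (L - z)) has_integral F (L - z) - F (L - 0)) {0..z}"
    by simp
qed

lemma H2rep_reflect:
  assumes "H2rep L u v g"
  shows "H2rep L (\<lambda>z. u (L - z)) (\<lambda>z. - v (L - z)) (\<lambda>z. g (L - z))"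
  using assms primitive_scale[OF primitive_reflect[of L g v], of "-1"] primitive_reflect[of L v u]
    H2rep_continuous[OF assms] reflect_cl(1)
  by (auto simp: H2rep_def)

lemma reflect_scaleR: "reflect L (c *\<^sub>R x) = c *\<^sub>R reflect L x"
proof transfer
  fix L c and f :: "real \<Rightarrow> real" assume "sq_eq f f"
  then show "sq_eq (\<lambda>z. c * f (L - z)) (\<lambda>z. c * f (L - z))"
    by (simp add: sq_integrable_cmult sq_integrable_reflect)
qed

text \<open>Reflection exchanges the end points and reverses the sign of the first derivative, so
  the condition u'(0) + \<gamma> u(0) = 0 turns into e'(L) = \<gamma> e(L).\<close>

lemma conj_A_op_eq_robin:
  assumes L: "0 < L"
  shows "conj_op (reflect L) (A_op D L \<gamma>) = robin D L \<gamma>"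
proof (intro set_eqI iffI)
  fix p assume "p \<in> conj_op (reflect L) (A_op D L \<gamma>)"
  then obtain u v g where h: "H2rep L u v g" and b: "v 0 + \<gamma> * u 0 = 0" "v L = 0"
    and p: "p = (reflect L (cl L u), reflect L (D *\<^sub>R cl L g))"
    unfolding conj_op_def A_op_eq[OF L] by blast
  have "p = (cl L (\<lambda>z. u (L - z)), D *\<^sub>R cl L (\<lambda>z. g (L - z)))"
    using H2rep_continuous[OF h] by (simp add: p reflect_scaleR reflect_cl)
  also have "\<dots> \<in> robin D L \<gamma>"
    by (rule robinI[OF H2rep_reflect[OF h]]) (use b in auto)
  finally show "p \<in> robin D L \<gamma>" .
next
  fix p assume "p \<in> robin D L \<gamma>"
  then obtain u v g where h: "H2rep L u v g" and b: "v 0 = 0" "v L = \<gamma> * u L"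
    and p: "p = (cl L u, D *\<^sub>R cl L g)"
    by (auto simp: robin_def)
  let ?u = "\<lambda>z. u (L - z)" and ?v = "\<lambda>z. - v (L - z)" and ?g = "\<lambda>z. g (L - z)"
  have r: "H2rep L ?u ?v ?g" by (rule H2rep_reflect[OF h])
  then have "(cl L ?u, D *\<^sub>R cl L ?g) \<in> A_op D L \<gamma>"
    unfolding A_op_eq[OF L] using b by force
  moreover have "p = (reflect L (cl L ?u), reflect L (D *\<^sub>R cl L ?g))"
    using H2rep_continuous[OF r] by (simp add: p reflect_scaleR reflect_cl)
  ultimately show "p \<in> conj_op (reflect L) (A_op D L \<gamma>)"
    unfolding conj_op_def by blast
qed

text \<open>Subtracting the two conditions at L leaves e'(L) = \<gamma> e(L). The set has the shape
  in which \<open>generator_triangular\<close> describes the generator of a coupled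
  semigroup.\<close>

lemma A0_eq_robin:
  assumes L: "0 < L"
  shows "A0 D L \<gamma> = {((x, x'), (y, y')). (x, y) \<in> robin D L 0 \<and> (x' - x, y' - y) \<in> robin D L \<gamma>}"
proof (intro set_eqI iffI)
  fix p assume "p \<in> A0 D L \<gamma>"
  then obtain x x' where x: "x \<in> H2 L" "x' \<in> H2 L" and b:
     "pval L (wderiv L x) 0 = 0" "pval L (wderiv L x') 0 = 0" "pval L (wderiv L x) L = 0"
     "pval L (wderiv L x') L = - \<gamma> * pval L x L + \<gamma> * pval L x' L"
    and p: "p = ((x, x'), (D *\<^sub>R wderiv L (wderiv L x), D *\<^sub>R wderiv L (wderiv L x')))"
    unfolding A0_def by blast
  obtain u v g where h: "H2rep L u v g" and xu: "x = cl L u" by (rule H2_cases[OF x(1) L])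
  obtain u' v' g' where h': "H2rep L u' v' g'" and xu': "x' = cl L u'" by (rule H2_cases[OF x(2) L])
  have b': "v 0 = 0" "v' 0 = 0" "v L = 0" "v' L = - \<gamma> * u L + \<gamma> * u' L"
    using b H2_cl(4,5)[OF h L] H2_cl(4,5)[OF h' L] L by (auto simp: xu xu')
  have "(x, D *\<^sub>R cl L g) \<in> robin D L 0"
    unfolding xu by (rule robinI[OF h]) (use b' in auto)
  moreover have "(cl L (\<lambda>z. u' z - u z), D *\<^sub>R cl L (\<lambda>z. g' z - g z)) \<in> robin D L \<gamma>"
    by (rule robinI[OF H2rep_diff[OF h' h]]) (use b' in \<open>auto simp: algebra_simps\<close>)
  then have "(x' - x, D *\<^sub>R cl L g' - D *\<^sub>R cl L g) \<in> robin D L \<gamma>"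
    using H2rep_continuous[OF h] H2rep_continuous[OF h'] by (simp add: xu xu' cl_diff scaleR_diff_right)
  ultimately show "p \<in> {((x, x'), (y, y')). (x, y) \<in> robin D L 0 \<and> (x' - x, y' - y) \<in> robin D L \<gamma>}"
    using H2_cl(3)[OF h L] H2_cl(3)[OF h' L] by (simp add: p xu xu')
next
  fix p assume "p \<in> {((x, x'), (y, y')). (x, y) \<in> robin D L 0 \<and> (x' - x, y' - y) \<in> robin D L \<gamma>}"
  then obtain x x' y y' where p: "p = ((x, x'), (y, y'))" and r: "(x, y) \<in> robin D L 0" "(x' - x, y' - y) \<in> robin D L \<gamma>"
    by auto
  obtain u v g where h: "H2rep L u v g" and b: "v 0 = 0" "v L = 0 * u L" and x: "x = cl L u" "y = D *\<^sub>R cl L g"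
    by (rule robinE[OF r(1)])
  obtain w w1 w2 where hw: "H2rep L w w1 w2" and bw: "w1 0 = 0" "w1 L = \<gamma> * w L" and e: "x' - x = cl L w" "y' - y = D *\<^sub>R cl L w2"
    by (rule robinE[OF r(2)])
  define u' v' g' where "u' z = w z + u z" and "v' z = w1 z + v z" and "g' z = w2 z + g z" for z
  have h': "H2rep L u' v' g'"
    using H2rep_add[OF hw h] by (simp add: u'_def[abs_def] v'_def[abs_def] g'_def[abs_def])
  have x': "x' = cl L u'" "y' = D *\<^sub>R cl L g'"
    using e x H2rep_continuous[OF h] H2rep_continuous[OF hw]
    by (simp_all add: u'_def[abs_def] g'_def[abs_def] cl_add scaleR_add_right algebra_simps)
  show "p \<in> A0 D L \<gamma>"
    unfolding A0_def p
    using H2_cl[OF h L] H2_cl[OF h' L] b bw L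
    by (auto simp: x x' u'_def v'_def algebra_simps intro!: exI[of _ "cl L u"] exI[of _ "cl L u'"])
qed

section \<open>Sharp dissipativity\<close>

text \<open>The square of u' - w u is (u')^2 - (w u^2)' - \<mu>^2 u^2. Integrating it leaves only
  the boundary term at L, since w(0) = 0. Equality holds for u = cos (\<mu> z), where u' = w u, so
  the constant cannot be improved.\<close>

lemma riccati_inequality:
  assumes L: "0 < L" and \<mu>: "0 \<le> \<mu>" "\<mu> * L < pi / 2"
    and u: "\<And>z. z \<in> {0..L} \<Longrightarrow> (u has_real_derivative v z) (at z within {0..L})" and v: "continuous_on {0..L} v"
  shows "\<mu>\<^sup>2 * integral {0..L} (\<lambda>z. u z * u z) \<le> integral {0..L} (\<lambda>z. v z * v z) + \<mu> * tan (\<mu> * L) * (u L)\<^sup>2"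
proof -
  define w where "w z = - \<mu> * tan (\<mu> * z)" for z
  \<comment> \<open>The Riccati equation w' = - \<mu>^2 - w^2. Its solution stays finite up to L
    exactly because \<mu> L < \<pi> / 2.\<close>
  define w' where "w' z = - \<mu>\<^sup>2 - (w z)\<^sup>2" for z
  have cos0: "cos (\<mu> * z) \<noteq> 0" if "z \<in> {0..L}" for z
  proof -
    have "\<mu> * z \<le> \<mu> * L" "0 \<le> \<mu> * z" using that \<mu>(1) by (auto intro: mult_left_mono)
    then have "0 < cos (\<mu> * z)" using \<mu>(2) pi_gt_zero by (intro cos_gt_zero_pi) linarith+
    then show ?thesis by simp
  qed
  have Dw: "(w has_real_derivative w' z) (at z within {0..L})" if "z \<in> {0..L}" for z
  proof -
    have "(w has_real_derivative - \<mu> * (inverse ((cos (\<mu> * z))\<^sup>2) * \<mu>)) (at z within {0..L})"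
      unfolding w_def using cos0[OF that]
      by (auto intro!: derivative_eq_intros simp: power2_eq_square field_simps)
    also have "- \<mu> * (inverse ((cos (\<mu> * z))\<^sup>2) * \<mu>) = - \<mu>\<^sup>2 * (1 + (tan (\<mu> * z))\<^sup>2)"
      unfolding tan_sec[OF cos0[OF that]] by (simp add: power2_eq_square)
    also have "\<dots> = w' z"
      by (simp add: w'_def w_def power_mult_distrib algebra_simps)
    finally show ?thesis .
  qed
  have cu: "continuous_on {0..L} u" using u by (rule DERIV_continuous_on)
  have cw: "continuous_on {0..L} w" using Dw by (rule DERIV_continuous_on)
  have cw': "continuous_on {0..L} w'" unfolding w'_def by (intro continuous_intros cw)
  define k where "k z = w' z * (u z)\<^sup>2 + 2 * w z * u z * v z" for z
  have "((\<lambda>z. w z * (u z)\<^sup>2) has_real_derivative k z) (at z within {0..L})" if "z \<in> {0..L}" for z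
    unfolding k_def using that by (auto intro!: derivative_eq_intros Dw u)
  then have "(k has_integral w L * (u L)\<^sup>2 - w 0 * (u 0)\<^sup>2) {0..L}"
    using L by (intro fundamental_theorem_of_calculus) (auto simp flip: has_real_derivative_iff_has_vector_derivative)
  then have k: "(k has_integral w L * (u L)\<^sup>2) {0..L}" by (simp add: w_def)
  have vv: "((\<lambda>z. v z * v z) has_integral integral {0..L} (\<lambda>z. v z * v z)) {0..L}"
    by (intro integrable_integral integrable_continuous_real continuous_intros v)
  have uu: "((\<lambda>z. \<mu>\<^sup>2 * (u z * u z)) has_integral \<mu>\<^sup>2 * integral {0..L} (\<lambda>z. u z * u z)) {0..L}"
    by (intro has_integral_mult_right integrable_integral integrable_continuous_real continuous_intros cu)
  have "((\<lambda>z. v z * v z - k z - \<mu>\<^sup>2 * (u z * u z)) has_integral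
      integral {0..L} (\<lambda>z. v z * v z) - w L * (u L)\<^sup>2 - \<mu>\<^sup>2 * integral {0..L} (\<lambda>z. u z * u z)) {0..L}"
    by (intro has_integral_diff vv k uu)
  moreover have "0 \<le> v z * v z - k z - \<mu>\<^sup>2 * (u z * u z)" for z
  proof -
    have "v z * v z - k z - \<mu>\<^sup>2 * (u z * u z) = (v z - w z * u z)\<^sup>2"
      by (simp add: k_def w'_def power2_eq_square algebra_simps)
    then show ?thesis by simp
  qed
  ultimately have "0 \<le> integral {0..L} (\<lambda>z. v z * v z) - w L * (u L)\<^sup>2 - \<mu>\<^sup>2 * integral {0..L} (\<lambda>z. u z * u z)"
    by (rule has_integral_nonneg)
  then show ?thesis by (simp add: w_def)
qed

text \<open>Integration by parts produces the boundary term v(L) u(L) = - \<mu> tan (\<mu> L)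
  u(L)^2, which is the one that \<open>riccati_inequality\<close> cancels.\<close>

lemma robin_dissipative:
  assumes D: "0 < D" and L: "0 < L" and \<mu>: "0 \<le> \<mu>" "\<mu> * L < pi / 2"
    and xy: "(x, y) \<in> robin D L (- \<mu> * tan (\<mu> * L))"
  shows "y \<bullet> x \<le> - (D * \<mu>\<^sup>2) * (norm x)\<^sup>2"
proof -
  obtain u v g where h: "H2rep L u v g" and b: "v 0 = 0" "v L = - \<mu> * tan (\<mu> * L) * u L"
    and x: "x = cl L u" "y = D *\<^sub>R cl L g"
    by (rule robinE[OF xy])
  note c = H2rep_continuous[OF h]
  have P: "primitive L g v" "primitive L v u" using h by (auto simp: H2rep_def)
  have "integral {0..L} (\<lambda>z. g z * u z) = - \<mu> * tan (\<mu> * L) * (u L)\<^sup>2 - integral {0..L} (\<lambda>z. v z * v z)"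
    using integral_by_parts_primitive[OF P c(2)] L b by (simp add: power2_eq_square)
  also have "\<dots> \<le> - (\<mu>\<^sup>2 * integral {0..L} (\<lambda>z. u z * u z))"
    using riccati_inequality[OF L \<mu> primitive_DERIV[OF P(2) c(2)] c(2)] by simp
  finally have "D * integral {0..L} (\<lambda>z. g z * u z) \<le> D * - (\<mu>\<^sup>2 * integral {0..L} (\<lambda>z. u z * u z))"
    using D by (intro mult_left_mono) auto
  then show ?thesis
    using c by (simp add: x inner_cl power2_norm_eq_inner)
qed

section \<open>The explicit resolvent and its order properties\<close>

text \<open>Reduction of order: writing the solution of \<open>a u'' = u - f\<close>, \<open>\<kappa>\<^sup>2 = 1/a\<close>, \<open>u'(0) = 0\<close> as
  \<open>u = V cosh (\<kappa> z)\<close> gives \<open>V' = - \<kappa>\<^sup>2 F / cosh\<^sup>2\<close> with \<open>F\<close> the weighted primitive of \<open>f\<close>; the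
  condition at \<open>L\<close> fixes \<open>V L\<close>. Every ingredient is manifestly monotone in \<open>f\<close>.\<close>

definition weighted_primitive :: "real \<Rightarrow> (real \<Rightarrow> real) \<Rightarrow> real \<Rightarrow> real" where
  "weighted_primitive \<kappa> f z = integral {0..z} (\<lambda>s. f s * cosh (\<kappa> * s))"

definition boundary_coeff :: "real \<Rightarrow> real \<Rightarrow> real \<Rightarrow> (real \<Rightarrow> real) \<Rightarrow> real" where
  "boundary_coeff \<kappa> L \<gamma> f = \<kappa>\<^sup>2 * weighted_primitive \<kappa> f L /
     (cosh (\<kappa> * L) * (\<kappa> * sinh (\<kappa> * L) - \<gamma> * cosh (\<kappa> * L)))"

definition resolvent_fun :: "real \<Rightarrow> real \<Rightarrow> real \<Rightarrow> (real \<Rightarrow> real) \<Rightarrow> real \<Rightarrow> real" where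
  "resolvent_fun \<kappa> L \<gamma> f z = cosh (\<kappa> * z) * (boundary_coeff \<kappa> L \<gamma> f
     + \<kappa>\<^sup>2 * (integral {0..L} (\<lambda>s. weighted_primitive \<kappa> f s / (cosh (\<kappa> * s))\<^sup>2)
            - integral {0..z} (\<lambda>s. weighted_primitive \<kappa> f s / (cosh (\<kappa> * s))\<^sup>2)))"

lemma cosh_ne_0: "cosh (x :: real) \<noteq> 0"
  using cosh_real_pos[of x] by simp

lemma weighted_primitive:
  assumes "sqi L f"
  shows "primitive L (\<lambda>s. f s * cosh (\<kappa> * s)) (weighted_primitive \<kappa> f)"
    and "continuous_on {0..L} (\<lambda>s. weighted_primitive \<kappa> f s / (cosh (\<kappa> * s))\<^sup>2)"
proof -
  have "(\<lambda>s. f s * cosh (\<kappa> * s)) absolutely_integrable_on {0..L}"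
    by (intro absolutely_integrable_mult_continuous sqi_absolutely_integrable assms continuous_intros)
  from primitive_indefinite[OF this, of 0]
  show P: "primitive L (\<lambda>s. f s * cosh (\<kappa> * s)) (weighted_primitive \<kappa> f)"
    by (simp add: weighted_primitive_def[abs_def])
  show "continuous_on {0..L} (\<lambda>s. weighted_primitive \<kappa> f s / (cosh (\<kappa> * s))\<^sup>2)"
    by (intro continuous_intros primitive_continuous[OF P]) (simp add: cosh_ne_0)
qed

lemma boundary_denominator_pos:
  fixes L \<kappa> \<gamma> :: real
  assumes "0 < L" "0 < \<kappa>" "\<gamma> \<le> 0"
  shows "0 < \<kappa> * sinh (\<kappa> * L) - \<gamma> * cosh (\<kappa> * L)"
proof -
  have "0 < \<kappa> * sinh (\<kappa> * L)"
    using assms by (intro mult_pos_pos) (simp_all add: sinh_real_pos_iff)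
  moreover have "\<gamma> * cosh (\<kappa> * L) \<le> 0"
    using assms cosh_real_pos[of "\<kappa> * L"] by (simp add: mult_le_0_iff)
  ultimately show ?thesis by simp
qed

text \<open>\<open>F\<close> is only absolutely continuous, so u' is split into a C1 part,
  differentiated classically in \<open>P1\<close>, and the product of \<open>F\<close> with 1 /
  cosh, handled by \<open>primitive_mult\<close> in \<open>P2\<close>. In the sum the terms
  containing \<open>F\<close> without a factor \<open>V\<close> cancel.\<close>

lemma resolvent_fun_H2rep:
  assumes f: "sqi L f" and L: "0 < L" and \<kappa>: "0 < \<kappa>" and \<gamma>: "\<gamma> \<le> 0"
  obtains v where "H2rep L (resolvent_fun \<kappa> L \<gamma> f) v (\<lambda>z. \<kappa>\<^sup>2 * (resolvent_fun \<kappa> L \<gamma> f z - f z))"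
    "v 0 = 0" "v L = \<gamma> * resolvent_fun \<kappa> L \<gamma> f L"
proof -
  define F where "F = weighted_primitive \<kappa> f"
  define M where "M = boundary_coeff \<kappa> L \<gamma> f"
  define q where "q s = F s / (cosh (\<kappa> * s))\<^sup>2" for s
  define Q where "Q z = integral {0..z} q" for z
  define V where "V z = M + \<kappa>\<^sup>2 * (Q L - Q z)" for z
  define u where "u = resolvent_fun \<kappa> L \<gamma> f"
  have u: "u z = cosh (\<kappa> * z) * V z" for z
    by (simp add: u_def resolvent_fun_def V_def M_def Q_def q_def[abs_def] F_def)
  note F = weighted_primitive(1)[OF f, of \<kappa>, folded F_def]
  have cF: "continuous_on {0..L} F" by (rule primitive_continuous[OF F])
  have cq: "continuous_on {0..L} q"
    using weighted_primitive(2)[OF f, of \<kappa>] by (simp add: q_def[abs_def] F_def)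
  have "primitive L q Q"
    using primitive_indefinite[OF absolutely_integrable_continuous_real[OF cq], of 0] by (simp add: Q_def[abs_def])
  note DQ = primitive_DERIV[OF this cq]
  have DV: "(V has_real_derivative - \<kappa>\<^sup>2 * q z) (at z within {0..L})" if "z \<in> {0..L}" for z
    unfolding V_def by (auto intro!: derivative_eq_intros DQ that)
  have cV: "continuous_on {0..L} V" using DV by (rule DERIV_continuous_on)
  define v where "v z = \<kappa> * sinh (\<kappa> * z) * V z - \<kappa>\<^sup>2 * (F z * (1 / cosh (\<kappa> * z)))" for z
  have cv: "continuous_on {0..L} v"
    unfolding v_def by (intro continuous_intros cV cF) (simp add: cosh_ne_0)
  have Du: "(u has_real_derivative v z) (at z within {0..L})" if "z \<in> {0..L}" for z
    unfolding u[abs_def] v_def using cosh_ne_0[of "\<kappa> * z"]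
    by (auto intro!: derivative_eq_intros DV that simp: q_def field_simps power2_eq_square)
  have Pu: "primitive L v u" by (rule primitive_C1[OF Du cv])
  have us: "sqi L u" by (rule sqi_continuous[OF primitive_continuous[OF Pu]])
  have P1: "primitive L (\<lambda>z. \<kappa>\<^sup>2 * cosh (\<kappa> * z) * V z + \<kappa> * sinh (\<kappa> * z) * (- \<kappa>\<^sup>2 * q z)) (\<lambda>z. \<kappa> * sinh (\<kappa> * z) * V z)"
  proof (rule primitive_C1)
    show "((\<lambda>z. \<kappa> * sinh (\<kappa> * z) * V z) has_real_derivative
        \<kappa>\<^sup>2 * cosh (\<kappa> * z) * V z + \<kappa> * sinh (\<kappa> * z) * (- \<kappa>\<^sup>2 * q z)) (at z within {0..L})" if "z \<in> {0..L}" for z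
      by (auto intro!: derivative_eq_intros DV that simp: power2_eq_square algebra_simps)
  qed (intro continuous_intros cV cq)
  have P2: "primitive L (\<lambda>z. f z * cosh (\<kappa> * z) * (1 / cosh (\<kappa> * z)) + F z * (- \<kappa> * sinh (\<kappa> * z) / (cosh (\<kappa> * z))\<^sup>2))
      (\<lambda>z. F z * (1 / cosh (\<kappa> * z)))"
  proof (rule primitive_mult[OF F primitive_C1])
    show c: "continuous_on {0..L} (\<lambda>z. - \<kappa> * sinh (\<kappa> * z) / (cosh (\<kappa> * z))\<^sup>2)"
      by (intro continuous_intros) (simp add: cosh_ne_0)
    show "continuous_on {0..L} (\<lambda>z. - \<kappa> * sinh (\<kappa> * z) / (cosh (\<kappa> * z))\<^sup>2)" by (rule c)
    show "((\<lambda>z. 1 / cosh (\<kappa> * z)) has_real_derivative - \<kappa> * sinh (\<kappa> * z) / (cosh (\<kappa> * z))\<^sup>2) (at z within {0..L})" for z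
      using cosh_ne_0[of "\<kappa> * z"] by (auto intro!: derivative_eq_intros simp: power2_eq_square)
  qed
  have "primitive L (\<lambda>z. (\<kappa>\<^sup>2 * cosh (\<kappa> * z) * V z + \<kappa> * sinh (\<kappa> * z) * (- \<kappa>\<^sup>2 * q z)) + - \<kappa>\<^sup>2 *
      (f z * cosh (\<kappa> * z) * (1 / cosh (\<kappa> * z)) + F z * (- \<kappa> * sinh (\<kappa> * z) / (cosh (\<kappa> * z))\<^sup>2)))
      (\<lambda>z. \<kappa> * sinh (\<kappa> * z) * V z + - \<kappa>\<^sup>2 * (F z * (1 / cosh (\<kappa> * z))))"
    by (rule primitive_add[OF P1 primitive_scale[OF P2]])
  also have "(\<lambda>z. (\<kappa>\<^sup>2 * cosh (\<kappa> * z) * V z + \<kappa> * sinh (\<kappa> * z) * (- \<kappa>\<^sup>2 * q z)) + - \<kappa>\<^sup>2 *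
      (f z * cosh (\<kappa> * z) * (1 / cosh (\<kappa> * z)) + F z * (- \<kappa> * sinh (\<kappa> * z) / (cosh (\<kappa> * z))\<^sup>2)))
      = (\<lambda>z. \<kappa>\<^sup>2 * (u z - f z))"
    using cosh_ne_0 by (auto simp: u q_def field_simps)
  also have "(\<lambda>z. \<kappa> * sinh (\<kappa> * z) * V z + - \<kappa>\<^sup>2 * (F z * (1 / cosh (\<kappa> * z)))) = v"
    by (auto simp: v_def)
  finally have "primitive L (\<lambda>z. \<kappa>\<^sup>2 * (u z - f z)) v" .
  moreover have "sqi L (\<lambda>z. \<kappa>\<^sup>2 * (u z - f z))"
    by (intro sqi_scale sqi_diff us f)
  moreover have "v 0 = 0"
    by (simp add: v_def F_def weighted_primitive_def)
  moreover have "v L = \<gamma> * u L"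
  proof -
    define d where "d = \<kappa> * sinh (\<kappa> * L) - \<gamma> * cosh (\<kappa> * L)"
    have d: "d \<noteq> 0" using boundary_denominator_pos[OF L \<kappa> \<gamma>] by (simp add: d_def)
    \<comment> \<open>Since u(L) = cosh (\<kappa> L) M and v(L) = \<kappa> sinh (\<kappa> L) M -
      \<kappa>^2 F(L) / cosh (\<kappa> L), the condition at L is this linear equation for M;
      \<open>boundary_coeff\<close> is its solution.\<close>
    have "M * d = \<kappa>\<^sup>2 * F L / cosh (\<kappa> * L)"
      using d cosh_ne_0[of "\<kappa> * L"] by (simp add: M_def boundary_coeff_def F_def d_def[symmetric])
    then show ?thesis
      by (simp add: v_def u V_def d_def algebra_simps)
  qed
  ultimately show ?thesis
    using that[of v] Pu by (simp add: H2rep_def u_def)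
qed

lemma weighted_primitive_nonneg:
  assumes "sqi L f" "\<And>z. z \<in> {0..L} \<Longrightarrow> 0 \<le> f z" "z \<in> {0..L}"
  shows "0 \<le> weighted_primitive \<kappa> f z"
proof -
  have "((\<lambda>s. f s * cosh (\<kappa> * s)) has_integral weighted_primitive \<kappa> f z - weighted_primitive \<kappa> f 0) {0..z}"
    using weighted_primitive(1)[OF assms(1)] assms(3) by (auto simp: primitive_def)
  then have "0 \<le> weighted_primitive \<kappa> f z - weighted_primitive \<kappa> f 0"
    by (rule has_integral_nonneg) (use assms in auto)
  then show ?thesis by (simp add: weighted_primitive_def)
qed

text \<open>The gain enters through the denominator of \<open>boundary_coeff\<close> alone. For
  \<gamma> \<le> 0 that denominator is positive and smallest at \<gamma> = 0, so the Neumann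
  solution is the largest.\<close>

lemma resolvent_fun_mono:
  assumes f: "sqi L f" "\<And>z. z \<in> {0..L} \<Longrightarrow> 0 \<le> f z" and L: "0 < L" and \<kappa>: "0 < \<kappa>" and \<gamma>: "\<gamma> \<le> 0"
    and z: "z \<in> {0..L}"
  shows "0 \<le> resolvent_fun \<kappa> L \<gamma> f z" "resolvent_fun \<kappa> L \<gamma> f z \<le> resolvent_fun \<kappa> L 0 f z"
proof -
  note F = weighted_primitive_nonneg[OF f, of _ \<kappa>]
  let ?q = "\<lambda>s. weighted_primitive \<kappa> f s / (cosh (\<kappa> * s))\<^sup>2"
  have c: "0 < cosh (\<kappa> * z)" for z by simp
  have "continuous_on {0..L} ?q" by (rule weighted_primitive(2)[OF f(1)])
  then have "?q integrable_on {0..L}" by (rule integrable_continuous_real)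
  then have "integral {0..z} ?q \<le> integral {0..L} ?q"
    using z F by (intro integral_subset_le) (auto intro: integrable_subinterval_real)
  then have Q: "0 \<le> \<kappa>\<^sup>2 * (integral {0..L} ?q - integral {0..z} ?q)"
    by simp
  have FL: "0 \<le> weighted_primitive \<kappa> f L" using F L by simp
  have d: "0 < \<kappa> * sinh (\<kappa> * L) - \<gamma> * cosh (\<kappa> * L)" "0 < \<kappa> * sinh (\<kappa> * L) - 0 * cosh (\<kappa> * L)"
    using boundary_denominator_pos L \<kappa> \<gamma> by blast+
  have bc: "0 \<le> boundary_coeff \<kappa> L \<gamma> f"
    unfolding boundary_coeff_def using d(1) FL c[of L] by (intro divide_nonneg_pos mult_nonneg_nonneg mult_pos_pos) auto
  show "0 \<le> resolvent_fun \<kappa> L \<gamma> f z"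
    unfolding resolvent_fun_def by (rule mult_nonneg_nonneg[OF less_imp_le[OF c] add_nonneg_nonneg[OF bc Q]])
  have "\<kappa> * sinh (\<kappa> * L) - 0 * cosh (\<kappa> * L) \<le> \<kappa> * sinh (\<kappa> * L) - \<gamma> * cosh (\<kappa> * L)"
    using \<gamma> c[of L] by (simp add: mult_le_0_iff)
  then have "boundary_coeff \<kappa> L \<gamma> f \<le> boundary_coeff \<kappa> L 0 f"
    unfolding boundary_coeff_def using d FL c[of L]
    by (intro divide_left_mono mult_left_mono mult_nonneg_nonneg mult_pos_pos) auto
  then show "resolvent_fun \<kappa> L \<gamma> f z \<le> resolvent_fun \<kappa> L 0 f z"
    unfolding resolvent_fun_def using c[of z] by (intro mult_left_mono add_right_mono) auto
qed

text \<open>The choice of \<kappa> makes h D \<kappa>^2 = 1, which turns u - h D u'' = f into u'' =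
  \<kappa>^2 (u - f).\<close>

lemma robin_resolvent:
  assumes f: "sqi L f" and L: "0 < L" and D: "0 < D" and h: "0 < h" and \<gamma>: "\<gamma> \<le> 0"
  defines "u \<equiv> resolvent_fun (1 / sqrt (h * D)) L \<gamma> f"
  obtains y where "(cl L u, y) \<in> robin D L \<gamma>" "cl L u - h *\<^sub>R y = cl L f" "sqi L u"
proof -
  let ?\<kappa> = "1 / sqrt (h * D)"
  have \<kappa>: "0 < ?\<kappa>" "h * D * ?\<kappa>\<^sup>2 = 1" using h D by (auto simp: power_divide)
  obtain v where v: "H2rep L u v (\<lambda>z. ?\<kappa>\<^sup>2 * (u z - f z))" "v 0 = 0" "v L = \<gamma> * u L"
    using resolvent_fun_H2rep[OF f L \<kappa>(1) \<gamma>] unfolding u_def by blast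
  note c = H2rep_continuous[OF v(1)]
  show ?thesis
  proof (rule that)
    show "(cl L u, D *\<^sub>R cl L (\<lambda>z. ?\<kappa>\<^sup>2 * (u z - f z))) \<in> robin D L \<gamma>"
      by (rule robinI[OF v])
    have "h *\<^sub>R D *\<^sub>R cl L (\<lambda>z. ?\<kappa>\<^sup>2 * (u z - f z)) = (h * D * ?\<kappa>\<^sup>2) *\<^sub>R (cl L u - cl L f)"
      using cl_scale[OF sqi_diff[OF c(3) f], of "?\<kappa>\<^sup>2"] by (simp add: cl_diff c f)
    then show "cl L u - h *\<^sub>R D *\<^sub>R cl L (\<lambda>z. ?\<kappa>\<^sup>2 * (u z - f z)) = cl L f"
      unfolding \<kappa>(2) by simp
  qed (rule c)
qed

text \<open>The case \<mu> = 0 is included: it is the Neumann Laplacian with rate 0, the first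
  diagonal entry of the coupled system.\<close>

lemma m_dissipative_robin:
  assumes D: "0 < D" and L: "0 < L" and \<mu>: "0 \<le> \<mu>" "\<mu> * L < pi / 2"
  shows "m_dissipative (L2 L) (robin D L (- \<mu> * tan (\<mu> * L))) (D * \<mu>\<^sup>2)"
proof
  let ?\<gamma> = "- \<mu> * tan (\<mu> * L)"
  have "0 \<le> tan (\<mu> * L)"
  proof (cases "\<mu> = 0")
    case False
    then show ?thesis using \<mu> L by (intro less_imp_le tan_gt_zero) auto
  qed simp
  then have \<gamma>: "?\<gamma> \<le> 0" using \<mu>(1) by (simp add: mult_nonneg_nonneg)
  show "subspace (L2 L)" by (rule subspace_L2)
  show "complete (L2 L)" by (rule complete_L2)
  show "subspace (robin D L ?\<gamma>)"
  proof (rule subspaceI)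
    show "0 \<in> robin D L ?\<gamma>"
      using robinI[OF H2rep_zero, where L = L and \<gamma> = ?\<gamma> and D = D] by (simp add: cl_zero zero_prod_def)
  next
    fix p q assume pq: "p \<in> robin D L ?\<gamma>" "q \<in> robin D L ?\<gamma>"
    obtain u v g where h: "H2rep L u v g" "v 0 = 0" "v L = ?\<gamma> * u L" and p: "fst p = cl L u" "snd p = D *\<^sub>R cl L g"
      using robinE[of "fst p" "snd p"] pq(1) by (metis prod.collapse)
    obtain u' v' g' where h': "H2rep L u' v' g'" "v' 0 = 0" "v' L = ?\<gamma> * u' L" and q: "fst q = cl L u'" "snd q = D *\<^sub>R cl L g'"
      using robinE[of "fst q" "snd q"] pq(2) by (metis prod.collapse)
    have "p + q = (cl L (\<lambda>z. u z + u' z), D *\<^sub>R cl L (\<lambda>z. g z + g' z))"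
      using H2rep_continuous[OF h(1)] H2rep_continuous[OF h'(1)] p q
      by (simp add: prod_eq_iff cl_add scaleR_add_right)
    also have "\<dots> \<in> robin D L ?\<gamma>"
      by (rule robinI[OF H2rep_add[OF h(1) h'(1)]]) (use h h' in \<open>simp_all add: distrib_left\<close>)
    finally show "p + q \<in> robin D L ?\<gamma>" .
  next
    fix c p assume pq: "p \<in> robin D L ?\<gamma>"
    obtain u v g where h: "H2rep L u v g" "v 0 = 0" "v L = ?\<gamma> * u L" and p: "fst p = cl L u" "snd p = D *\<^sub>R cl L g"
      using robinE[of "fst p" "snd p"] pq by (metis prod.collapse)
    have "c *\<^sub>R p = (cl L (\<lambda>z. c * u z), D *\<^sub>R cl L (\<lambda>z. c * g z))"
      using H2rep_continuous[OF h(1)] p by (simp add: prod_eq_iff cl_scale)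
    also have "\<dots> \<in> robin D L ?\<gamma>"
      by (rule robinI[OF H2rep_scale[OF h(1)]]) (use h in simp_all)
    finally show "c *\<^sub>R p \<in> robin D L ?\<gamma>" .
  qed
  show "robin D L ?\<gamma> \<subseteq> L2 L \<times> L2 L"
  proof safe
    fix x y assume "(x, y) \<in> robin D L ?\<gamma>"
    then obtain u v g where h: "H2rep L u v g" and x: "x = cl L u" "y = D *\<^sub>R cl L g"
      by (rule robinE)
    show "x \<in> L2 L" "y \<in> L2 L"
      using H2rep_continuous[OF h] by (simp_all add: x subspace_scale[OF subspace_L2])
  qed
  show "y = 0" if "(0, y) \<in> robin D L ?\<gamma>" for y
  proof -
    from that obtain u v g where h: "H2rep L u v g" and x: "0 = cl L u" "y = D *\<^sub>R cl L g"
      by (rule robinE)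
    have "cl L g = wderiv L (wderiv L 0)" using H2_cl(3)[OF h L] x by simp
    also have "\<dots> = 0" using H2_cl(3)[OF H2rep_zero L] by (simp add: cl_zero)
    finally show ?thesis using x(2) by simp
  qed
  show "0 \<le> D * \<mu>\<^sup>2" using D by simp
  show "y \<bullet> x \<le> - (D * \<mu>\<^sup>2) * (norm x)\<^sup>2" if "(x, y) \<in> robin D L ?\<gamma>" for x y
    by (rule robin_dissipative[OF D L \<mu> that])
  show "\<exists>x y. (x, y) \<in> robin D L ?\<gamma> \<and> x - h *\<^sub>R y = f" if h: "0 < h" and f: "f \<in> L2 L" for h f
  proof -
    obtain w where w: "sqi L w" "f = cl L w" using f by (rule L2_cases)
    show ?thesis
      using robin_resolvent[OF w(1) L D h \<gamma>] w(2) by metis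
  qed
qed

section \<open>Positivity, stability and the optimal gain\<close>

lemma L2_pos_subset: "L2_pos L \<subseteq> L2 L"
  by (auto simp: L2_pos_def)

text \<open>The resolvent formula is monotone for functions, so a class that is nonnegative almost
  everywhere is given a representative that is nonnegative everywhere.\<close>

lemma L2_pos_cases:
  assumes "x \<in> L2_pos L"
  obtains f where "sqi L f" "x = cl L f" "\<forall>z. 0 \<le> f z"
proof -
  obtain u where u: "sqi L u" "x = cl L u" using assms L2_pos_subset by (blast elim: L2_cases)
  then have nn: "AE z in lborel. z \<in> {0..L} \<longrightarrow> 0 \<le> u z" using assms by (simp add: L2_pos_def nonneg_cl)
  define f where "f z = max 0 (u z)" for z
  have eq: "AE z in lborel. z \<in> {0..L} \<longrightarrow> u z = f z"
    using nn by eventually_elim (auto simp: f_def)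
  have "zext L f = (\<lambda>z. max 0 (zext L u z))"
    by (auto simp: zext_def f_def indicator_def)
  then have "zext L f \<in> borel_measurable borel"
    using sqi_measurable[OF u(1)] by simp
  then have f: "sqi L f" using sqi_cong_AE[OF u(1)] eq by blast
  then have "x = cl L f" using cl_eq_iff[OF u(1) f] eq u by blast
  with f show ?thesis by (rule that) (simp add: f_def)
qed

lemma cl_pos: "sqi L u \<Longrightarrow> (\<And>z. z \<in> {0..L} \<Longrightarrow> 0 \<le> u z) \<Longrightarrow> cl L u \<in> L2_pos L"
  by (simp add: L2_pos_def nonneg_cl)

lemma robin_J_domination:
  assumes N: "m_dissipative (L2 L) (robin D L 0) \<omega>" and B: "m_dissipative (L2 L) (robin D L \<gamma>) \<omega>'"
    and L: "0 < L" and D: "0 < D" and \<gamma>: "\<gamma> \<le> 0" and h: "0 \<le> h" and x: "x \<in> L2_pos L"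
  shows "m_dissipative.J (robin D L \<gamma>) h x \<in> L2_pos L"
    and "m_dissipative.J (robin D L 0) h x - m_dissipative.J (robin D L \<gamma>) h x \<in> L2_pos L"
proof -
  have "m_dissipative.J (robin D L \<gamma>) h x \<in> L2_pos L \<and>
    m_dissipative.J (robin D L 0) h x - m_dissipative.J (robin D L \<gamma>) h x \<in> L2_pos L"
  proof (cases "h = 0")
    case True
    have "cl L (\<lambda>_. 0) \<in> L2_pos L" by (rule cl_pos) (auto intro: sqi_continuous)
    with True show ?thesis
      using x m_dissipative.J_0[OF N] m_dissipative.J_0[OF B] by (simp add: cl_zero)
  next
    case False
    then have h: "0 < h" using h by simp
    obtain f where f: "sqi L f" "x = cl L f" "\<forall>z. 0 \<le> f z" by (rule L2_pos_cases[OF x])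
    define \<kappa> where "\<kappa> = 1 / sqrt (h * D)"
    have \<kappa>: "0 < \<kappa>" using h D by (simp add: \<kappa>_def)
    let ?uB = "resolvent_fun \<kappa> L \<gamma> f" and ?uN = "resolvent_fun \<kappa> L 0 f"
    obtain y where y: "(cl L ?uB, y) \<in> robin D L \<gamma>" "cl L ?uB - h *\<^sub>R y = cl L f" "sqi L ?uB"
      using robin_resolvent[OF f(1) L D h \<gamma>] unfolding \<kappa>_def by blast
    obtain y' where y': "(cl L ?uN, y') \<in> robin D L 0" "cl L ?uN - h *\<^sub>R y' = cl L f" "sqi L ?uN"
      using robin_resolvent[OF f(1) L D h order_refl] unfolding \<kappa>_def by blast
    have JB: "m_dissipative.J (robin D L \<gamma>) h x = cl L ?uB"
      using m_dissipative.J_eqI[OF B y(1) less_imp_le[OF h]] y(2) f(2) by simp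
    have JN: "m_dissipative.J (robin D L 0) h x = cl L ?uN"
      using m_dissipative.J_eqI[OF N y'(1) less_imp_le[OF h]] y'(2) f(2) by simp
    note mono = resolvent_fun_mono[OF f(1) f(3)[rule_format] L \<kappa> \<gamma>]
    have "cl L ?uB \<in> L2_pos L"
      by (rule cl_pos[OF y(3)]) (rule mono(1))
    moreover have "cl L (\<lambda>z. ?uN z - ?uB z) \<in> L2_pos L"
      by (rule cl_pos[OF sqi_diff[OF y'(3) y(3)]]) (use mono(2) in simp)
    ultimately show ?thesis
      using y(3) y'(3) by (simp add: JB JN cl_diff)
  qed
  then show "m_dissipative.J (robin D L \<gamma>) h x \<in> L2_pos L"
    "m_dissipative.J (robin D L 0) h x - m_dissipative.J (robin D L \<gamma>) h x \<in> L2_pos L" by auto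
qed

text \<open>Domination of powers by induction: with N and B the two resolvents, N^(n+1) - B^(n+1) =
  N (N^n - B^n) + (N - B) B^n, a sum of positive terms. The cone is closed, so the order survives
  the limit.\<close>

lemma robin_T_domination:
  assumes N: "m_dissipative (L2 L) (robin D L 0) \<omega>" and B: "m_dissipative (L2 L) (robin D L \<gamma>) \<omega>'"
    and L: "0 < L" and D: "0 < D" and \<gamma>: "\<gamma> \<le> 0" and t: "0 \<le> t" and x: "x \<in> L2_pos L"
  shows "m_dissipative.T (robin D L \<gamma>) t x \<in> L2_pos L"
    and "m_dissipative.T (robin D L 0) t x - m_dissipative.T (robin D L \<gamma>) t x \<in> L2_pos L"
proof -
  interpret N: m_dissipative "L2 L" "robin D L 0" \<omega> by (rule N)
  interpret B: m_dissipative "L2 L" "robin D L \<gamma>" \<omega>' by (rule B)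
  have xL: "x \<in> L2 L" using x L2_pos_subset by blast
  have pow: "(B.J h ^^ n) x \<in> L2_pos L \<and> (N.J h ^^ n) x - (B.J h ^^ n) x \<in> L2_pos L" if h: "0 \<le> h" for h n
  proof (induction n)
    case 0
    have "cl L (\<lambda>_. 0) \<in> L2_pos L" by (rule cl_pos) (auto intro: sqi_continuous)
    then show ?case using x by (simp add: cl_zero)
  next
    case (Suc n)
    define b d where "b = (B.J h ^^ n) x" and "d = (N.J h ^^ n) x - b"
    have bd: "b \<in> L2_pos L" "d \<in> L2_pos L" using Suc by (auto simp: b_def d_def)
    have L2: "b \<in> L2 L" "d \<in> L2 L" using bd L2_pos_subset by blast+
    \<comment> \<open>The Neumann resolvent is positive as the sum of the Robin one and their
      difference.\<close>
    have "N.J h d \<in> L2_pos L"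
      using L2_pos_add[OF robin_J_domination(2,1)[OF N B L D \<gamma> h bd(2)]] by simp
    moreover have "N.J h b - B.J h b \<in> L2_pos L"
      by (rule robin_J_domination(2)[OF N B L D \<gamma> h bd(1)])
    ultimately have "N.J h d + (N.J h b - B.J h b) \<in> L2_pos L" by (rule L2_pos_add)
    also have "N.J h d + (N.J h b - B.J h b) = N.J h (d + b) - B.J h b"
      using N.J_add[OF h L2(2,1)] by simp
    also have "\<dots> = (N.J h ^^ Suc n) x - (B.J h ^^ Suc n) x"
      by (simp add: d_def b_def)
    finally show ?case
      using robin_J_domination(1)[OF N B L D \<gamma> h bd(1)] by (simp add: b_def)
  qed
  have E: "B.E k t x \<in> L2_pos L" "N.E k t x - B.E k t x \<in> L2_pos L" for k
    using pow[of "t / 2 ^ k" "2 ^ k"] t by (auto simp: B.E_def N.E_def)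
  show "B.T t x \<in> L2_pos L"
    by (rule L2_pos_tendsto[OF E(1) B.E_tendsto[OF xL t] B.T_X[OF xL t]])
  show "N.T t x - B.T t x \<in> L2_pos L"
    by (rule L2_pos_tendsto[OF E(2) tendsto_diff[OF N.E_tendsto[OF xL t] B.E_tendsto[OF xL t]]
        N.X_diff[OF N.T_X[OF xL t] B.T_X[OF xL t]]])
qed

section \<open>The coupled semigroup\<close>

text \<open>The diagonal pair of \<open>S\<close> and \<open>T\<close> in the coordinates (x, x' -
  x), written back in the original coordinates.\<close>

definition triangular :: "(real \<Rightarrow> 'a \<Rightarrow> 'a) \<Rightarrow> (real \<Rightarrow> 'a \<Rightarrow> 'a) \<Rightarrow> real \<Rightarrow> 'a \<times> 'a \<Rightarrow> 'a::ab_group_add \<times> 'a" where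
  "triangular S T t p = (S t (fst p), S t (fst p) + T t (snd p - fst p))"

lemma C0_semigroup_triangular:
  assumes X: "subspace X" and S: "C0_semigroup X S" and T: "C0_semigroup X T"
  shows "C0_semigroup (X \<times> X) (triangular S T)"
proof -
  have Xd: "x - y \<in> X" "x + y \<in> X" "c *\<^sub>R x \<in> X" if "x \<in> X" "y \<in> X" for x y c
    using that X by (auto simp: subspace_diff subspace_add subspace_scale)
  have SX: "S t x \<in> X" "T t x \<in> X" if "0 \<le> t" "x \<in> X" for t x
    using S T that by (auto simp: C0_semigroup_def)
  have add: "S t (x + y) = S t x + S t y" "T t (x + y) = T t x + T t y" if "0 \<le> t" "x \<in> X" "y \<in> X" for t x y
    using S T that by (auto simp: C0_semigroup_def)
  have scale: "S t (c *\<^sub>R x) = c *\<^sub>R S t x" "T t (c *\<^sub>R x) = c *\<^sub>R T t x" if "0 \<le> t" "x \<in> X" for t x c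
    using S T that by (auto simp: C0_semigroup_def)
  have zero: "S 0 x = x" "T 0 x = x" if "x \<in> X" for x
    using S T that by (auto simp: C0_semigroup_def)
  have sg: "S (s + t) x = S s (S t x)" "T (s + t) x = T s (T t x)" if "0 \<le> s" "0 \<le> t" "x \<in> X" for s t x
    using S T that by (auto simp: C0_semigroup_def)
  have lim: "((\<lambda>t. S t x) \<longlongrightarrow> x) (at_right 0)" "((\<lambda>t. T t x) \<longlongrightarrow> x) (at_right 0)" if "x \<in> X" for x
    using S T that by (auto simp: C0_semigroup_def)
  show ?thesis
    unfolding C0_semigroup_def
  proof (intro conjI allI impI ballI)
    fix t :: real and p assume t: "0 \<le> t" and p: "p \<in> X \<times> X"
    then show "triangular S T t p \<in> X \<times> X"
      by (auto simp: triangular_def intro!: Xd SX)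
    fix q assume q: "q \<in> X \<times> X"
    have d: "snd (p + q) - fst (p + q) = (snd p - fst p) + (snd q - fst q)" by simp
    have "T t (snd (p + q) - fst (p + q)) = T t (snd p - fst p) + T t (snd q - fst q)"
      unfolding d using p q by (intro add(2)[OF t] Xd) (auto simp: mem_Times_iff)
    then show "triangular S T t (p + q) = triangular S T t p + triangular S T t q"
      using p q t by (simp add: triangular_def add mem_Times_iff)
  next
    fix t c :: real and p assume t: "0 \<le> t" and p: "p \<in> X \<times> X"
    then show "triangular S T t (c *\<^sub>R p) = c *\<^sub>R triangular S T t p"
      by (simp add: triangular_def scale Xd mem_Times_iff scaleR_add_right flip: scaleR_diff_right)
  next
    fix t :: real assume t: "0 \<le> t"
    have "\<exists>K. \<forall>x\<in>X. norm (S t x) \<le> K * norm x" "\<exists>K. \<forall>x\<in>X. norm (T t x) \<le> K * norm x"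
      using S T t by (simp_all add: C0_semigroup_def)
    then obtain K K' where K: "\<And>x. x \<in> X \<Longrightarrow> norm (S t x) \<le> K * norm x"
      and K': "\<And>x. x \<in> X \<Longrightarrow> norm (T t x) \<le> K' * norm x"
      by blast
    show "\<exists>K. \<forall>p\<in>X \<times> X. norm (triangular S T t p) \<le> K * norm p"
    proof (intro exI ballI)
      fix p assume p: "p \<in> X \<times> X"
      have f: "norm (fst p) \<le> norm p" "norm (snd p) \<le> norm p"
        by (metis norm_fst_le prod.collapse, metis norm_snd_le prod.collapse)
      have le: "k * a \<le> \<bar>k\<bar> * b" if "0 \<le> a" "a \<le> b" for k a b :: real
        using that by (intro mult_mono) auto
      have "norm (S t (fst p)) \<le> \<bar>K\<bar> * norm p"
        using K[of "fst p"] p le[OF norm_ge_zero f(1), of K] by (auto simp: mem_Times_iff)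
      moreover have "norm (T t (snd p - fst p)) \<le> \<bar>K'\<bar> * (2 * norm p)"
      proof -
        have "norm (snd p - fst p) \<le> 2 * norm p" using f norm_triangle_ineq4[of "snd p" "fst p"] by simp
        from le[OF norm_ge_zero this, of K'] show ?thesis
          using K'[of "snd p - fst p"] p Xd(1)[of "snd p" "fst p"] by (simp add: mem_Times_iff)
      qed
      moreover have "norm (triangular S T t p) \<le> norm (S t (fst p)) + norm (S t (fst p) + T t (snd p - fst p))"
        unfolding triangular_def by (rule norm_Pair_le)
      ultimately show "norm (triangular S T t p) \<le> (2 * \<bar>K\<bar> + 2 * \<bar>K'\<bar>) * norm p"
        using norm_triangle_ineq[of "S t (fst p)" "T t (snd p - fst p)"] by (simp add: algebra_simps)
    qed
  next
    fix p assume p: "p \<in> X \<times> X"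
    then show "triangular S T 0 p = p"
      by (simp add: triangular_def zero Xd mem_Times_iff)
    have "((\<lambda>t. (S t (fst p), S t (fst p) + T t (snd p - fst p))) \<longlongrightarrow> (fst p, fst p + (snd p - fst p))) (at_right 0)"
      using p by (intro tendsto_Pair tendsto_add lim) (auto simp: mem_Times_iff Xd)
    then show "((\<lambda>t. triangular S T t p) \<longlongrightarrow> p) (at_right 0)"
      by (simp add: triangular_def[abs_def])
  next
    fix s t :: real and p assume "0 \<le> s" "0 \<le> t" "p \<in> X \<times> X"
    then show "triangular S T (s + t) p = triangular S T s (triangular S T t p)"
      by (simp add: triangular_def sg Xd mem_Times_iff)
  qed
qed

text \<open>The difference quotient of the pair is (s, s + d), where s and d are the quotients of
  \<open>S\<close> and \<open>T\<close>; it converges exactly when both of them do.\<close>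

lemma generator_triangular:
  assumes X: "subspace X"
  shows "generator (X \<times> X) (triangular S T) =
    {((x, x'), (y, y')). (x, y) \<in> generator X S \<and> (x' - x, y' - y) \<in> generator X T}"
proof (intro set_eqI)
  fix p :: "('a \<times> 'a) \<times> ('a \<times> 'a)"
  obtain x x' y y' where p: "p = ((x, x'), (y, y'))" by (metis prod.collapse)
  define s where "s t = (S t x - x) /\<^sub>R t" for t
  define d where "d t = (T t (x' - x) - (x' - x)) /\<^sub>R t" for t
  have q: "(triangular S T t (x, x') - (x, x')) /\<^sub>R t = (s t, s t + d t)" for t
    by (simp add: triangular_def s_def d_def flip: scaleR_add_right)
  have lim: "((\<lambda>t. (s t, s t + d t)) \<longlongrightarrow> (y, y')) (at_right 0) \<longleftrightarrow>
      (s \<longlongrightarrow> y) (at_right 0) \<and> (d \<longlongrightarrow> y' - y) (at_right 0)"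
  proof
    assume *: "((\<lambda>t. (s t, s t + d t)) \<longlongrightarrow> (y, y')) (at_right 0)"
    have a: "(s \<longlongrightarrow> y) (at_right 0)" using tendsto_fst[OF *] by simp
    have "((\<lambda>t. s t + d t) \<longlongrightarrow> y') (at_right 0)" using tendsto_snd[OF *] by simp
    from tendsto_diff[OF this a] a show "(s \<longlongrightarrow> y) (at_right 0) \<and> (d \<longlongrightarrow> y' - y) (at_right 0)" by simp
  next
    assume *: "(s \<longlongrightarrow> y) (at_right 0) \<and> (d \<longlongrightarrow> y' - y) (at_right 0)"
    then have "((\<lambda>t. (s t, s t + d t)) \<longlongrightarrow> (y, y + (y' - y))) (at_right 0)"
      by (intro tendsto_Pair tendsto_add) auto
    then show "((\<lambda>t. (s t, s t + d t)) \<longlongrightarrow> (y, y')) (at_right 0)" by simp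
  qed
  have X_iff: "a \<in> X \<Longrightarrow> a' - a \<in> X \<longleftrightarrow> a' \<in> X" for a a'
    using subspace_add[OF X, of "a' - a" a] subspace_diff[OF X, of a' a] by auto
  show "p \<in> generator (X \<times> X) (triangular S T) \<longleftrightarrow>
    p \<in> {((x, x'), (y, y')). (x, y) \<in> generator X S \<and> (x' - x, y' - y) \<in> generator X T}"
  proof -
    have "p \<in> generator (X \<times> X) (triangular S T) \<longleftrightarrow> x \<in> X \<and> x' \<in> X \<and> y \<in> X \<and> y' \<in> X \<and>
        ((\<lambda>t. (s t, s t + d t)) \<longlongrightarrow> (y, y')) (at_right 0)"
      unfolding p generator_def mem_Collect_eq prod.case q by auto
    also have "\<dots> \<longleftrightarrow> (x \<in> X \<and> y \<in> X \<and> (s \<longlongrightarrow> y) (at_right 0)) \<and>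
        (x' - x \<in> X \<and> y' - y \<in> X \<and> (d \<longlongrightarrow> y' - y) (at_right 0))"
      unfolding lim using X_iff by blast
    finally show ?thesis
      by (simp add: p generator_def s_def[abs_def] d_def[abs_def])
  qed
qed

lemma admissibleI:
  assumes D: "0 < D" and L: "0 < L" and \<mu>: "0 \<le> \<mu>" "\<mu> * L < pi / 2" and \<alpha>: "0 < \<alpha>" "\<alpha> \<le> D * \<mu>\<^sup>2"
  shows "admissible D L \<alpha> (- \<mu> * tan (\<mu> * L))"
proof -
  let ?\<gamma> = "- \<mu> * tan (\<mu> * L)"
  have N: "m_dissipative (L2 L) (robin D L 0) (D * 0\<^sup>2)"
    using m_dissipative_robin[OF D L, of 0] by simp
  have B: "m_dissipative (L2 L) (robin D L ?\<gamma>) (D * \<mu>\<^sup>2)"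
    by (rule m_dissipative_robin[OF D L \<mu>])
  interpret N: m_dissipative "L2 L" "robin D L 0" "D * 0\<^sup>2" by (rule N)
  interpret B: m_dissipative "L2 L" "robin D L ?\<gamma>" "D * \<mu>\<^sup>2" by (rule B)
  have "0 \<le> tan (\<mu> * L)"
  proof (cases "\<mu> = 0")
    case False
    then show ?thesis using \<mu> L by (intro less_imp_le tan_gt_zero) auto
  qed simp
  then have \<gamma>: "?\<gamma> \<le> 0" using \<mu>(1) by (simp add: mult_nonneg_nonneg)
  have "generates (L2 L \<times> L2 L) (A0 D L ?\<gamma>) (triangular N.T B.T)"
    unfolding generates_def A0_eq_robin[OF L] generator_triangular[OF subspace_L2] N.generator_T B.generator_T
    using C0_semigroup_triangular[OF subspace_L2 N.C0_semigroup_T B.C0_semigroup_T] by simp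
  moreover have "positive_semigroup (L2_pos L \<times> L2_pos L) (triangular N.T B.T)"
    unfolding positive_semigroup_def
  proof (intro allI impI ballI)
    fix t :: real and p assume t: "0 \<le> t" and p: "p \<in> L2_pos L \<times> L2_pos L"
    obtain x x' where x: "p = (x, x')" "x \<in> L2_pos L" "x' \<in> L2_pos L" using p by auto
    have xL: "x \<in> L2 L" "x' \<in> L2 L" using x L2_pos_subset by blast+
    note dom = robin_T_domination[OF N B L D \<gamma> t]
    have "N.T t x \<in> L2_pos L"
      using L2_pos_add[OF dom(2,1)[OF x(2)]] by simp
    \<comment> \<open>Regrouped so that domination applies to \<open>x\<close> and positivity of the
      Robin semigroup to \<open>x'\<close>; the error \<open>x' - x\<close> itself has no
      sign.\<close>
    moreover have "N.T t x + B.T t (x' - x) = (N.T t x - B.T t x) + B.T t x'"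
      using B.T_diff[OF xL(2,1) t] by simp
    then have "N.T t x + B.T t (x' - x) \<in> L2_pos L"
      using L2_pos_add[OF dom(2)[OF x(2)] dom(1)[OF x(3)]] by (rule ssubst)
    ultimately show "triangular N.T B.T t p \<in> L2_pos L \<times> L2_pos L"
      by (simp add: triangular_def x(1))
  qed
  moreover have "generates (L2 L) (conj_op (reflect L) (A_op D L ?\<gamma>)) B.T"
    unfolding conj_A_op_eq_robin[OF L] by (rule B.generates_T)
  moreover have "exp_stable (L2 L) B.T \<beta>" if "\<beta> \<in> {-\<alpha><..0}" for \<beta>
  proof -
    have "\<exists>M\<ge>1. \<forall>t\<ge>0. \<forall>x\<in>L2 L. norm (B.T t x) \<le> M * exp (- (D * \<mu>\<^sup>2) * t) * norm x"
      by (intro exI[of _ 1]) (use B.T_norm in auto)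
    then have "ereal (- (D * \<mu>\<^sup>2)) \<in> {ereal \<omega> | \<omega>. \<exists>M\<ge>1. \<forall>t\<ge>0. \<forall>x\<in>L2 L. norm (B.T t x) \<le> M * exp (\<omega> * t) * norm x}"
      by blast
    then have "growth_bound (L2 L) B.T \<le> ereal (- (D * \<mu>\<^sup>2))"
      unfolding growth_bound_def by (rule Inf_lower)
    also have "\<dots> < ereal \<beta>" using that \<alpha> by simp
    finally show ?thesis by (simp add: exp_stable_def)
  qed
  ultimately show ?thesis
    unfolding admissible_def by blast
qed

section \<open>Eigenvalues and exponential stability\<close>

text \<open>\<open>exp (- \<nu> t) T t e - e\<close> is \<open>o(t)\<close> at 0; the uniform bound on \<open>T\<close> lets one sum the
  errors of \<open>n\<close> steps of length \<open>t / n\<close>.\<close>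

lemma semigroup_eigenvector:
  fixes e :: "'a::real_normed_vector"
  assumes gen: "generates X A T" and e: "(e, \<nu> *\<^sub>R e) \<in> A"
    and bd: "\<And>t x. 0 \<le> t \<Longrightarrow> x \<in> X \<Longrightarrow> norm (T t x) \<le> M * exp (\<omega> * t) * norm x" and M: "1 \<le> M"
    and X: "subspace X" and t: "0 \<le> t"
  shows "T t e = exp (\<nu> * t) *\<^sub>R e"
proof (cases "t = 0")
  case True
  have "e \<in> X" "C0_semigroup X T" using gen e by (auto simp: generates_def generator_def)
  then show ?thesis using True by (auto simp: C0_semigroup_def)
next
  case False
  then have t: "0 < t" using t by simp
  have eX: "e \<in> X" and C: "C0_semigroup X T" and lim: "((\<lambda>t. (T t e - e) /\<^sub>R t) \<longlongrightarrow> \<nu> *\<^sub>R e) (at_right 0)"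
    using gen e by (auto simp: generates_def generator_def)
  have TX: "T s x \<in> X" if "0 \<le> s" "x \<in> X" for s x using C that by (auto simp: C0_semigroup_def)
  have sc: "T s (c *\<^sub>R x) = c *\<^sub>R T s x" if "0 \<le> s" "x \<in> X" for s c x
    using C that by (auto simp: C0_semigroup_def)
  have ad: "T s (x + y) = T s x + T s y" if "0 \<le> s" "x \<in> X" "y \<in> X" for s x y
    using C that by (auto simp: C0_semigroup_def)
  have sg: "T (s + r) x = T s (T r x)" if "0 \<le> s" "0 \<le> r" "x \<in> X" for s r x
    using C that by (auto simp: C0_semigroup_def)
  have T0: "T 0 x = x" if "x \<in> X" for x using C that by (auto simp: C0_semigroup_def)
  define z where "z s = exp (- \<nu> * s) *\<^sub>R T s e - e" for s
  have zX: "z s \<in> X" if "0 \<le> s" for s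
    using TX[OF that eX] eX X by (auto simp: z_def intro!: subspace_diff subspace_scale)
  have "((\<lambda>s. exp (- \<nu> * s) *\<^sub>R ((T s e - e) /\<^sub>R s) + ((exp (- \<nu> * s) - 1) / s) *\<^sub>R e)
      \<longlongrightarrow> exp (- \<nu> * 0) *\<^sub>R (\<nu> *\<^sub>R e) + (- \<nu>) *\<^sub>R e) (at_right 0)"
  proof (intro tendsto_add lim tendsto_scaleR tendsto_const)
    show "((\<lambda>s. exp (- \<nu> * s)) \<longlongrightarrow> exp (- \<nu> * 0)) (at_right 0)"
      by (intro tendsto_intros)
    have "((\<lambda>s. exp (- \<nu> * s)) has_real_derivative - \<nu>) (at 0)"
      by (auto intro!: derivative_eq_intros)
    then have "((\<lambda>s. (exp (- \<nu> * s) - 1) / s) \<longlongrightarrow> - \<nu>) (at 0)"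
      by (simp add: has_field_derivative_iff)
    then show "((\<lambda>s. (exp (- \<nu> * s) - 1) / s) \<longlongrightarrow> - \<nu>) (at_right 0)"
      by (rule filterlim_mono[OF _ order_refl at_le]) simp
  qed
  moreover have "exp (- \<nu> * s) *\<^sub>R ((T s e - e) /\<^sub>R s) + ((exp (- \<nu> * s) - 1) / s) *\<^sub>R e = z s /\<^sub>R s" for s
  proof -
    have "exp (- \<nu> * s) *\<^sub>R ((T s e - e) /\<^sub>R s) + ((exp (- \<nu> * s) - 1) / s) *\<^sub>R e
        = (exp (- \<nu> * s) *\<^sub>R (T s e - e) + (exp (- \<nu> * s) - 1) *\<^sub>R e) /\<^sub>R s"
      by (simp add: divide_inverse scaleR_add_right mult.commute)
    also have "exp (- \<nu> * s) *\<^sub>R (T s e - e) + (exp (- \<nu> * s) - 1) *\<^sub>R e = z s"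
      by (simp add: z_def scaleR_diff_right scaleR_diff_left)
    finally show ?thesis .
  qed
  ultimately have z0: "((\<lambda>s. z s /\<^sub>R s) \<longlongrightarrow> 0) (at_right 0)" by simp
  \<comment> \<open>A bound for the rescaled semigroup exp (- \<nu> s) T s that holds on all of
    [0, t]; absolute values serve for either sign of the exponents.\<close>
  define K where "K = M * exp ((\<bar>\<omega>\<bar> + \<bar>\<nu>\<bar>) * t)"
  have K: "norm (exp (- \<nu> * s) *\<^sub>R T s x) \<le> K * norm x" if "0 \<le> s" "s \<le> t" "x \<in> X" for s x
  proof -
    have "norm (exp (- \<nu> * s) *\<^sub>R T s x) \<le> exp (- \<nu> * s) * (M * exp (\<omega> * s) * norm x)"
      using bd[OF that(1,3)] by simp
    also have "\<dots> = M * exp ((\<omega> - \<nu>) * s) * norm x"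
      by (simp add: left_diff_distrib exp_diff exp_minus field_simps)
    also have "\<dots> \<le> K * norm x"
      unfolding K_def
    proof (intro mult_right_mono mult_left_mono)
      have "(\<omega> - \<nu>) * s \<le> (\<bar>\<omega>\<bar> + \<bar>\<nu>\<bar>) * t" using that by (intro mult_mono) auto
      then show "exp ((\<omega> - \<nu>) * s) \<le> exp ((\<bar>\<omega>\<bar> + \<bar>\<nu>\<bar>) * t)" by simp
    qed (use M in auto)
    finally show ?thesis .
  qed
  have step: "norm (z (real n * s)) \<le> real n * (K * norm (z s))" if s: "0 \<le> s" and "real n * s \<le> t" for n s
    using that(2)
  proof (induction n)
    case (Suc n)
    have ns: "0 \<le> real n * s" "real n * s \<le> t" using Suc.prems s by (auto simp: algebra_simps)
    have "T (real (Suc n) * s) e = T (real n * s) (T s e)"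
      using sg[OF ns(1) s eX] by (simp add: algebra_simps)
    also have "T s e = exp (\<nu> * s) *\<^sub>R (z s + e)"
      by (simp add: z_def exp_add[symmetric])
    also have "T (real n * s) \<dots> = exp (\<nu> * s) *\<^sub>R (T (real n * s) (z s) + T (real n * s) e)"
      using ns zX[OF s] eX X by (simp add: ad sc subspace_add)
    finally have "exp (- \<nu> * (real (Suc n) * s)) *\<^sub>R T (real (Suc n) * s) e
        = exp (- \<nu> * (real n * s)) *\<^sub>R (T (real n * s) (z s) + T (real n * s) e)"
      by (simp add: exp_add[symmetric] algebra_simps)
    \<comment> \<open>The cocycle identity: the error of one step, transported by the rescaled
      semigroup, plus the error accumulated so far.\<close>
    then have "z (real (Suc n) * s) = exp (- \<nu> * (real n * s)) *\<^sub>R T (real n * s) (z s) + z (real n * s)"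
      unfolding z_def[of "real (Suc n) * s"] z_def[of "real n * s"] by (simp add: scaleR_add_right)
    also have "norm \<dots> \<le> K * norm (z s) + real n * (K * norm (z s))"
      using K[OF ns zX[OF s]] Suc.IH[OF ns(2)] by (intro norm_triangle_le add_mono)
    finally show ?case by (simp add: algebra_simps)
  qed (simp add: z_def T0 eX)
  have "filterlim (\<lambda>n. t / real (Suc n)) (at_right 0) sequentially"
  proof -
    have "(\<lambda>n. t / real (Suc n)) \<longlonglongrightarrow> 0"
      using tendsto_mult_right_zero[OF LIMSEQ_inverse_real_of_nat, of t] by (simp add: divide_inverse)
    then show ?thesis using t by (auto simp: filterlim_at)
  qed
  from tendsto_norm_zero[OF filterlim_compose[OF z0 this]]
  have lim0: "(\<lambda>n. K * t * norm (z (t / real (Suc n)) /\<^sub>R (t / real (Suc n)))) \<longlonglongrightarrow> 0"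
    by (rule tendsto_mult_right_zero)
  have "norm (z t) \<le> K * t * norm (z (t / real (Suc n)) /\<^sub>R (t / real (Suc n)))" for n
  proof -
    have "norm (z (real (Suc n) * (t / real (Suc n)))) \<le> real (Suc n) * (K * norm (z (t / real (Suc n))))"
      using t by (intro step) (simp_all del: of_nat_Suc)
    \<comment> \<open>The number of steps is t divided by the step length, so the accumulated error
      is a multiple of the difference quotient of \<open>z\<close>, which tends to 0.\<close>
    also have "\<dots> = K * t * norm (z (t / real (Suc n)) /\<^sub>R (t / real (Suc n)))"
      using t by (simp del: of_nat_Suc)
    finally show ?thesis by (simp del: of_nat_Suc)
  qed
  then have "norm (z t) \<le> 0"
    by (intro LIMSEQ_le_const[OF lim0]) auto
  then have "exp (- \<nu> * t) *\<^sub>R T t e = e" by (simp add: z_def)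
  then have "exp (\<nu> * t) *\<^sub>R (exp (- \<nu> * t) *\<^sub>R T t e) = exp (\<nu> * t) *\<^sub>R e" by simp
  then show ?thesis by (simp add: exp_add[symmetric])
qed

text \<open>On the eigenvector the semigroup is multiplication by exp (\<nu> t), so every exponent
  in a growth estimate is at least \<nu>.\<close>

lemma eigenvalue_le_of_stable:
  fixes e :: "'a::real_normed_vector"
  assumes gen: "generates X A T" and e: "(e, \<nu> *\<^sub>R e) \<in> A" "e \<noteq> 0" and X: "subspace X"
    and st: "\<And>\<beta>. \<beta> \<in> {-\<alpha><..0} \<Longrightarrow> exp_stable X T \<beta>" and \<alpha>: "0 < \<alpha>"
  shows "\<nu> \<le> - \<alpha>"
proof -
  have "\<nu> < \<beta>" if \<beta>: "\<beta> \<in> {-\<alpha><..0}" for \<beta>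
  proof -
    have "growth_bound X T < ereal \<beta>" using st[OF \<beta>] by (simp add: exp_stable_def)
    then obtain \<omega> M where \<omega>: "\<omega> < \<beta>" and M: "1 \<le> M"
      and bd: "\<And>t x. 0 \<le> t \<Longrightarrow> x \<in> X \<Longrightarrow> norm (T t x) \<le> M * exp (\<omega> * t) * norm x"
      unfolding growth_bound_def Inf_less_iff by auto
    have eX: "e \<in> X" using gen e by (auto simp: generates_def generator_def)
    have *: "exp ((\<nu> - \<omega>) * t) \<le> M" if t: "0 \<le> t" for t
    proof -
      have "T t e = exp (\<nu> * t) *\<^sub>R e"
        by (rule semigroup_eigenvector[OF gen e(1) bd M X t])
      then have "exp (\<nu> * t) * norm e \<le> M * exp (\<omega> * t) * norm e"
        using bd[OF t eX] by simp
      then have "exp (\<nu> * t) \<le> M * exp (\<omega> * t)" using e(2) by simp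
      then show ?thesis by (simp add: left_diff_distrib exp_diff divide_le_eq)
    qed
    have "\<nu> \<le> \<omega>"
    proof (rule ccontr)
      assume "\<not> \<nu> \<le> \<omega>"
      then have p: "0 < \<nu> - \<omega>" by simp
      \<comment> \<open>The time M / (\<nu> - \<omega>) is chosen so that the linear lower bound for
        exp already yields 1 + M \<le> M.\<close>
      have "1 + (\<nu> - \<omega>) * (M / (\<nu> - \<omega>)) \<le> exp ((\<nu> - \<omega>) * (M / (\<nu> - \<omega>)))"
        by (rule exp_ge_add_one_self)
      also have "\<dots> \<le> M" using p M by (intro *) simp
      finally show False using p by simp
    qed
    with \<omega> show ?thesis by simp
  qed
  note * = this
  show ?thesis
  proof (rule ccontr)
    assume "\<not> \<nu> \<le> - \<alpha>"
    \<comment> \<open>The witness min \<nu> 0 lies in (- \<alpha>, 0], and being strictly above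
      \<nu> is impossible for it.\<close>
    then have "\<nu> < min \<nu> 0" using \<alpha> by (intro *) auto
    then show False by simp
  qed
qed

text \<open>The value at 0 serves to see that the class of \<open>u\<close> is not zero; cosh and
  cos both equal 1 there.\<close>

lemma robin_eigenfunction:
  assumes L: "0 < L" and u: "\<And>z. (u has_real_derivative v z) (at z)" "\<And>z. (v has_real_derivative c * u z) (at z)"
    and b: "v 0 = 0" "v L = \<gamma> * u L" and u0: "u 0 \<noteq> 0"
  shows "(cl L u, (D * c) *\<^sub>R cl L u) \<in> robin D L \<gamma>" "cl L u \<noteq> 0"
proof -
  have cu: "continuous_on S u" for S
    by (rule DERIV_continuous_on[OF has_field_derivative_at_within[OF u(1)]])
  have "H2rep L u v (\<lambda>z. c * u z)"
    by (rule H2rep_C2[OF u]) (intro continuous_intros cu)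
  from robinI[OF this b, of D] show "(cl L u, (D * c) *\<^sub>R cl L u) \<in> robin D L \<gamma>"
    by (simp add: cl_scale sqi_continuous cu)
  show "cl L u \<noteq> 0"
  proof
    assume "cl L u = 0"
    then have "cl L u = cl L (\<lambda>_. 0)" by (simp add: cl_zero)
    then have "u 0 = 0"
      using continuous_cl_eq_imp_eq[OF L cu[of "{0..L}"] continuous_on_const] L by simp
    with u0 show False by simp
  qed
qed

lemma admissibleD:
  assumes D: "0 < D" and L: "0 < L" and \<alpha>: "0 < \<alpha>" and ad: "admissible D L \<alpha> \<gamma>"
  obtains \<mu> where "0 < \<mu>" "\<mu> * L < pi / 2" "\<gamma> = - \<mu> * tan (\<mu> * L)" "\<alpha> \<le> D * \<mu>\<^sup>2"
proof -
  obtain T where T: "generates (L2 L) (robin D L \<gamma>) T" "\<And>\<beta>. \<beta> \<in> {-\<alpha><..0} \<Longrightarrow> exp_stable (L2 L) T \<beta>"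
    using ad unfolding admissible_def conj_A_op_eq_robin[OF L] by blast
  have ev: "D * c \<le> - \<alpha>" if "\<And>z. (u has_real_derivative v z) (at z)" "\<And>z. (v has_real_derivative c * u z) (at z)"
    "v 0 = 0" "v L = \<gamma> * u L" "u 0 \<noteq> 0" for u v c
    by (rule eigenvalue_le_of_stable[OF T(1) robin_eigenfunction[OF L that] subspace_L2 T(2) \<alpha>])
  have "\<gamma> < 0"
  proof (rule ccontr)
    assume "\<not> \<gamma> < 0"
    then have \<gamma>: "0 \<le> \<gamma>" by simp
    define f where "f x = x * sinh (x * L) - \<gamma> * cosh (x * L)" for x
    \<comment> \<open>Large enough for the intermediate value theorem: b L \<ge> 1 gives tanh (b L)
      \<ge> 1/2, since exp 2 \<ge> 3, and \<gamma> \<le> b / 2 absorbs the factor 2.\<close>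
    define b where "b = 2 * \<gamma> + 1 / L"
    have b: "0 < b" "1 \<le> b * L" "2 * \<gamma> \<le> b" using \<gamma> L by (simp_all add: b_def distrib_right add_nonneg_pos)
    have "cosh (b * L) \<le> 2 * sinh (b * L)"
    proof -
      have "3 \<le> 1 + 2 * (b * L)" using b(2) by simp
      also have "\<dots> \<le> exp (2 * (b * L))" by (rule exp_ge_add_one_self)
      also have "\<dots> = exp (b * L) * exp (b * L)" by (simp add: exp_add[symmetric])
      finally have "3 * exp (- (b * L)) \<le> exp (b * L) * exp (b * L) * exp (- (b * L))"
        by (intro mult_right_mono) auto
      also have "\<dots> = exp (b * L)" by (simp add: mult.assoc exp_add[symmetric])
      finally show ?thesis by (simp add: cosh_def sinh_def field_simps)
    qed
    then have "\<gamma> * cosh (b * L) \<le> (b / 2) * (2 * sinh (b * L))"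
      using b \<gamma> by (intro mult_mono) auto
    then have "0 \<le> f b" by (simp add: f_def)
    moreover have "f 0 \<le> 0" using \<gamma> by (simp add: f_def)
    moreover have "continuous_on {0..b} f" unfolding f_def by (intro continuous_intros)
    \<comment> \<open>For \<gamma> = 0 the root is 0 and the eigenfunction used below is the
      constant 1, with eigenvalue 0.\<close>
    ultimately obtain x where x: "0 \<le> x" "f x = 0"
      using IVT'[of f 0 0 b] b(1) by auto
    have "D * x\<^sup>2 \<le> - \<alpha>"
    proof (rule ev)
      show "((\<lambda>z. cosh (x * z)) has_real_derivative x * sinh (x * z)) (at z)" for z
        by (auto intro!: derivative_eq_intros)
      show "((\<lambda>z. x * sinh (x * z)) has_real_derivative x\<^sup>2 * cosh (x * z)) (at z)" for z
        by (auto intro!: derivative_eq_intros simp: power2_eq_square)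
    qed (use x in \<open>auto simp: f_def\<close>)
    moreover have "0 \<le> D * x\<^sup>2" using D by simp
    ultimately show False using \<alpha> by simp
  qed
  \<comment> \<open>The equation \<gamma> = - x tan (x L) multiplied by the cosine. This removes the
    pole, so the interval can be closed at \<pi> / (2 L).\<close>
  define f where "f x = x * sin (x * L) + \<gamma> * cos (x * L)" for x
  define b where "b = pi / (2 * L)"
  have bL: "b * L = pi / 2" "0 < b" using L by (auto simp: b_def)
  have fb: "f b = b" unfolding f_def bL(1) by simp
  have "f 0 \<le> 0" "0 \<le> f b" using \<open>\<gamma> < 0\<close> bL(2) by (simp_all add: fb) (simp add: f_def)
  moreover have "continuous_on {0..b} f" unfolding f_def by (intro continuous_intros)
  \<comment> \<open>The root is interior because f is \<gamma> < 0 at the left end and b > 0 at the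
    right end.\<close>
  ultimately obtain \<mu> where \<mu>: "0 \<le> \<mu>" "\<mu> \<le> b" "f \<mu> = 0"
    using IVT'[of f 0 0 b] bL(2) by auto
  have "\<mu> \<noteq> 0" using \<mu>(3) \<open>\<gamma> < 0\<close> by (auto simp: f_def)
  moreover have "\<mu> \<noteq> b" using \<mu>(3) bL(2) fb by auto
  ultimately have \<mu>': "0 < \<mu>" "\<mu> < b" using \<mu> by auto
  then have lt: "\<mu> * L < pi / 2" unfolding bL(1)[symmetric] using L by (intro mult_strict_right_mono)
  have "0 < cos (\<mu> * L)" using \<mu>' L lt by (intro cos_gt_zero) auto
  then have \<gamma>: "\<gamma> = - \<mu> * tan (\<mu> * L)"
    using \<mu>(3) by (simp add: f_def tan_def field_simps)
  have "D * (- \<mu>\<^sup>2) \<le> - \<alpha>"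
  proof (rule ev)
    show "((\<lambda>z. cos (\<mu> * z)) has_real_derivative - \<mu> * sin (\<mu> * z)) (at z)" for z
      by (auto intro!: derivative_eq_intros)
    show "((\<lambda>z. - \<mu> * sin (\<mu> * z)) has_real_derivative - \<mu>\<^sup>2 * cos (\<mu> * z)) (at z)" for z
      by (auto intro!: derivative_eq_intros simp: power2_eq_square)
  qed (use \<mu>(3) in \<open>auto simp: f_def\<close>)
  then show ?thesis using that[OF \<mu>'(1) lt \<gamma>] by simp
qed

section \<open>Feasibility and the unique minimizer\<close>

theorem theorem10:
  fixes D\<^sub>a L \<alpha> :: real
  assumes "D\<^sub>a > 0" and "L > 0" and "\<alpha> > 0"
  shows "((\<exists>\<gamma>. admissible D\<^sub>a L \<alpha> \<gamma>) \<longleftrightarrow> \<alpha> < pi\<^sup>2 * D\<^sub>a / (4 * L\<^sup>2)) \<and>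
    (\<alpha> < pi\<^sup>2 * D\<^sub>a / (4 * L\<^sup>2) \<longrightarrow>
      (\<forall>\<gamma>. is_arg_min (\<lambda>\<gamma>. \<gamma>\<^sup>2) (admissible D\<^sub>a L \<alpha>) \<gamma> \<longleftrightarrow>
           \<gamma> = - sqrt (\<alpha> / D\<^sub>a) * tan (L * sqrt (\<alpha> / D\<^sub>a))))"
proof -
  \<comment> \<open>The frequency at which the eigenvalue - D m^2 equals - \<alpha> exactly.\<close>
  define m where "m = sqrt (\<alpha> / D\<^sub>a)"
  have m: "0 < m" "D\<^sub>a * m\<^sup>2 = \<alpha>" using assms by (auto simp: m_def)
  define \<gamma>0 where "\<gamma>0 = - m * tan (m * L)"
  have crit: "\<alpha> < pi\<^sup>2 * D\<^sub>a / (4 * L\<^sup>2) \<longleftrightarrow> m * L < pi / 2"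
  proof -
    have "\<alpha> < pi\<^sup>2 * D\<^sub>a / (4 * L\<^sup>2) \<longleftrightarrow> D\<^sub>a * (m * L)\<^sup>2 < D\<^sub>a * (pi / 2)\<^sup>2"
      using assms by (simp add: m(2)[symmetric] field_simps power2_eq_square)
    also have "\<dots> \<longleftrightarrow> (m * L)\<^sup>2 < (pi / 2)\<^sup>2" using assms by simp
    also have "\<dots> \<longleftrightarrow> m * L < pi / 2"
      using power_mono_iff[of "pi / 2" "m * L" 2] m(1) assms(2) by (simp add: linorder_not_le[symmetric])
    finally show ?thesis .
  qed
  \<comment> \<open>The function \<mu> tan (\<mu> L) increases on (0, \<pi> / (2 L)), so the
    requirement \<mu> \<ge> m caps the gain.\<close>
  have nec: "m * L < pi / 2 \<and> \<gamma> \<le> \<gamma>0" if "admissible D\<^sub>a L \<alpha> \<gamma>" for \<gamma>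
  proof -
    from that obtain \<mu> where \<mu>: "0 < \<mu>" "\<mu> * L < pi / 2" "\<gamma> = - \<mu> * tan (\<mu> * L)" "\<alpha> \<le> D\<^sub>a * \<mu>\<^sup>2"
      by (rule admissibleD[OF assms])
    have "m\<^sup>2 \<le> \<mu>\<^sup>2" using \<mu>(4) m(2) assms(1) by (metis mult_le_cancel_left_pos)
    then have le: "m \<le> \<mu>" by (rule power2_le_imp_le) (use \<mu>(1) in simp)
    then have mL: "m * L \<le> \<mu> * L" using assms(2) by simp
    then have lt: "m * L < pi / 2" using \<mu>(2) by simp
    have "0 < m * L" using m(1) assms(2) by simp
    then have "0 < tan (m * L)" using lt by (intro tan_gt_zero) auto
    moreover have "tan (m * L) \<le> tan (\<mu> * L)"
      using mL \<mu>(2) \<open>0 < m * L\<close> by (intro tan_mono_le) auto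
    ultimately have "m * tan (m * L) \<le> \<mu> * tan (\<mu> * L)"
      using le m(1) by (intro mult_mono) auto
    then show ?thesis using lt by (simp add: \<gamma>0_def \<mu>(3))
  qed
  have suf: "admissible D\<^sub>a L \<alpha> \<gamma>0" if "m * L < pi / 2"
    unfolding \<gamma>0_def using that m assms by (intro admissibleI) auto
  have "is_arg_min (\<lambda>\<gamma>. \<gamma>\<^sup>2) (admissible D\<^sub>a L \<alpha>) \<gamma> \<longleftrightarrow> \<gamma> = \<gamma>0" if mL: "m * L < pi / 2" for \<gamma>
  proof -
    have "0 < m * L" using m(1) assms(2) by simp
    then have "\<gamma>0 < 0" using m(1) mL by (simp add: \<gamma>0_def tan_gt_zero)
    \<comment> \<open>To the left of the negative number \<open>\<gamma>0\<close> squaring reverses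
      the order, so the largest admissible gain has the smallest square; strictness gives
      uniqueness.\<close>
    then have sq: "\<gamma>0\<^sup>2 < x\<^sup>2 \<longleftrightarrow> x \<noteq> \<gamma>0" "\<gamma>0\<^sup>2 \<le> x\<^sup>2" if "x \<le> \<gamma>0" for x
    proof -
      show "\<gamma>0\<^sup>2 \<le> x\<^sup>2"
        using power_mono[of "- \<gamma>0" "- x" 2] that \<open>\<gamma>0 < 0\<close> by simp
      show "\<gamma>0\<^sup>2 < x\<^sup>2 \<longleftrightarrow> x \<noteq> \<gamma>0"
        using power_strict_mono[of "- \<gamma>0" "- x" 2] that \<open>\<gamma>0 < 0\<close> by (cases "x = \<gamma>0") auto
    qed
    show ?thesis
    proof
      assume a: "is_arg_min (\<lambda>\<gamma>. \<gamma>\<^sup>2) (admissible D\<^sub>a L \<alpha>) \<gamma>"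
      then have "admissible D\<^sub>a L \<alpha> \<gamma>" "\<not> \<gamma>0\<^sup>2 < \<gamma>\<^sup>2"
        using suf[OF mL] by (auto simp: is_arg_min_def)
      then show "\<gamma> = \<gamma>0" using sq(1)[of \<gamma>] nec[of \<gamma>] by blast
    next
      assume "\<gamma> = \<gamma>0"
      moreover have "\<not> y\<^sup>2 < \<gamma>0\<^sup>2" if "admissible D\<^sub>a L \<alpha> y" for y
        using sq(2)[of y] nec[OF that] by simp
      ultimately show "is_arg_min (\<lambda>\<gamma>. \<gamma>\<^sup>2) (admissible D\<^sub>a L \<alpha>) \<gamma>"
        using suf[OF mL] by (auto simp: is_arg_min_def)
    qed
  qed
  then show ?thesis
    unfolding crit using suf nec by (auto simp: \<gamma>0_def m_def mult.commute)
qed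

end
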